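(* Let $G,H$ be finite directed graphs and $\xi=(\xi^0,\xi^1)$ a pair of graph embeddings $H\to G$ satisfying the standing hypotheses. 1. The map $\pi_\xi:(X_G,d_G,\sigma)\to(X_\xi,d_\xi,\sigma_\xi)$ is a factor map. 2. For all $x,y\in X_G$ with $d_G(x,y)\le2^{-3}$, both $[x,y]$ and $[\pi_\xi(x),\pi_\xi(y)]$ are defined and $\pi_\xi[x,y]=[\pi_\xi(x),\pi_\xi(y)]$. 3. Points $x,y\in X_G$ satisfy $\pi_\xi(x)=\pi_\xi(y)$ if and only if exactly one of the following holds: (a) $x=y$; (b) there are $j\in\{0,1\}$ and $z\in X_H$ such that $\xi^j(z_n)=x_n$ and $\xi^{1-j}(z_n)=y_n$ for all integers $n$; (c) there are an integer $m$, $j\in\{0,1\}$ and $z\in X_H$ such that (i) $x_n=y_n$ for all $n<m$, (ii) $x_m=y_m$ is not in $\xi(H^1)$, or $\xi^{1-j}(z_m)=x_m$ and $\xi^{j}(z_m)=y_m$, and (iii) $\xi^j(z_n)=x_n$ and $\xi^{1-j}(z_n)=y_n$ for all integers $n>m$. 4. The map $\pi_\xi$ is $s$-bijective; that is, for every $x\in X_G$, the restriction of $\pi_\xi$ to $X_G^s(x)$ is a bijection from $X_G^s(x)$ to $X_\xi^s(\pi_\xi(x))$.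
   Context: **Graphs.** A finite directed graph $G$ consists of finite sets $G^0$ (vertices), $G^1$ (edges) and maps $i,t:G^1\to G^0$ (initial and terminal vertex). $G$ is primitive if there is $k\ge1$ such that for all $v,w\in G^0$ there is a path of length $k$ from $v$ to $w$. $X_G^+$ is the set of sequences $x=(x_n)_{n\ge1}$ in $G^1$ with $t(x_n)=i(x_{n+1})$ for all $n$, with metric $d_G(x,y)=\inf\{2^{-n}: n\ge0,\ x_j=y_j \text{ for }1\le j\le n\}$ and shift $\sigma(x)_n=x_{n+1}$. $X_G$ is the analogous set of sequences indexed by $n\in\mathbb Z$, with metric $d_G(x,y)=\inf\{2^{-n}:n\ge0,\ x_j=y_j\text{ for }1-n\le j\le n\}$ and shift $\sigma(x)_n=x_{n+1}$; $\chi_G^+:X_G\to X_G^+$ restricts a sequence to indices $n\ge1$. $X_H$ is defined in the same way from $H$. For $x,y\in X_G$ with $d_G(x,y)\le2^{-1}$, $[x,y]=(\dots,y_{-1},y_0,x_1,x_2,\dots)$. A graph embedding $H\to G$ is an injective map sending $H^0$ into $G^0$ and $H^1$ into $G^1$ and commuting with $i$ and $t$. **Standing hypotheses** on $(G,H,\xi^0,\xi^1)$: $G$ is primitive; $\xi^0|_{H^0}=\xi^1|_{H^0}$; $\xi^0(H^1)\cap\xi^1(H^1)=\emptyset$; for every $y\in H^1$ there is $x\in G^1\setminus(\xi^0(H^1)\cup\xi^1(H^1))$ with $i(x)=i(\xi^0(y))$, $t(x)=t(\xi^0(y))$. **Notation.** $\xi(H^1)=\xi^0(H^1)\cup\xi^1(H^1)$;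 for $x\in\xi(H^1)$, $\varepsilon(x)\in\{0,1\}$ is such that $x\in\xi^{\varepsilon(x)}(H^1)$. $G_\xi$ is the graph with vertex set $G^0$ and edge set obtained from $G^1$ by identifying $\xi^0(y)$ with $\xi^1(y)$ for each $y\in H^1$; $\tau_\xi$ denotes the quotient map $G^1\to G_\xi^1$ and the induced map $X_G^+\to X_{G_\xi}^+$. For $x\in X_G^+$, $\kappa(x)\in\{0,1,\dots,\infty\}$ is the number of $n\ge1$ with $x_n\notin\xi(H^1)$; $X_k^+=\kappa^{-1}\{k\}$; if $\kappa(x)>0$, $n(x)$ is the least $n\ge 1$ with $x_n\notin\xi(H^1)$. **The relation $\sim_\xi$ on $X_G^+$.** $x\sim_\xi x$ for all $x$; and $x\sim_\xi x'$ if either (1) for some $n\ge1$, $j\in\{0,1\}$, $y_n,y_{n+1},\ldots\in H^1$: $x=(x_1,\dots,x_{n-1},\xi^{1-j}(y_n),\xi^j(y_{n+1}),\xi^j(y_{n+2}),\dots)$ and $x'=(x_1,\dots,x_{n-1},\xi^{j}(y_n),\xi^{1-j}(y_{n+1}),\xi^{1-j}(y_{n+2}),\dots)$; or (2) for some $n\ge0$, $j\in\{0,1\}$, $y_{n+1},y_{n+2},\ldots\in H^1$, where $n=0$ or $x_n\notin\xi(H^1)$: $x=(x_1,\dots,x_n,\xi^j(y_{n+1}),\xi^j(y_{n+2}),\dots)$ and $x'=(x_1,\dots,x_n,\xi^{1-j}(y_{n+1}),\xi^{1-j}(y_{n+2}),\dots)$. This is an equivalence relation. $X_\xi^+=X_G^+/\sim_\xi$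 with the quotient topology, $\pi_\xi:X_G^+\to X_\xi^+$ is the quotient map, and $\sigma_\xi(\pi_\xi(x))=\pi_\xi(\sigma(x))$ (well defined). **The metric on $X_\xi^+$.** On the unit circle $\mathbb T\subset\mathbb C$ let $d_{\mathbb T}(z,w)=\inf\{|s|: s\in\mathbb R,\ e^{2\pi i s}z=w\}$. For $x\in X_G^+$, $\theta(x)=\exp(2\pi i\sum_{j\ge1}\varepsilon(x_j)2^{-j})$ if $\kappa(x)=0$ and $\theta(x)=\exp(2\pi i\sum_{j=1}^{n(x)-1}\varepsilon(x_j)2^{-j})$ if $\kappa(x)>0$. Define $\lambda_k:X_k^+\times X_k^+\to[0,\infty)$ by $\lambda_0(x,y)=d_{\mathbb T}(\theta(x),\theta(y))$ and, for $k\ge1$, $\lambda_k(x,y)=|2^{-n(x)}-2^{-n(y)}|+d_{\mathbb T}(\theta(x),\theta(y))+\delta\,2^{-2-n(x)}\lambda_{k-1}(\sigma^{n(x)}(x),\sigma^{n(y)}(y))$, where $\delta=1$ if $(n(x),\theta(x))=(n(y),\theta(y))$ and $\delta=0$ otherwise. Put $d_k(x,y)=d_{G_\xi}(\tau_\xi(x),\tau_\xi(y))+\lambda_k(x,y)$ on $X_k^+$. The $d_k$, $0\le k<\infty$, have a common continuous extension to a pseudo-metric $d$ on $X_G^+$, given by $d(x,y)=\lim_l d_l(x^l,y^l)$ for any $x^l,y^l\in X_l^+$ with $x^l\to x$, $y^l\to y$ in $d_G$. One has $d(x,y)=0$ iff $x\sim_\xi y$, and $d_\xi(\pi_\xi(x),\pi_\xi(y))=d(x,y)$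 defines a metric on $X_\xi^+$ inducing its topology. **The inverse limit.** $X_\xi=\{(x^0,x^1,\dots): x^n\in X_\xi^+,\ x^n=\sigma_\xi(x^{n+1}),\ n\ge0\}$; $\sigma_\xi(x)^n=\sigma_\xi(x^n)$, a homeomorphism with inverse $\sigma_\xi^{-1}(x)^n=x^{n+1}$; $d_\xi(x,y)=\sup_{n\ge0}2^{-n}d_\xi(x^n,y^n)$. The map $\pi_\xi:X_G\to X_\xi$ is $\pi_\xi(x)^n=\pi_\xi(\chi_G^+(\sigma^{-n}(x)))=\pi_\xi(x_{1-n},x_{2-n},\dots)$, $n\ge0$. A factor map is a continuous surjection intertwining the dynamics. **Bracket on $X_\xi$.** For $x,y\in X_\xi$ with $d_\xi(x,y)\le2^{-1}$, $[x,y]=(z^0,z^1,\dots)\in X_\xi$ is defined inductively: $z^0=x^0$, and $z^{n+1}\in X_\xi^+$ is taken with $\sigma_\xi(z^{n+1})=z^n$ and $d_\xi(z^{n+1},y^{n+1})\le2^{-1}d_\xi(z^n,y^n)\le2^{-n-2}$ (such an element exists). **Stable sets.** For a homeomorphism $\varphi$ of a compact metric space $(X,d)$, $X^s(x)=\{y\in X:\lim_{n\to+\infty}d(\varphi^n(x),\varphi^n(y))=0\}$; $X_G^s(x)$ and $X_\xi^s(x)$ denote these for $(X_G,\sigma)$ and $(X_\xi,\sigma_\xi)$.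
   Formalization: In 3(c), z need only be a path in H where it is constrained (n>m, and n=m in the swapped case), since requiring z in X_H makes "only if" false when H has sources; the version with z in X_H is given when every edge of H is preceded by one. If all X_k^+ (k finite) are empty, d=lim d_l(x,y). *)

theory Defs
  imports "HOL-Analysis.Analysis" "Graph_Theory.Arc_Walk"
begin

text \<open>
  Finite directed graphs are the \<^locale>\<open>fin_digraph\<close>s; multiple arcs and loops are allowed,
  \<^const>\<open>tail\<close> is the initial and \<^const>\<open>head\<close> the terminal vertex of an arc.
\<close>

definition primitive :: "('v, 'e) pre_digraph \<Rightarrow> bool" where
  "primitive G \<longleftrightarrow>
     (\<exists>k\<ge>1. \<forall>v\<in>verts G. \<forall>w\<in>verts G. \<exists>p. pre_digraph.awalk G v p w \<and> length p = k)"

text \<open>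
  One-sided sequences are indexed from 0: the value \<open>x i\<close> is the entry $x_{i+1}$ of the
  usual notation $(x_n)_{n \geq 1}$. Two-sided sequences are functions on the integers.
\<close>

definition one_sided :: "('v, 'e) pre_digraph \<Rightarrow> (nat \<Rightarrow> 'e) set" where
  "one_sided G = {x. \<forall>n. x n \<in> arcs G \<and> head G (x n) = tail G (x (Suc n))}"

definition two_sided :: "('v, 'e) pre_digraph \<Rightarrow> (int \<Rightarrow> 'e) set" where
  "two_sided G = {x. \<forall>n. x n \<in> arcs G \<and> head G (x n) = tail G (x (n + 1))}"

definition dist1 :: "(nat \<Rightarrow> 'a) \<Rightarrow> (nat \<Rightarrow> 'a) \<Rightarrow> real" where
  "dist1 x y = (INF n\<in>{n. \<forall>i<n. x i = y i}. (1/2) ^ n)"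

definition dist2 :: "(int \<Rightarrow> 'a) \<Rightarrow> (int \<Rightarrow> 'a) \<Rightarrow> real" where
  "dist2 x y = (INF n\<in>{n. \<forall>j. 1 - int n \<le> j \<and> j \<le> int n \<longrightarrow> x j = y j}. (1/2) ^ n)"

definition shift1 :: "(nat \<Rightarrow> 'a) \<Rightarrow> nat \<Rightarrow> 'a" where
  "shift1 x = (\<lambda>n. x (Suc n))"

definition shift2 :: "(int \<Rightarrow> 'a) \<Rightarrow> int \<Rightarrow> 'a" where
  "shift2 x = (\<lambda>n. x (n + 1))"

definition unshift2 :: "(int \<Rightarrow> 'a) \<Rightarrow> int \<Rightarrow> 'a" where
  "unshift2 x = (\<lambda>n. x (n - 1))"

definition right_half :: "(int \<Rightarrow> 'a) \<Rightarrow> nat \<Rightarrow> 'a" where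
  "right_half x = (\<lambda>i. x (int i + 1))"

definition bracket2 :: "(int \<Rightarrow> 'a) \<Rightarrow> (int \<Rightarrow> 'a) \<Rightarrow> int \<Rightarrow> 'a" where
  "bracket2 x y = (\<lambda>n. if n \<le> 0 then y n else x n)"

record ('w, 'f, 'v, 'e) graph_map =
  vert_map :: "'w \<Rightarrow> 'v"
  arc_map :: "'f \<Rightarrow> 'e"

definition graph_embedding ::
  "('w, 'f) pre_digraph \<Rightarrow> ('v, 'e) pre_digraph \<Rightarrow> ('w, 'f, 'v, 'e) graph_map \<Rightarrow> bool" where
  "graph_embedding H G f \<longleftrightarrow>
     inj_on (vert_map f) (verts H) \<and> inj_on (arc_map f) (arcs H) \<and>
     vert_map f ` verts H \<subseteq> verts G \<and> arc_map f ` arcs H \<subseteq> arcs G \<and>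
     (\<forall>e\<in>arcs H. tail G (arc_map f e) = vert_map f (tail H e) \<and>
                  head G (arc_map f e) = vert_map f (head H e))"

text \<open>
  A pair $(\xi^0, \xi^1)$ is a function on \<^typ>\<open>bool\<close>, with \<^const>\<open>False\<close> for 0 and
  \<^const>\<open>True\<close> for 1; so $\xi^{1-j}$ is \<open>\<xi> (\<not> j)\<close>.
\<close>

type_synonym ('w, 'f, 'v, 'e) map_pair = "bool \<Rightarrow> ('w, 'f, 'v, 'e) graph_map"

definition xi_arcs :: "('w, 'f) pre_digraph \<Rightarrow> ('w, 'f, 'v, 'e) map_pair \<Rightarrow> 'e set" where
  "xi_arcs H \<xi> = arc_map (\<xi> False) ` arcs H \<union> arc_map (\<xi> True) ` arcs H"

definition standing_hypotheses ::
  "('v, 'e) pre_digraph \<Rightarrow> ('w, 'f) pre_digraph \<Rightarrow> ('w, 'f, 'v, 'e) map_pair \<Rightarrow> bool" where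
  "standing_hypotheses G H \<xi> \<longleftrightarrow>
     primitive G \<and>
     (\<forall>v\<in>verts H. vert_map (\<xi> False) v = vert_map (\<xi> True) v) \<and>
     arc_map (\<xi> False) ` arcs H \<inter> arc_map (\<xi> True) ` arcs H = {} \<and>
     (\<forall>y\<in>arcs H. \<exists>x\<in>arcs G - xi_arcs H \<xi>.
        tail G x = tail G (arc_map (\<xi> False) y) \<and> head G x = head G (arc_map (\<xi> False) y))"

text \<open>Meaningful on \<^term>\<open>xi_arcs H \<xi>\<close> only.\<close>

definition eps :: "('w, 'f) pre_digraph \<Rightarrow> ('w, 'f, 'v, 'e) map_pair \<Rightarrow> 'e \<Rightarrow> bool" where
  "eps H \<xi> e \<longleftrightarrow> e \<in> arc_map (\<xi> True) ` arcs H"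

text \<open>
  The arcs of $G_\xi$ are the classes of the following relation; the map on sequences induced
  by \<open>tau\<close> is $x \mapsto \tau_\xi \circ x$.
\<close>

definition arc_ident ::
  "('v, 'e) pre_digraph \<Rightarrow> ('w, 'f) pre_digraph \<Rightarrow> ('w, 'f, 'v, 'e) map_pair \<Rightarrow> ('e \<times> 'e) set" where
  "arc_ident G H \<xi> = {(a, b). a \<in> arcs G \<and> b \<in> arcs G \<and>
     (a = b \<or> (\<exists>y\<in>arcs H. {a, b} = {arc_map (\<xi> False) y, arc_map (\<xi> True) y}))}"

definition tau ::
  "('v, 'e) pre_digraph \<Rightarrow> ('w, 'f) pre_digraph \<Rightarrow> ('w, 'f, 'v, 'e) map_pair \<Rightarrow> 'e \<Rightarrow> 'e set" where
  "tau G H \<xi> a = arc_ident G H \<xi> `` {a}"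

definition kappa ::
  "('w, 'f) pre_digraph \<Rightarrow> ('w, 'f, 'v, 'e) map_pair \<Rightarrow> (nat \<Rightarrow> 'e) \<Rightarrow> enat" where
  "kappa H \<xi> x = (let S = {n. x n \<notin> xi_arcs H \<xi>} in if finite S then enat (card S) else \<infinity>)"

definition level ::
  "('v, 'e) pre_digraph \<Rightarrow> ('w, 'f) pre_digraph \<Rightarrow> ('w, 'f, 'v, 'e) map_pair \<Rightarrow> nat
    \<Rightarrow> (nat \<Rightarrow> 'e) set" where
  "level G H \<xi> k = {x \<in> one_sided G. kappa H \<xi> x = enat k}"

text \<open>
  The successor turns the 0-based index into the position $n(x) \geq 1$. Meaningful only if
  $\kappa(x) > 0$.
\<close>

definition first_exit ::
  "('w, 'f) pre_digraph \<Rightarrow> ('w, 'f, 'v, 'e) map_pair \<Rightarrow> (nat \<Rightarrow> 'e) \<Rightarrow> nat" where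
  "first_exit H \<xi> x = Suc (LEAST i. x i \<notin> xi_arcs H \<xi>)"

definition theta ::
  "('w, 'f) pre_digraph \<Rightarrow> ('w, 'f, 'v, 'e) map_pair \<Rightarrow> (nat \<Rightarrow> 'e) \<Rightarrow> complex" where
  "theta H \<xi> x =
     (if kappa H \<xi> x = 0
      then cis (2 * pi * (\<Sum>i. of_bool (eps H \<xi> (x i)) * (1/2) ^ Suc i))
      else cis (2 * pi * (\<Sum>i<first_exit H \<xi> x - 1. of_bool (eps H \<xi> (x i)) * (1/2) ^ Suc i)))"

definition circle_dist :: "complex \<Rightarrow> complex \<Rightarrow> real" where
  "circle_dist z w = Inf {\<bar>s\<bar> | s. cis (2 * pi * s) * z = w}"

primrec lambda_dist ::
  "('w, 'f) pre_digraph \<Rightarrow> ('w, 'f, 'v, 'e) map_pair \<Rightarrow> nat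
    \<Rightarrow> (nat \<Rightarrow> 'e) \<Rightarrow> (nat \<Rightarrow> 'e) \<Rightarrow> real" where
  "lambda_dist H \<xi> 0 x y = circle_dist (theta H \<xi> x) (theta H \<xi> y)"
| "lambda_dist H \<xi> (Suc k) x y =
     \<bar>(1/2) ^ first_exit H \<xi> x - (1/2) ^ first_exit H \<xi> y\<bar>
     + circle_dist (theta H \<xi> x) (theta H \<xi> y)
     + (if first_exit H \<xi> x = first_exit H \<xi> y \<and> theta H \<xi> x = theta H \<xi> y
        then (1/2) ^ (2 + first_exit H \<xi> x)
             * lambda_dist H \<xi> k ((shift1 ^^ first_exit H \<xi> x) x) ((shift1 ^^ first_exit H \<xi> y) y)
        else 0)"

definition level_dist ::
  "('v, 'e) pre_digraph \<Rightarrow> ('w, 'f) pre_digraph \<Rightarrow> ('w, 'f, 'v, 'e) map_pair \<Rightarrow> nat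
    \<Rightarrow> (nat \<Rightarrow> 'e) \<Rightarrow> (nat \<Rightarrow> 'e) \<Rightarrow> real" where
  "level_dist G H \<xi> k x y = dist1 (tau G H \<xi> \<circ> x) (tau G H \<xi> \<circ> y) + lambda_dist H \<xi> k x y"

text \<open>
  The pseudo-metric $d$, the limit along approximations $x^l, y^l \in X^+_l$. If $H$ has no
  infinite path then all $X^+_l$ with $l < \infty$ are empty and there are no approximations;
  every point has $\kappa = \infty$ then, so that the formulas for $d_l$ apply to $x$ and $y$
  themselves, and $d(x, y)$ is the limit of their values.
\<close>

definition pseudo_dist ::
  "('v, 'e) pre_digraph \<Rightarrow> ('w, 'f) pre_digraph \<Rightarrow> ('w, 'f, 'v, 'e) map_pair
    \<Rightarrow> (nat \<Rightarrow> 'e) \<Rightarrow> (nat \<Rightarrow> 'e) \<Rightarrow> real" where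
  "pseudo_dist G H \<xi> x y =
     (if \<exists>k. level G H \<xi> k \<noteq> {}
      then THE r. \<forall>xs ys.
             (\<forall>l. xs l \<in> level G H \<xi> l \<and> ys l \<in> level G H \<xi> l)
             \<longrightarrow> (\<lambda>l. dist1 (xs l) x) \<longlonglongrightarrow> 0 \<longrightarrow> (\<lambda>l. dist1 (ys l) y) \<longlonglongrightarrow> 0
             \<longrightarrow> (\<lambda>l. level_dist G H \<xi> l (xs l) (ys l)) \<longlonglongrightarrow> r
      else lim (\<lambda>l. level_dist G H \<xi> l x y))"

text \<open>
  The first existential is the relation (1) with $n$ replaced by $n - 1$ (0-based position of
  the exceptional entry); in the second, $n$ is the length of the common prefix, as in (2).
\<close>

definition sim_xi ::
  "('v, 'e) pre_digraph \<Rightarrow> ('w, 'f) pre_digraph \<Rightarrow> ('w, 'f, 'v, 'e) map_pair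
    \<Rightarrow> ((nat \<Rightarrow> 'e) \<times> (nat \<Rightarrow> 'e)) set" where
  "sim_xi G H \<xi> = {(x, x'). x \<in> one_sided G \<and> x' \<in> one_sided G \<and>
     (x = x' \<or>
      (\<exists>n j y. (\<forall>i\<ge>n. y i \<in> arcs H) \<and>
         (\<forall>i<n. x i = x' i) \<and>
         x n = arc_map (\<xi> (\<not> j)) (y n) \<and> x' n = arc_map (\<xi> j) (y n) \<and>
         (\<forall>i>n. x i = arc_map (\<xi> j) (y i) \<and> x' i = arc_map (\<xi> (\<not> j)) (y i))) \<or>
      (\<exists>n j y. (\<forall>i\<ge>n. y i \<in> arcs H) \<and>
         (n = 0 \<or> x (n - 1) \<notin> xi_arcs H \<xi>) \<and>
         (\<forall>i<n. x i = x' i) \<and>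
         (\<forall>i\<ge>n. x i = arc_map (\<xi> j) (y i) \<and> x' i = arc_map (\<xi> (\<not> j)) (y i))))}"

definition quot1 ::
  "('v, 'e) pre_digraph \<Rightarrow> ('w, 'f) pre_digraph \<Rightarrow> ('w, 'f, 'v, 'e) map_pair
    \<Rightarrow> (nat \<Rightarrow> 'e) set set" where
  "quot1 G H \<xi> = one_sided G // sim_xi G H \<xi>"

definition pi1 ::
  "('v, 'e) pre_digraph \<Rightarrow> ('w, 'f) pre_digraph \<Rightarrow> ('w, 'f, 'v, 'e) map_pair
    \<Rightarrow> (nat \<Rightarrow> 'e) \<Rightarrow> (nat \<Rightarrow> 'e) set" where
  "pi1 G H \<xi> x = sim_xi G H \<xi> `` {x}"

text \<open>
  Induced maps on classes; \<^const>\<open>the_elem\<close> yields the common value at all representatives.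
\<close>

definition quot1_shift ::
  "('v, 'e) pre_digraph \<Rightarrow> ('w, 'f) pre_digraph \<Rightarrow> ('w, 'f, 'v, 'e) map_pair
    \<Rightarrow> (nat \<Rightarrow> 'e) set \<Rightarrow> (nat \<Rightarrow> 'e) set" where
  "quot1_shift G H \<xi> A = the_elem {pi1 G H \<xi> (shift1 x) | x. x \<in> A}"

definition quot1_dist ::
  "('v, 'e) pre_digraph \<Rightarrow> ('w, 'f) pre_digraph \<Rightarrow> ('w, 'f, 'v, 'e) map_pair
    \<Rightarrow> (nat \<Rightarrow> 'e) set \<Rightarrow> (nat \<Rightarrow> 'e) set \<Rightarrow> real" where
  "quot1_dist G H \<xi> A B = the_elem {pseudo_dist G H \<xi> x y | x y. x \<in> A \<and> y \<in> B}"

definition X_xi ::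
  "('v, 'e) pre_digraph \<Rightarrow> ('w, 'f) pre_digraph \<Rightarrow> ('w, 'f, 'v, 'e) map_pair
    \<Rightarrow> (nat \<Rightarrow> (nat \<Rightarrow> 'e) set) set" where
  "X_xi G H \<xi> = {x. \<forall>n. x n \<in> quot1 G H \<xi> \<and> x n = quot1_shift G H \<xi> (x (Suc n))}"

definition sigma_xi ::
  "('v, 'e) pre_digraph \<Rightarrow> ('w, 'f) pre_digraph \<Rightarrow> ('w, 'f, 'v, 'e) map_pair
    \<Rightarrow> (nat \<Rightarrow> (nat \<Rightarrow> 'e) set) \<Rightarrow> nat \<Rightarrow> (nat \<Rightarrow> 'e) set" where
  "sigma_xi G H \<xi> x = (\<lambda>n. quot1_shift G H \<xi> (x n))"

definition d_xi ::
  "('v, 'e) pre_digraph \<Rightarrow> ('w, 'f) pre_digraph \<Rightarrow> ('w, 'f, 'v, 'e) map_pair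
    \<Rightarrow> (nat \<Rightarrow> (nat \<Rightarrow> 'e) set) \<Rightarrow> (nat \<Rightarrow> (nat \<Rightarrow> 'e) set) \<Rightarrow> real" where
  "d_xi G H \<xi> x y = (SUP n. (1/2) ^ n * quot1_dist G H \<xi> (x n) (y n))"

definition pi_xi ::
  "('v, 'e) pre_digraph \<Rightarrow> ('w, 'f) pre_digraph \<Rightarrow> ('w, 'f, 'v, 'e) map_pair
    \<Rightarrow> (int \<Rightarrow> 'e) \<Rightarrow> nat \<Rightarrow> (nat \<Rightarrow> 'e) set" where
  "pi_xi G H \<xi> x = (\<lambda>n. pi1 G H \<xi> (right_half ((unshift2 ^^ n) x)))"

text \<open>
  The sequences that the inductive construction of the bracket may produce. At
  $d_\xi(x, y) = 1/2$ there can be more than one: if $x^0, y^0$ are the points of angle 0 and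
  1/2 of a circle on which $\sigma_\xi$ doubles angles, and $y^1$ has angle 1/4, then both
  preimages of $x^0$ have distance 1/4 to $y^1$. The bracket counts as defined if
  $d_\xi(x, y) \leq 1/2$ and the sequence is unique.
\<close>

definition is_bracket_xi ::
  "('v, 'e) pre_digraph \<Rightarrow> ('w, 'f) pre_digraph \<Rightarrow> ('w, 'f, 'v, 'e) map_pair
    \<Rightarrow> (nat \<Rightarrow> (nat \<Rightarrow> 'e) set) \<Rightarrow> (nat \<Rightarrow> (nat \<Rightarrow> 'e) set)
    \<Rightarrow> (nat \<Rightarrow> (nat \<Rightarrow> 'e) set) \<Rightarrow> bool" where
  "is_bracket_xi G H \<xi> x y z \<longleftrightarrow>
     z \<in> X_xi G H \<xi> \<and> z 0 = x 0 \<and>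
     (\<forall>n. quot1_dist G H \<xi> (z (Suc n)) (y (Suc n)) \<le> 1/2 * quot1_dist G H \<xi> (z n) (y n) \<and>
          1/2 * quot1_dist G H \<xi> (z n) (y n) \<le> (1/2) ^ (n + 2))"

definition bracket_xi_defined ::
  "('v, 'e) pre_digraph \<Rightarrow> ('w, 'f) pre_digraph \<Rightarrow> ('w, 'f, 'v, 'e) map_pair
    \<Rightarrow> (nat \<Rightarrow> (nat \<Rightarrow> 'e) set) \<Rightarrow> (nat \<Rightarrow> (nat \<Rightarrow> 'e) set) \<Rightarrow> bool" where
  "bracket_xi_defined G H \<xi> x y \<longleftrightarrow>
     d_xi G H \<xi> x y \<le> 1/2 \<and> (\<exists>!z. is_bracket_xi G H \<xi> x y z)"

definition bracket_xi ::
  "('v, 'e) pre_digraph \<Rightarrow> ('w, 'f) pre_digraph \<Rightarrow> ('w, 'f, 'v, 'e) map_pair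
    \<Rightarrow> (nat \<Rightarrow> (nat \<Rightarrow> 'e) set) \<Rightarrow> (nat \<Rightarrow> (nat \<Rightarrow> 'e) set) \<Rightarrow> nat \<Rightarrow> (nat \<Rightarrow> 'e) set" where
  "bracket_xi G H \<xi> x y = (THE z. is_bracket_xi G H \<xi> x y z)"

definition factor_map ::
  "'a set \<Rightarrow> ('a \<Rightarrow> 'a \<Rightarrow> real) \<Rightarrow> ('a \<Rightarrow> 'a) \<Rightarrow>
   'b set \<Rightarrow> ('b \<Rightarrow> 'b \<Rightarrow> real) \<Rightarrow> ('b \<Rightarrow> 'b) \<Rightarrow> ('a \<Rightarrow> 'b) \<Rightarrow> bool" where
  "factor_map X d \<phi> Y e \<psi> p \<longleftrightarrow>
     continuous_map (Metric_space.mtopology X d) (Metric_space.mtopology Y e) p \<and>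
     p ` X = Y \<and> (\<forall>x\<in>X. p (\<phi> x) = \<psi> (p x))"

definition stable_set ::
  "'a set \<Rightarrow> ('a \<Rightarrow> 'a \<Rightarrow> real) \<Rightarrow> ('a \<Rightarrow> 'a) \<Rightarrow> 'a \<Rightarrow> 'a set" where
  "stable_set X d \<phi> x = {y \<in> X. (\<lambda>n. d ((\<phi> ^^ n) x) ((\<phi> ^^ n) y)) \<longlonglongrightarrow> 0}"

definition exactly_one :: "bool \<Rightarrow> bool \<Rightarrow> bool \<Rightarrow> bool" where
  "exactly_one A B C \<longleftrightarrow> (A \<and> \<not> B \<and> \<not> C) \<or> (\<not> A \<and> B \<and> \<not> C) \<or> (\<not> A \<and> \<not> B \<and> C)"

text \<open>
  The three alternatives for $\pi_\xi(x) = \pi_\xi(y)$.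

  In the third one, only the entries $z_n$ with $n > m$, and $z_m$ if $x_m \neq y_m$, are
  constrained by $x$ and $y$. Requiring $z$ to be a two-sided path of $H$ (\<open>swapped_after\<close>)
  excludes pairs for which the constrained part does not extend backwards in $H$, although
  they have the same image. For instance, let $H$ have the arcs $a : v \to w$ and
  $b : w \to w$, and let $G$ have two copies of each, one further arc parallel to each, and an
  arc $e : w \to v$. The points $(\ldots, e, \xi^0(a), \xi^0(b), \xi^0(b), \ldots)$ and
  $(\ldots, e, \xi^1(a), \xi^1(b), \xi^1(b), \ldots)$ with the same past have the same image,
  but no arc of $H$ ends in $v$. Therefore \<open>swapped_after_fwd\<close> asks only the constrained part
  to be a path of $H$. The two conditions agree if every arc of $H$ is preceded by an arc of
  $H$.
\<close>

definition swapped ::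
  "('w, 'f) pre_digraph \<Rightarrow> ('w, 'f, 'v, 'e) map_pair \<Rightarrow> (int \<Rightarrow> 'e) \<Rightarrow> (int \<Rightarrow> 'e) \<Rightarrow> bool" where
  "swapped H \<xi> x y \<longleftrightarrow>
     (\<exists>j. \<exists>z\<in>two_sided H. \<forall>n. arc_map (\<xi> j) (z n) = x n \<and> arc_map (\<xi> (\<not> j)) (z n) = y n)"

definition swapped_after ::
  "('w, 'f) pre_digraph \<Rightarrow> ('w, 'f, 'v, 'e) map_pair \<Rightarrow> (int \<Rightarrow> 'e) \<Rightarrow> (int \<Rightarrow> 'e) \<Rightarrow> bool" where
  "swapped_after H \<xi> x y \<longleftrightarrow>
     (\<exists>m j. \<exists>z\<in>two_sided H.
        (\<forall>n<m. x n = y n) \<and>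
        (x m = y m \<and> x m \<notin> xi_arcs H \<xi> \<or>
         arc_map (\<xi> (\<not> j)) (z m) = x m \<and> arc_map (\<xi> j) (z m) = y m) \<and>
        (\<forall>n>m. arc_map (\<xi> j) (z n) = x n \<and> arc_map (\<xi> (\<not> j)) (z n) = y n))"

definition swapped_after_fwd ::
  "('w, 'f) pre_digraph \<Rightarrow> ('w, 'f, 'v, 'e) map_pair \<Rightarrow> (int \<Rightarrow> 'e) \<Rightarrow> (int \<Rightarrow> 'e) \<Rightarrow> bool" where
  "swapped_after_fwd H \<xi> x y \<longleftrightarrow>
     (\<exists>m j z.
        (\<forall>n>m. z n \<in> arcs H \<and> head H (z n) = tail H (z (n + 1))) \<and>
        (\<forall>n<m. x n = y n) \<and>
        (x m = y m \<and> x m \<notin> xi_arcs H \<xi> \<or>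
         z m \<in> arcs H \<and> head H (z m) = tail H (z (m + 1)) \<and>
         arc_map (\<xi> (\<not> j)) (z m) = x m \<and> arc_map (\<xi> j) (z m) = y m) \<and>
        (\<forall>n>m. arc_map (\<xi> j) (z n) = x n \<and> arc_map (\<xi> (\<not> j)) (z n) = y n))"

end

theory Submission
  imports Defs "HOL-Library.Real_Mod"
begin

text \<open>
  Write $\theta(x)$ as $e^{2 \pi i a(x)}$, where the angle $a(x)$ is the binary value of the initial
  block of symbols in $\xi(H^1)$, and let $e(x)$ be $2^{-n(x)}$, or 0 if no symbol leaves
  $\xi(H^1)$. With these conventions the recursion for $\lambda_k$ makes sense on the whole of
  $X_G^+$ and, being a contraction by the factor 1/8, has a limit $\Lambda$. This $\Lambda$
  satisfies the triangle inequality and is at most twice the distance of sequences, so that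
  $d(x, y) = d_{G_\xi}(\tau_\xi x, \tau_\xi y) + \Lambda(x, y)$, and $d(x, y) = 0$ if and only if
  $x \sim_\xi y$, because binary expansions of a point of the circle are unique up to carries.

  Everything else rests on three properties of the shift. Every $w \sim_\xi \sigma u$ is $\sigma v$ for
  some $v \sim_\xi u$ (surjectivity of $\pi_\xi$). Prefixing a common symbol halves $d$ as long as the
  next symbols agree, while different preimages of a point have distance at least 1/2 (existence
  and uniqueness of the bracket). Since doubling expands small distances on the circle, points
  whose orbits stay close are identified; hence points of a stable set in $X_\xi$ lift to a stable
  set in $X_G$.
\<close>

subsection \<open>Metrics on sequences\<close>

text \<open>The recursion looks past the first exits of two points only if exits and angles agree,
  so the triangle inequality is at risk when an intermediate point is separated earlier. A gap
  rescues it: different exit weights differ by at least half of each, and angles of points with a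
  common exit are multiples of the same power of 1/2. A separation from x thus costs at least
  e(x)/2, and this is the most that the coefficient 2^(-2-n(x)) = e(x)/4, times the bound 2 for the
  later terms, can contribute. An angle matters modulo 1, but putting a symbol of \<xi>(H^1) in
  front halves it. The identification of the angles 0 and 1 does not survive this; equality of
  angles as real numbers does. Hence the two forms of the relation, and the condition on x_n in the
  second: a symbol outside \<xi>(H^1) resets the angle to 0. The limit defining d needs, near every
  point, points with exactly l exits. Parallel arcs outside \<xi>(H^1) create exits, and primitivity
  leads from every vertex to a path where such arcs are available.\<close>

lemma dist1_nonneg: "0 \<le> dist1 x y"
  unfolding dist1_def by (rule cINF_greatest) (auto intro: exI[of _ 0])

lemma dist1_le_iff: "dist1 x y \<le> (1/2) ^ N \<longleftrightarrow> (\<forall>i<N. x i = y i)"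
proof
  let ?A = "{n. \<forall>i<n. x i = y i}"
  have bdd: "bdd_below ((\<lambda>n. (1/2::real) ^ n) ` ?A)"
    by (rule bdd_belowI[of _ 0]) auto
  show "dist1 x y \<le> (1/2) ^ N" if "\<forall>i<N. x i = y i"
    unfolding dist1_def using that by (intro cINF_lower[OF bdd]) auto
  show "\<forall>i<N. x i = y i" if le: "dist1 x y \<le> (1/2) ^ N"
  proof (rule ccontr)
    assume "\<not> (\<forall>i<N. x i = y i)"
    then obtain i where i: "i < N" "x i \<noteq> y i" by blast
    have "(1/2) ^ i \<le> dist1 x y"
      unfolding dist1_def
    proof (rule cINF_greatest)
      have "0 \<in> ?A" by simp
      then show "?A \<noteq> {}" by blast
      fix n assume "n \<in> ?A"
      with i have "n \<le> i" by (auto simp: not_less[symmetric])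
      then show "(1/2::real) ^ i \<le> (1/2) ^ n" by (intro power_decreasing) auto
    qed
    moreover have "(1/2::real) ^ N < (1/2) ^ i"
      using i by (intro power_strict_decreasing) auto
    ultimately show False using le by linarith
  qed
qed

text \<open>The infimum is attained at the first disagreement. Estimates can therefore be checked on
  prefixes, with equal sequences as the only other case.\<close>

lemma dist1_cases:
  obtains (equal) "x = y" "dist1 x y = 0" | (power) N where "dist1 x y = (1/2) ^ N"
proof (cases "x = y")
  case True
  have "dist1 x y \<le> 0"
  proof (rule LIMSEQ_le_const)
    show "(\<lambda>N. (1/2::real) ^ N) \<longlonglongrightarrow> 0" by (rule LIMSEQ_realpow_zero) auto
    show "\<exists>M. \<forall>N\<ge>M. dist1 x y \<le> (1/2) ^ N" using True by (simp add: dist1_le_iff)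
  qed
  with True show ?thesis using equal dist1_nonneg[of x y] by simp
next
  case False
  then obtain i where "x i \<noteq> y i" by auto
  define N where "N = (LEAST i. x i \<noteq> y i)"
  have N: "x N \<noteq> y N" unfolding N_def by (rule LeastI) fact
  have "\<forall>i<N. x i = y i" unfolding N_def using not_less_Least by blast
  then have "dist1 x y \<le> (1/2) ^ N" by (simp add: dist1_le_iff)
  moreover have "(1/2) ^ N \<le> dist1 x y"
    unfolding dist1_def
  proof (rule cINF_greatest)
    have "0 \<in> {n. \<forall>i<n. x i = y i}" by simp
    then show "{n. \<forall>i<n. x i = y i} \<noteq> {}" by blast
    fix n assume "n \<in> {n. \<forall>i<n. x i = y i}"
    with N have "n \<le> N" by (auto simp: not_less[symmetric])
    then show "(1/2::real) ^ N \<le> (1/2) ^ n" by (intro power_decreasing) auto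
  qed
  ultimately show ?thesis using power by force
qed

lemma dist1_refl [simp]: "dist1 x x = 0"
proof (cases x x rule: dist1_cases)
  case (power N)
  have "dist1 x x \<le> (1/2) ^ Suc N" by (simp only: dist1_le_iff) simp
  with power show ?thesis by simp
qed simp

lemma dist1_eq_0_iff: "dist1 x y = 0 \<longleftrightarrow> x = y"
  by (cases x y rule: dist1_cases) auto

lemma dist1_le_1: "dist1 x y \<le> 1"
  using dist1_le_iff[of x y 0] by simp

lemma dist1_less_1: "dist1 x y < 1 \<Longrightarrow> x 0 = y 0"
proof (cases x y rule: dist1_cases)
  case (power N)
  assume "dist1 x y < 1"
  with power have "N \<noteq> 0" by (cases N) auto
  then show ?thesis using dist1_le_iff[of x y N] power by simp
qed simp

lemma dist1_sym: "dist1 x y = dist1 y x"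
  unfolding dist1_def by (simp add: eq_commute)

lemma dist1_triangle: "dist1 x z \<le> dist1 x y + dist1 y z"
proof (cases x y rule: dist1_cases)
  case (power N)
  then have N: "\<forall>i<N. x i = y i" using dist1_le_iff[of x y N] by simp
  show ?thesis
  proof (cases y z rule: dist1_cases)
    case (power M)
    then have "\<forall>i<M. y i = z i" using dist1_le_iff[of y z M] by simp
    with N have "dist1 x z \<le> (1/2) ^ min N M" by (simp add: dist1_le_iff)
    moreover have "(1/2::real) ^ min N M \<le> (1/2) ^ N + (1/2) ^ M" by (simp add: min_def)
    ultimately show ?thesis using power \<open>dist1 x y = (1/2) ^ N\<close> by simp
  qed simp
qed simp

lemma dist1_mono:
  assumes "\<And>N. \<forall>i<N. x i = y i \<Longrightarrow> \<forall>i<N. u i = v i"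
  shows "dist1 u v \<le> dist1 x y"
proof (cases x y rule: dist1_cases)
  case equal
  then have "u = v" using assms by (metis ext lessI)
  then show ?thesis by (simp add: dist1_nonneg)
next
  case (power N)
  then show ?thesis using assms[of N] dist1_le_iff[of x y N] dist1_le_iff[of u v N] by simp
qed

lemma dist1_comp_le: "dist1 (f \<circ> x) (f \<circ> y) \<le> dist1 x y"
  by (rule dist1_mono) auto

lemma dist1_shift:
  assumes "x 0 = y 0"
  shows "dist1 x y \<le> dist1 (shift1 x) (shift1 y) / 2"
proof (cases "shift1 x" "shift1 y" rule: dist1_cases)
  case equal
  have "x = y"
  proof
    show "x i = y i" for i
      using assms fun_cong[OF equal(1), of "i - 1"] by (cases i) (auto simp: shift1_def)
  qed
  then show ?thesis by (simp add: dist1_nonneg)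
next
  case (power N)
  then have *: "\<forall>i<N. shift1 x i = shift1 y i" using dist1_le_iff[of "shift1 x" "shift1 y" N] by simp
  have "x i = y i" if "i < Suc N" for i
    using * assms that by (cases i) (auto simp: shift1_def)
  then have "dist1 x y \<le> (1/2) ^ Suc N" by (simp only: dist1_le_iff) simp
  with power show ?thesis by simp
qed

lemma shift1_funpow: "(shift1 ^^ n) x = (\<lambda>i. x (n + i))"
  by (induction n arbitrary: x) (auto simp: shift1_def funpow_Suc_right simp del: funpow.simps(2))

lemma shift2_funpow: "(shift2 ^^ n) x = (\<lambda>i. x (i + int n))"
  by (induction n) (auto simp: shift2_def algebra_simps)

lemma unshift2_funpow: "(unshift2 ^^ n) x = (\<lambda>i. x (i - int n))"
  by (induction n) (auto simp: unshift2_def algebra_simps)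

text \<open>Pairing the indices -n and n+1 turns the windows 1-n..n into prefixes, so that
  \<open>dist2\<close> inherits the metric properties of \<open>dist1\<close>.\<close>

definition fold_int :: "(int \<Rightarrow> 'a) \<Rightarrow> nat \<Rightarrow> 'a \<times> 'a" where
  "fold_int x = (\<lambda>n. (x (- int n), x (int n + 1)))"

lemma fold_int_agree:
  "(\<forall>i<n. fold_int x i = fold_int y i) \<longleftrightarrow> (\<forall>j. 1 - int n \<le> j \<and> j \<le> int n \<longrightarrow> x j = y j)"
proof safe
  fix j assume *: "\<forall>i<n. fold_int x i = fold_int y i" "1 - int n \<le> j" "j \<le> int n"
  show "x j = y j"
  proof (cases "j \<le> 0")
    case True
    then show ?thesis using *(1)[rule_format, of "nat (- j)"] *(2) by (simp add: fold_int_def)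
  next
    case False
    then show ?thesis using *(1)[rule_format, of "nat (j - 1)"] *(3) by (simp add: fold_int_def)
  qed
qed (simp add: fold_int_def)

lemma dist2_eq: "dist2 x y = dist1 (fold_int x) (fold_int y)"
  unfolding dist1_def dist2_def fold_int_agree ..

lemma dist2_le_iff:
  "dist2 x y \<le> (1/2) ^ N \<longleftrightarrow> (\<forall>j. 1 - int N \<le> j \<and> j \<le> int N \<longrightarrow> x j = y j)"
  unfolding dist2_eq dist1_le_iff fold_int_agree ..

lemma inj_fold_int: "fold_int x = fold_int y \<Longrightarrow> x = y"
proof
  fix j assume "fold_int x = fold_int y"
  then have "\<forall>k. 1 - int (nat \<bar>j\<bar> + 1) \<le> k \<and> k \<le> int (nat \<bar>j\<bar> + 1) \<longrightarrow> x k = y k"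
    using fold_int_agree[of "nat \<bar>j\<bar> + 1" x y] by simp
  then show "x j = y j" by (rule allE[of _ j]) auto
qed

lemma Metric_space_dist2: "Metric_space A dist2"
proof
  show "0 \<le> dist2 x y" for x y :: "int \<Rightarrow> 'a" by (simp add: dist2_eq dist1_nonneg)
  show "dist2 x y = dist2 y x" for x y :: "int \<Rightarrow> 'a" by (simp add: dist2_eq dist1_sym)
  show "dist2 x y = 0 \<longleftrightarrow> x = y" for x y :: "int \<Rightarrow> 'a"
    by (auto simp: dist2_eq dist1_eq_0_iff inj_fold_int)
  show "dist2 x z \<le> dist2 x y + dist2 y z" for x y z :: "int \<Rightarrow> 'a"
    by (simp add: dist2_eq dist1_triangle)
qed

subsection \<open>Distance to the nearest integer\<close>

text \<open>The metric of the circle in terms of angles measured in full turns; see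
  \<open>circle_dist_cis\<close>.\<close>

definition dist_int :: "real \<Rightarrow> real" where
  "dist_int t = \<bar>t - of_int (round t)\<bar>"

lemma dist_int_le: "dist_int t \<le> \<bar>t - of_int m\<bar>"
  unfolding dist_int_def by (rule round_diff_minimal)

lemma dist_int_nonneg: "0 \<le> dist_int t"
  by (simp add: dist_int_def)

lemma dist_int_le_half: "dist_int t \<le> 1/2"
  unfolding dist_int_def using of_int_round_abs_le[of t] by linarith

lemma dist_int_eqI: "\<bar>t - of_int m\<bar> \<le> 1/2 \<Longrightarrow> dist_int t = \<bar>t - of_int m\<bar>"
proof (rule antisym[OF dist_int_le])
  assume *: "\<bar>t - of_int m\<bar> \<le> 1/2"
  show "\<bar>t - of_int m\<bar> \<le> dist_int t"
  proof (cases "round t = m")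
    case False
    then have "1 \<le> \<bar>of_int (round t) - of_int m :: real\<bar>" by linarith
    with * show ?thesis unfolding dist_int_def by linarith
  qed (simp add: dist_int_def)
qed

lemma dist_int_eq_abs: "\<bar>t\<bar> \<le> 1/2 \<Longrightarrow> dist_int t = \<bar>t\<bar>"
  using dist_int_eqI[of t 0] by simp

lemma dist_int_0 [simp]: "dist_int 0 = 0"
  using dist_int_eq_abs[of 0] by simp

lemma dist_int_eq_0_iff: "dist_int t = 0 \<longleftrightarrow> t \<in> \<int>"
proof
  show "dist_int t = 0 \<Longrightarrow> t \<in> \<int>" unfolding dist_int_def by (metis Ints_of_int abs_eq_0 eq_iff_diff_eq_0)
  show "t \<in> \<int> \<Longrightarrow> dist_int t = 0" by (auto simp: dist_int_def elim: Ints_cases)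
qed

lemma dist_int_minus: "dist_int (- t) = dist_int t"
proof (rule antisym)
  show *: "dist_int (- t) \<le> dist_int t" for t
    using dist_int_le[of "- t" "- round t"] by (simp add: dist_int_def)
  show "dist_int t \<le> dist_int (- t)" using *[of "- t"] by simp
qed

lemma dist_int_commute: "dist_int (a - b) = dist_int (b - a)"
  using dist_int_minus[of "a - b"] by simp

lemma dist_int_triangle: "dist_int (s + t) \<le> dist_int s + dist_int t"
  using dist_int_le[of "s + t" "round s + round t"] unfolding dist_int_def by simp

lemma dist_int_triangle_diff: "dist_int (a - c) \<le> dist_int (a - b) + dist_int (b - c)"
  using dist_int_triangle[of "a - b" "b - c"] by simp

lemma dist_int_add_int: "dist_int (t + of_int m) = dist_int t"
proof (rule antisym)
  show *: "dist_int (t + of_int m) \<le> dist_int t" for t m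
    using dist_int_le[of "t + of_int m" "round t + m"] by (simp add: dist_int_def)
  show "dist_int t \<le> dist_int (t + of_int m)" using *[of "t + of_int m" "- m"] by simp
qed

text \<open>Below 1/4, twice the integer nearest to t is still within 1/2 of 2t. This is the
  expansion of the doubling map.\<close>

lemma dist_int_double: "dist_int t \<le> 1/4 \<Longrightarrow> dist_int (2 * t) = 2 * dist_int t"
proof -
  assume le: "dist_int t \<le> 1/4"
  have "2 * t - of_int (2 * round t) = 2 * (t - of_int (round t))" by simp
  then have "\<bar>2 * t - of_int (2 * round t)\<bar> = 2 * dist_int t"
    unfolding dist_int_def by linarith
  with le show ?thesis using dist_int_eqI[of "2 * t" "2 * round t"] by simp
qed

lemma dist_int_fraction:
  assumes "M > 0" "of_int k / M \<notin> \<int>" "M = of_int m"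
  shows "1 / M \<le> dist_int (of_int k / M)"
proof -
  define r where "r = round (of_int k / M)"
  have "k \<noteq> r * m"
  proof
    assume "k = r * m"
    then have "of_int k / M = of_int r" using assms(1,3) by simp
    with assms(2) show False by simp
  qed
  then have "1 \<le> \<bar>k - r * m\<bar>" by linarith
  then have "real_of_int 1 \<le> of_int \<bar>k - r * m\<bar>" by (simp only: of_int_le_iff)
  then have le: "1 \<le> \<bar>of_int k - of_int r * M\<bar>" unfolding assms(3) by simp
  have "of_int k / M - of_int r = (of_int k - of_int r * M) / M"
    using assms(1) by (simp add: diff_divide_distrib)
  then have "dist_int (of_int k / M) = \<bar>of_int k - of_int r * M\<bar> / M"
    using assms(1) unfolding dist_int_def r_def[symmetric] by simp
  with le assms(1) show ?thesis by (simp add: divide_right_mono)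
qed

lemma circle_dist_cis: "circle_dist (cis (2 * pi * a)) (cis (2 * pi * b)) = dist_int (a - b)"
proof -
  have eq: "cis (2 * pi * s) * cis (2 * pi * a) = cis (2 * pi * b) \<longleftrightarrow> s + a - b \<in> \<int>" for s
  proof -
    have "cis (2 * pi * s) * cis (2 * pi * a) = cis (2 * pi * (s + a))"
      by (simp add: cis_mult algebra_simps)
    moreover have "cis (2 * pi * (s + a)) = cis (2 * pi * b) \<longleftrightarrow> cis (2 * pi * (s + a - b)) = 1"
      by (simp add: right_diff_distrib flip: cis_divide)
    moreover have "\<dots> \<longleftrightarrow> (\<exists>n::int. s + a - b = of_int n)"
      by (auto simp: cis_eq_1_iff mult.commute[of "of_int _"])
    ultimately show ?thesis by (auto simp: Ints_def)
  qed
  show ?thesis unfolding circle_dist_def eq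
  proof (rule cInf_eq_minimum)
    have "(b - a + of_int (round (a - b))) + a - b \<in> \<int>" by simp
    moreover have "dist_int (a - b) = \<bar>b - a + of_int (round (a - b))\<bar>"
      unfolding dist_int_def by linarith
    ultimately show "dist_int (a - b) \<in> {\<bar>s\<bar> |s. s + a - b \<in> \<int>}" by blast
    fix t assume "t \<in> {\<bar>s\<bar> |s. s + a - b \<in> \<int>}"
    then obtain s m where "t = \<bar>s\<bar>" "s + a - b = of_int m" by (auto elim: Ints_cases)
    then have "t = \<bar>(a - b) - of_int m\<bar>" by linarith
    then show "dist_int (a - b) \<le> t" using dist_int_le by simp
  qed
qed

lemma cis_eq_iff_dist_int: "cis (2 * pi * a) = cis (2 * pi * b) \<longleftrightarrow> dist_int (a - b) = 0"
proof -
  have "cis (2 * pi * a) = cis (2 * pi * b) \<longleftrightarrow> cis (2 * pi * (a - b)) = 1"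
    by (simp add: right_diff_distrib flip: cis_divide)
  also have "\<dots> \<longleftrightarrow> (\<exists>n::int. a - b = of_int n)"
    by (auto simp: cis_eq_1_iff mult.commute[of "of_int _"])
  finally show ?thesis by (auto simp: dist_int_eq_0_iff Ints_def)
qed

subsection \<open>Binary expansions\<close>

definition binary_value :: "(nat \<Rightarrow> bool) \<Rightarrow> real" where
  "binary_value c = (\<Sum>i. of_bool (c i) * (1/2) ^ Suc i)"

lemma summable_binary: "summable (\<lambda>i. of_bool (c i) * (1/2::real) ^ Suc i)"
proof (rule summable_comparison_test')
  show "summable (\<lambda>i. (1/2::real) ^ Suc i)" using power_half_series by (rule sums_summable)
  show "norm (of_bool (c i) * (1/2::real) ^ Suc i) \<le> (1/2) ^ Suc i" if "0 \<le> i" for i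
    by simp
qed

lemma binary_value_Suc: "binary_value c = (of_bool (c 0) + binary_value (\<lambda>i. c (Suc i))) / 2"
proof -
  have "binary_value c = of_bool (c 0) * (1/2) ^ Suc 0 + (\<Sum>i. of_bool (c (Suc i)) * (1/2) ^ Suc (Suc i))"
    unfolding binary_value_def using suminf_split_head[OF summable_binary[of c]] by simp
  also have "(\<Sum>i. of_bool (c (Suc i)) * (1/2::real) ^ Suc (Suc i)) = (\<Sum>i. (of_bool (c (Suc i)) * (1/2) ^ Suc i) / 2)"
    by simp
  also have "\<dots> = binary_value (\<lambda>i. c (Suc i)) / 2"
    unfolding binary_value_def by (rule suminf_divide[OF summable_binary])
  finally show ?thesis by (simp add: add_divide_distrib)
qed

lemma binary_value_nonneg: "0 \<le> binary_value c"
  unfolding binary_value_def by (intro suminf_nonneg summable_binary) simp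

lemma binary_value_Not: "binary_value (\<lambda>i. \<not> c i) = 1 - binary_value c"
proof -
  have "binary_value (\<lambda>i. \<not> c i) + binary_value c
      = (\<Sum>i. of_bool (\<not> c i) * (1/2) ^ Suc i + of_bool (c i) * (1/2) ^ Suc i)"
    unfolding binary_value_def by (rule suminf_add[OF summable_binary summable_binary])
  also have "\<dots> = (\<Sum>i. (1/2) ^ Suc i)" by (intro arg_cong[of _ _ suminf]) auto
  also have "\<dots> = 1" using power_half_series by (rule sums_unique[symmetric])
  finally show ?thesis by simp
qed

lemma binary_value_le_1: "binary_value c \<le> 1"
  using binary_value_Not[of c] binary_value_nonneg[of "\<lambda>i. \<not> c i"] by simp

lemma binary_value_False [simp]: "binary_value (\<lambda>i. False) = 0"
  by (simp add: binary_value_def)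

lemma binary_value_True [simp]: "binary_value (\<lambda>i. True) = 1"
  using binary_value_Not[of "\<lambda>_. False"] by simp

lemma binary_value_eq_0D: "binary_value c = 0 \<Longrightarrow> \<not> c i"
proof -
  assume "binary_value c = 0"
  then have "of_bool (c i) * (1/2::real) ^ Suc i = 0"
    using suminf_eq_zero_iff[OF summable_binary[of c]] unfolding binary_value_def by auto
  then show ?thesis by auto
qed

lemma binary_value_eq_1D: "binary_value c = 1 \<Longrightarrow> c i"
  using binary_value_eq_0D[of "\<lambda>i. \<not> c i" i] by (simp add: binary_value_Not)

text \<open>If m is the integer difference of the values, then 2m = 1 + c' - d' with tail values c',
  d' in [0,1]. So m is 0 or 1, and either value forces both tails to be extremal: 1000... against
  0111..., or 111... against 000....\<close>

lemma dist_int_binary_value_head: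
  assumes "dist_int (binary_value c - binary_value d) = 0" "c 0" "\<not> d 0"
  shows "(\<forall>i>0. \<not> c i \<and> d i) \<or> (\<forall>i. c i \<and> \<not> d i)"
proof -
  obtain m where m: "binary_value c - binary_value d = of_int m"
    using assms(1) by (auto simp: dist_int_eq_0_iff elim: Ints_cases)
  let ?c = "\<lambda>i. c (Suc i)" and ?d = "\<lambda>i. d (Suc i)"
  have "2 * of_int m = 1 + binary_value ?c - binary_value ?d"
    unfolding m[symmetric] using binary_value_Suc[of c] binary_value_Suc[of d] assms(2,3)
    by (simp add: field_simps)
  moreover note bnd = binary_value_nonneg[of ?c] binary_value_nonneg[of ?d]
    binary_value_le_1[of ?c] binary_value_le_1[of ?d]
  moreover from calculation have "m = 0 \<or> m = 1" by linarith
  ultimately consider "binary_value ?c = 0" "binary_value ?d = 1" | "binary_value ?c = 1" "binary_value ?d = 0"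
    by force
  then show ?thesis
  proof cases
    case 1
    have "\<not> c i \<and> d i" if "i > 0" for i
      using binary_value_eq_0D[OF 1(1)] binary_value_eq_1D[OF 1(2)] that by (cases i) auto
    then show ?thesis by blast
  next
    case 2
    have "c i \<and> \<not> d i" for i
      using binary_value_eq_1D[OF 2(1)] binary_value_eq_0D[OF 2(2)] assms(2,3) by (cases i) auto
    then show ?thesis by blast
  qed
qed

text \<open>Twice the integer difference is a difference of two numbers in [0,1], hence 0. A common
  leading digit thus upgrades equality modulo 1 to equality of the tails as reals.\<close>

lemma dist_int_binary_value_shift:
  assumes "dist_int (binary_value c - binary_value d) = 0" "c 0 = d 0"
  shows "binary_value (\<lambda>i. c (Suc i)) = binary_value (\<lambda>i. d (Suc i))"
proof -
  obtain m where m: "binary_value c - binary_value d = of_int m"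
    using assms(1) by (auto simp: dist_int_eq_0_iff elim: Ints_cases)
  let ?c = "\<lambda>i. c (Suc i)" and ?d = "\<lambda>i. d (Suc i)"
  have "2 * of_int m = binary_value ?c - binary_value ?d"
    unfolding m[symmetric] using binary_value_Suc[of c] binary_value_Suc[of d] assms(2)
    by (simp add: field_simps)
  moreover note binary_value_nonneg[of ?c] binary_value_nonneg[of ?d]
    binary_value_le_1[of ?c] binary_value_le_1[of ?d]
  moreover from calculation have "m = 0" by linarith
  ultimately show ?thesis by simp
qed

lemma dist_int_binary_value_eq_0:
  assumes "dist_int (binary_value c - binary_value d) = 0" "\<forall>i<n. c i = d i" "c n \<noteq> d n"
  shows "(\<forall>i>n. c i = (\<not> c n) \<and> d i = c n) \<or> n = 0 \<and> (\<forall>i. c i = c 0 \<and> d i = (\<not> c 0))"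
  using assms
proof (induction n arbitrary: c d)
  case 0
  show ?case
  proof (cases "c 0")
    case True
    with 0 show ?thesis using dist_int_binary_value_head[of c d] by auto
  next
    case False
    with 0 show ?thesis using dist_int_binary_value_head[of d c] by (auto simp: dist_int_commute)
  qed
next
  case (Suc n)
  let ?c = "\<lambda>i. c (Suc i)" and ?d = "\<lambda>i. d (Suc i)"
  have eq: "binary_value ?c = binary_value ?d"
    using dist_int_binary_value_shift Suc.prems by blast
  then have "(\<forall>i>n. ?c i = (\<not> ?c n) \<and> ?d i = ?c n) \<or> n = 0 \<and> (\<forall>i. ?c i = ?c 0 \<and> ?d i = (\<not> ?c 0))"
    using Suc.prems(2,3) by (intro Suc.IH) auto
  \<comment> \<open>Opposite constant tails have the values 0 and 1, which agree modulo 1 but not as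
    reals. The wrap-around can therefore occur only at position 0.\<close>
  moreover have False if "\<forall>i. ?c i = ?c 0 \<and> ?d i = (\<not> ?c 0)"
  proof -
    define b where "b = c (Suc 0)"
    have "c (Suc i) = b" "d (Suc i) = (\<not> b)" for i
      using that[rule_format, of i] unfolding b_def by blast+
    then show False using eq by (cases b) auto
  qed
  ultimately have IH: "\<forall>i>n. ?c i = (\<not> ?c n) \<and> ?d i = ?c n" by blast
  have "c i = (\<not> c (Suc n)) \<and> d i = c (Suc n)" if "i > Suc n" for i
    using IH[rule_format, of "i - 1"] that by (cases i) auto
  then show ?case by blast
qed

lemma half_power_inject: "(1/2::real) ^ a = (1/2) ^ b \<longleftrightarrow> a = b"
  by (simp add: power_one_over)

locale doubled_graph =
  fixes G :: "('v, 'e) pre_digraph" and H :: "('w, 'f) pre_digraph"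
    and \<xi> :: "bool \<Rightarrow> ('w, 'f, 'v, 'e) graph_map"
  assumes fin_G: "fin_digraph G" and fin_H: "fin_digraph H"
    and emb: "graph_embedding H G (\<xi> j)"
    and hyps: "standing_hypotheses G H \<xi>"
begin

abbreviation Z :: "'e set" where
  "Z \<equiv> xi_arcs H \<xi>"

subsection \<open>The functions $2^{-n(x)}$ and $\theta$\<close>

definition exit_weight :: "(nat \<Rightarrow> 'e) \<Rightarrow> real" where
  "exit_weight x = (if \<forall>i. x i \<in> Z then 0 else (1/2) ^ first_exit H \<xi> x)"

text \<open>Digits are set to 0 from the first exit on, so that one infinite series covers both
  clauses in the definition of \<open>theta\<close>.\<close>

definition digit :: "(nat \<Rightarrow> 'e) \<Rightarrow> nat \<Rightarrow> bool" where
  "digit x i \<longleftrightarrow> (\<forall>j\<le>i. x j \<in> Z) \<and> eps H \<xi> (x i)"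

definition angle :: "(nat \<Rightarrow> 'e) \<Rightarrow> real" where
  "angle x = binary_value (digit x)"

text \<open>Unspecified if x never leaves \<open>Z\<close>; the recursions below then multiply the
  term containing it by \<open>exit_weight x\<close>, which is 0.\<close>

definition after_exit :: "(nat \<Rightarrow> 'e) \<Rightarrow> nat \<Rightarrow> 'e" where
  "after_exit x = (shift1 ^^ first_exit H \<xi> x) x"

lemma first_exitE:
  assumes "\<not> (\<forall>i. x i \<in> Z)"
  obtains n where "first_exit H \<xi> x = Suc n" "x n \<notin> Z" "\<And>i. i < n \<Longrightarrow> x i \<in> Z"
proof -
  obtain i where i: "x i \<notin> Z" using assms by blast
  show ?thesis
  proof (rule that[of "LEAST i. x i \<notin> Z"])
    show "x (LEAST i. x i \<notin> Z) \<notin> Z" using i by (rule LeastI)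
    show "x i \<in> Z" if "i < (LEAST i. x i \<notin> Z)" for i using not_less_Least[OF that] by simp
  qed (simp add: first_exit_def)
qed

lemma first_exit_eq:
  assumes "x n \<notin> Z" "\<And>i. i < n \<Longrightarrow> x i \<in> Z"
  shows "first_exit H \<xi> x = Suc n"
proof -
  have "(LEAST i. x i \<notin> Z) = n"
    using assms by (intro Least_equality) (auto simp: not_less[symmetric])
  then show ?thesis by (simp add: first_exit_def)
qed

lemma first_exit_out: "x 0 \<notin> Z \<Longrightarrow> first_exit H \<xi> x = 1"
  by (subst first_exit_eq[of x 0]) auto

lemma first_exit_in:
  assumes "x 0 \<in> Z" "\<not> (\<forall>i. x i \<in> Z)"
  shows "first_exit H \<xi> x = Suc (first_exit H \<xi> (shift1 x))"
proof -
  obtain n where n: "first_exit H \<xi> x = Suc n" "x n \<notin> Z" "\<And>i. i < n \<Longrightarrow> x i \<in> Z"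
    using first_exitE[OF assms(2)] by blast
  with assms(1) obtain m where m: "n = Suc m" by (cases n) auto
  have "first_exit H \<xi> (shift1 x) = Suc m"
    by (rule first_exit_eq) (use n m in \<open>auto simp: shift1_def\<close>)
  with n m show ?thesis by simp
qed

lemma all_in_shift: "x 0 \<in> Z \<Longrightarrow> (\<forall>i. shift1 x i \<in> Z) \<longleftrightarrow> (\<forall>i. x i \<in> Z)"
  unfolding shift1_def by (metis not0_implies_Suc)

lemma kappa_eq_0_iff: "kappa H \<xi> x = 0 \<longleftrightarrow> (\<forall>i. x i \<in> Z)"
proof (cases "finite {n. x n \<notin> Z}")
  case True
  then show ?thesis by (auto simp: kappa_def zero_enat_def)
next
  case False
  then have "{n. x n \<notin> Z} \<noteq> {}" by (metis finite.emptyI)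
  with False show ?thesis by (auto simp: kappa_def)
qed

lemma theta_eq_cis: "theta H \<xi> x = cis (2 * pi * angle x)"
proof (cases "\<forall>i. x i \<in> Z")
  case True
  then have "digit x = (\<lambda>i. eps H \<xi> (x i))" by (auto simp: digit_def)
  with True show ?thesis
    by (simp add: theta_def kappa_eq_0_iff angle_def binary_value_def)
next
  case False
  then obtain n where n: "first_exit H \<xi> x = Suc n" "x n \<notin> Z" "\<And>i. i < n \<Longrightarrow> x i \<in> Z"
    using first_exitE by blast
  have d: "digit x i \<longleftrightarrow> i < n \<and> eps H \<xi> (x i)" for i
    using n by (auto simp: digit_def not_less[symmetric])
  have "angle x = (\<Sum>i<n. of_bool (digit x i) * (1/2) ^ Suc i)"
    unfolding angle_def binary_value_def by (rule suminf_finite) (auto simp: d)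
  also have "\<dots> = (\<Sum>i<n. of_bool (eps H \<xi> (x i)) * (1/2) ^ Suc i)"
    by (intro sum.cong) (auto simp: d)
  finally have "angle x = (\<Sum>i<n. of_bool (eps H \<xi> (x i)) * (1/2) ^ Suc i)" .
  moreover have "kappa H \<xi> x \<noteq> 0" using False by (simp only: kappa_eq_0_iff) simp
  ultimately show ?thesis using n(1) by (simp add: theta_def)
qed

lemma theta_eq_iff: "theta H \<xi> x = theta H \<xi> y \<longleftrightarrow> dist_int (angle x - angle y) = 0"
  by (simp add: theta_eq_cis cis_eq_iff_dist_int)

lemma circle_dist_theta: "circle_dist (theta H \<xi> x) (theta H \<xi> y) = dist_int (angle x - angle y)"
  by (simp add: theta_eq_cis circle_dist_cis)

lemma angle_bounds: "0 \<le> angle x" "angle x \<le> 1"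
  by (simp_all add: angle_def binary_value_nonneg binary_value_le_1)

lemma angle_in: "x 0 \<in> Z \<Longrightarrow> angle x = (of_bool (eps H \<xi> (x 0)) + angle (shift1 x)) / 2"
proof -
  assume "x 0 \<in> Z"
  moreover from this have "(\<forall>j\<le>Suc i. x j \<in> Z) \<longleftrightarrow> (\<forall>j\<le>i. x (Suc j) \<in> Z)" for i
    by (metis Suc_le_mono le0 not0_implies_Suc)
  ultimately have "digit x 0 = eps H \<xi> (x 0)" "(\<lambda>i. digit x (Suc i)) = digit (shift1 x)"
    by (simp_all add: digit_def shift1_def fun_eq_iff)
  then show ?thesis unfolding angle_def by (subst binary_value_Suc) simp
qed

lemma angle_out: "x 0 \<notin> Z \<Longrightarrow> angle x = 0"
proof -
  assume "x 0 \<notin> Z"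
  then have "digit x = (\<lambda>i. False)" by (auto simp: digit_def)
  then show ?thesis by (simp add: angle_def)
qed

lemma exit_weight_nonneg: "0 \<le> exit_weight x"
  by (simp add: exit_weight_def)

lemma exit_weight_le_half: "exit_weight x \<le> 1/2"
proof (cases "\<forall>i. x i \<in> Z")
  case False
  then obtain n where "first_exit H \<xi> x = Suc n" using first_exitE by blast
  with False show ?thesis by (simp add: exit_weight_def power_le_one)
qed (simp add: exit_weight_def)

lemma exit_weight_in: "x 0 \<in> Z \<Longrightarrow> exit_weight x = exit_weight (shift1 x) / 2"
  using first_exit_in[of x] all_in_shift[of x] by (simp add: exit_weight_def)

lemma exit_weight_out: "x 0 \<notin> Z \<Longrightarrow> exit_weight x = 1/2"
  using first_exit_out[of x] by (auto simp: exit_weight_def)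

lemma after_exit_in:
  "x 0 \<in> Z \<Longrightarrow> exit_weight x \<noteq> 0 \<Longrightarrow> after_exit x = after_exit (shift1 x)"
proof -
  assume "x 0 \<in> Z" "exit_weight x \<noteq> 0"
  moreover from this(2) have "\<not> (\<forall>i. x i \<in> Z)" by (metis exit_weight_def)
  ultimately have "first_exit H \<xi> x = Suc (first_exit H \<xi> (shift1 x))"
    using first_exit_in[of x] by blast
  then show ?thesis by (simp add: after_exit_def funpow_Suc_right del: funpow.simps(2))
qed

lemma after_exit_out: "x 0 \<notin> Z \<Longrightarrow> after_exit x = shift1 x"
  by (simp add: after_exit_def first_exit_out)

text \<open>Among 0 and the powers of 1/2, the nearest neighbour of 2^(-a) is 2^(-a-1). The gap is
  what makes \<open>lam_triangle\<close> work.\<close>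

lemma exit_weight_gap:
  assumes "exit_weight x \<noteq> exit_weight y"
  shows "exit_weight x / 2 \<le> \<bar>exit_weight x - exit_weight y\<bar>"
proof (cases "exit_weight x = 0 \<or> exit_weight y = 0")
  case True
  then show ?thesis using exit_weight_nonneg[of x] exit_weight_nonneg[of y] by auto
next
  case False
  then obtain a b where a: "exit_weight x = (1/2) ^ a" and b: "exit_weight y = (1/2) ^ b"
    by (auto simp: exit_weight_def split: if_splits)
  with assms have "a < b \<or> b < a" by (metis linorder_neqE_nat)
  then show ?thesis
  proof
    assume "a < b"
    then have "(1/2::real) ^ b \<le> (1/2) ^ Suc a" by (intro power_decreasing) auto
    then have "(1/2::real) ^ b \<le> (1/2) ^ a / 2" by simp
    then show ?thesis unfolding a b by linarith
  next
    assume "b < a"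
    then have "(1/2::real) ^ a \<le> (1/2) ^ Suc b" by (intro power_decreasing) auto
    then have "(1/2::real) ^ a \<le> (1/2) ^ b / 2" "0 \<le> (1/2::real) ^ a" by simp_all
    then show ?thesis unfolding a b by linarith
  qed
qed

lemma angle_dyadic:
  assumes "first_exit H \<xi> x = Suc n" "\<not> (\<forall>i. x i \<in> Z)"
  obtains k where "angle x = of_int k / 2 ^ n"
proof -
  have "\<exists>k. angle x = of_int k / 2 ^ n"
    using assms
  proof (induction n arbitrary: x)
    case 0
    then have "x 0 \<notin> Z" by (metis first_exitE nat.inject)
    then show ?case by (auto simp: angle_out intro: exI[of _ 0])
  next
    case (Suc n)
    then have x0: "x 0 \<in> Z" by (metis first_exit_out One_nat_def nat.inject nat.distinct(1))
    with Suc.prems have "first_exit H \<xi> (shift1 x) = Suc n" "\<not> (\<forall>i. shift1 x i \<in> Z)"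
      using first_exit_in[of x] all_in_shift[of x] by auto
    then obtain k where k: "angle (shift1 x) = of_int k / 2 ^ n" using Suc.IH by blast
    have "angle x = of_int (of_bool (eps H \<xi> (x 0)) * 2 ^ n + k) / 2 ^ Suc n"
      unfolding angle_in[of x, OF x0] k by (simp add: field_simps)
    then show ?case by blast
  qed
  then show ?thesis using that by blast
qed

text \<open>Points with the common weight 2^(-n-1) have n digits before the exit, so both angles are
  multiples of 2^(-n), and so is their distance on the circle.\<close>

lemma angle_gap:
  assumes "exit_weight x = exit_weight y" "dist_int (angle x - angle y) \<noteq> 0"
  shows "exit_weight x \<le> dist_int (angle x - angle y)"
proof (cases "exit_weight x = 0")
  case True
  then show ?thesis by (simp add: dist_int_nonneg)
next
  case False
  then have x: "\<not> (\<forall>i. x i \<in> Z)" and y: "\<not> (\<forall>i. y i \<in> Z)"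
    using assms(1) by (auto simp: exit_weight_def split: if_splits)
  obtain n where n: "first_exit H \<xi> x = Suc n" using first_exitE[OF x] by blast
  have "(1/2::real) ^ first_exit H \<xi> x = (1/2) ^ first_exit H \<xi> y"
    using assms(1) x y by (simp add: exit_weight_def)
  then have "first_exit H \<xi> y = Suc n" 
    unfolding n half_power_inject by simp
  then obtain l where l: "angle y = of_int l / 2 ^ n" using angle_dyadic y by blast
  obtain k where k: "angle x = of_int k / 2 ^ n" using angle_dyadic n x by blast
  have eq: "angle x - angle y = of_int (k - l) / 2 ^ n"
    by (simp add: k l diff_divide_distrib)
  have "1 / 2 ^ n \<le> dist_int (of_int (k - l) / (2::real) ^ n)"
  proof (rule dist_int_fraction)
    show "of_int (k - l) / (2::real) ^ n \<notin> \<int>" using assms(2) unfolding eq dist_int_eq_0_iff .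
    show "(2::real) ^ n = of_int (2 ^ n)" by simp
  qed simp
  moreover have "exit_weight x \<le> 1 / 2 ^ n"
    using x n by (simp add: exit_weight_def power_one_over field_simps)
  ultimately show ?thesis unfolding eq by linarith
qed

subsection \<open>The limit of the functions $\lambda_k$\<close>

text \<open>The part of \<lambda>_k outside the recursive term. At points with an exit it vanishes
  exactly when \<delta> = 1.\<close>

definition exit_diff :: "(nat \<Rightarrow> 'e) \<Rightarrow> (nat \<Rightarrow> 'e) \<Rightarrow> real" where
  "exit_diff x y = \<bar>exit_weight x - exit_weight y\<bar> + dist_int (angle x - angle y)"

lemma exit_diff_nonneg: "0 \<le> exit_diff x y"
  by (simp add: exit_diff_def dist_int_nonneg)

lemma exit_diff_refl [simp]: "exit_diff x x = 0"
  by (simp add: exit_diff_def)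

lemma exit_diff_le_1: "exit_diff x y \<le> 1"
  using dist_int_le_half[of "angle x - angle y"] exit_weight_nonneg[of x] exit_weight_nonneg[of y]
    exit_weight_le_half[of x] exit_weight_le_half[of y]
  unfolding exit_diff_def by linarith

lemma exit_diff_sym: "exit_diff x y = exit_diff y x"
  by (simp add: exit_diff_def abs_minus_commute dist_int_commute[of "angle x"])

lemma exit_diff_triangle: "exit_diff x z \<le> exit_diff x y + exit_diff y z"
  using dist_int_triangle_diff[of "angle x" "angle z" "angle y"] unfolding exit_diff_def by linarith

lemma exit_diff_eq_0_iff:
  "exit_diff x y = 0 \<longleftrightarrow> exit_weight x = exit_weight y \<and> dist_int (angle x - angle y) = 0"
  using dist_int_nonneg[of "angle x - angle y"] by (auto simp: exit_diff_def)

lemma exit_diff_gap: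
  assumes "exit_diff x y \<noteq> 0"
  shows "exit_weight x / 2 \<le> exit_diff x y"
proof (cases "exit_weight x = exit_weight y")
  case True
  then show ?thesis
    using assms angle_gap[of x y] exit_weight_nonneg[of y] by (simp add: exit_diff_def)
next
  case False
  then show ?thesis
    using exit_weight_gap[of x y] dist_int_nonneg[of "angle x - angle y"] by (simp add: exit_diff_def)
qed

text \<open>\<open>exit_weight x / 4\<close> is the coefficient 2^(-2-n(x)); being 0 at points
  without exit, it lets one clause serve all values of \<open>kappa\<close>. Starting from 0 instead
  of the circle distance makes the sequence increasing in k.\<close>

primrec lam :: "nat \<Rightarrow> (nat \<Rightarrow> 'e) \<Rightarrow> (nat \<Rightarrow> 'e) \<Rightarrow> real" where
  "lam 0 x y = 0"
| "lam (Suc k) x y = exit_diff x y +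
     (if exit_diff x y = 0 then exit_weight x / 4 * lam k (after_exit x) (after_exit y) else 0)"

lemma lam_bounds: "0 \<le> lam k x y" "lam k x y \<le> 2"
proof -
  have "0 \<le> lam k x y \<and> lam k x y \<le> 2"
  proof (induction k arbitrary: x y)
    case (Suc k)
    have "exit_weight x / 4 * lam k (after_exit x) (after_exit y) \<le> 1/8 * 2"
      using Suc exit_weight_nonneg[of x] exit_weight_le_half[of x] by (intro mult_mono) auto
    then show ?case
      using Suc exit_weight_nonneg[of x] exit_diff_nonneg[of x y] exit_diff_le_1[of x y] by auto
  qed simp
  then show "0 \<le> lam k x y" "lam k x y \<le> 2" by auto
qed

lemma lam_sym: "lam k x y = lam k y x"
proof (induction k arbitrary: x y)
  case (Suc k)
  then show ?case using exit_diff_sym[of x y] exit_diff_eq_0_iff[of x y] by auto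
qed simp

lemma lam_refl: "lam k x x = 0"
  by (induction k arbitrary: x) auto

lemma lam_triangle: "lam k x z \<le> lam k x y + lam k y z"
proof (induction k arbitrary: x y z)
  case (Suc k)
  let ?x = "after_exit x" and ?y = "after_exit y" and ?z = "after_exit z"
  have pos: "0 \<le> exit_weight x / 4 * lam k u v" for x u v
    using exit_weight_nonneg lam_bounds by simp
  have ge: "exit_diff u v \<le> lam (Suc k) u v" for u v
    using pos[of u "after_exit u" "after_exit v"] by simp
  show ?case
  proof (cases "exit_diff x z = 0")
    case False
    then show ?thesis using exit_diff_triangle[of x z y] ge[of x y] ge[of y z] by simp
  next
    case xz: True
    show ?thesis
    proof (cases "exit_diff x y = 0")
      case True
      have "exit_diff y z = 0"
        using exit_diff_triangle[of y z x] exit_diff_sym[of x y] exit_diff_nonneg[of y z] True xz by simp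
      moreover have "exit_weight y = exit_weight x" using True by (simp add: exit_diff_eq_0_iff)
      moreover have "exit_weight x / 4 * lam k ?x ?z \<le> exit_weight x / 4 * (lam k ?x ?y + lam k ?y ?z)"
        using Suc.IH exit_weight_nonneg by (intro mult_left_mono) auto
      ultimately show ?thesis using True xz by (simp add: distrib_left)
    next
      case False
      \<comment> \<open>Here x and z continue to be compared although y is already separated from x.
        The recursive term is at most \<open>exit_weight x / 2\<close>, which the gap bounds by the
        distance from x to y.\<close>
      have "exit_weight x / 4 * lam k ?x ?z \<le> exit_weight x / 4 * 2"
        using lam_bounds exit_weight_nonneg by (intro mult_left_mono) auto
      then have "lam (Suc k) x z \<le> exit_diff x y" using exit_diff_gap[OF False] xz by simp
      then show ?thesis using ge[of x y] lam_bounds(1)[of "Suc k" y z] by linarith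
    qed
  qed
qed simp

lemma lam_mono_bound: "lam k x y \<le> lam (k + m) x y" "lam (k + m) x y \<le> lam k x y + 2 * (1/8) ^ k"
proof -
  have "lam k x y \<le> lam (k + m) x y \<and> lam (k + m) x y \<le> lam k x y + 2 * (1/8) ^ k"
  proof (induction k arbitrary: x y)
    case 0
    then show ?case using lam_bounds[of m] by simp
  next
    case (Suc k)
    let ?l = "\<lambda>k. lam k (after_exit x) (after_exit y)" and ?e = "exit_weight x / 4"
    have e: "0 \<le> ?e" "?e \<le> 1/8"
      using exit_weight_nonneg[of x] exit_weight_le_half[of x] by auto
    have "?e * ?l k \<le> ?e * ?l (k + m)"
      using Suc e by (intro mult_left_mono) auto
    moreover have "?e * ?l (k + m) \<le> ?e * (?l k + 2 * (1/8) ^ k)"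
      using Suc e by (intro mult_left_mono) auto
    moreover have "?e * (2 * (1/8) ^ k) \<le> 1/8 * (2 * (1/8) ^ k)"
      using e by (intro mult_right_mono) auto
    moreover have "?e * (?l k + 2 * (1/8) ^ k) = ?e * ?l k + ?e * (2 * (1/8) ^ k)"
      by (rule distrib_left)
    moreover have "1/8 * (2 * (1/8) ^ k) = 2 * (1/8::real) ^ Suc k" by simp
    ultimately have "?e * ?l k \<le> ?e * ?l (k + m)" "?e * ?l (k + m) \<le> ?e * ?l k + 2 * (1/8) ^ Suc k"
      by linarith+
    then show ?case unfolding add_Suc lam.simps by (auto simp del: power_Suc)
  qed
  then show "lam k x y \<le> lam (k + m) x y" "lam (k + m) x y \<le> lam k x y + 2 * (1/8) ^ k" by auto
qed

definition Lam :: "(nat \<Rightarrow> 'e) \<Rightarrow> (nat \<Rightarrow> 'e) \<Rightarrow> real" where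
  "Lam x y = lim (\<lambda>k. lam k x y)"

lemma lam_tendsto: "(\<lambda>k. lam k x y) \<longlonglongrightarrow> Lam x y"
proof -
  have "incseq (\<lambda>k. lam k x y)"
    unfolding incseq_def by (metis lam_mono_bound(1) le_Suc_ex)
  then have "convergent (\<lambda>k. lam k x y)"
    using incseq_convergent[of "\<lambda>k. lam k x y" 2] lam_bounds(2) unfolding convergent_def by metis
  then show ?thesis unfolding Lam_def by (simp add: convergent_LIMSEQ_iff)
qed

lemma Lam_unfold: "Lam x y = exit_diff x y +
     (if exit_diff x y = 0 then exit_weight x / 4 * Lam (after_exit x) (after_exit y) else 0)"
proof (rule LIMSEQ_unique)
  show "(\<lambda>k. lam (Suc k) x y) \<longlonglongrightarrow> Lam x y"
    by (rule LIMSEQ_Suc[OF lam_tendsto])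
  show "(\<lambda>k. lam (Suc k) x y) \<longlonglongrightarrow> exit_diff x y +
     (if exit_diff x y = 0 then exit_weight x / 4 * Lam (after_exit x) (after_exit y) else 0)"
    by (auto intro!: tendsto_intros lam_tendsto)
qed

lemma Lam_nonneg: "0 \<le> Lam x y"
  by (rule LIMSEQ_le_const[OF lam_tendsto]) (simp add: lam_bounds)

lemma Lam_le_2: "Lam x y \<le> 2"
  by (rule LIMSEQ_le_const2[OF lam_tendsto]) (simp add: lam_bounds)

lemma Lam_sym: "Lam x y = Lam y x"
  by (simp add: Lam_def lam_sym[of _ x])

lemma Lam_refl [simp]: "Lam x x = 0"
  using lam_tendsto[of x x] by (simp add: lam_refl LIMSEQ_const_iff)

lemma Lam_triangle: "Lam x z \<le> Lam x y + Lam y z"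
  using lam_tendsto[of x z] tendsto_add[OF lam_tendsto[of x y] lam_tendsto[of y z]]
  by (rule LIMSEQ_le) (use lam_triangle in blast)

lemma exit_diff_le_Lam: "exit_diff x y \<le> Lam x y"
  by (subst Lam_unfold) (simp add: exit_weight_nonneg Lam_nonneg)

section \<open>Behaviour of the limit under the shift\<close>

lemma Lam_out:
  assumes "x 0 \<notin> Z" "y 0 \<notin> Z"
  shows "Lam x y = Lam (shift1 x) (shift1 y) / 8"
  using assms by (subst Lam_unfold)
    (simp add: exit_diff_def exit_weight_out angle_out after_exit_out)

definition residue :: "(nat \<Rightarrow> 'e) \<Rightarrow> (nat \<Rightarrow> 'e) \<Rightarrow> real" where
  "residue x y =
     (if exit_diff x y = 0 then exit_weight x / 4 * Lam (after_exit x) (after_exit y) else 0)"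

lemma Lam_residue: "Lam x y = exit_diff x y + residue x y"
  unfolding residue_def by (rule Lam_unfold)

lemma residue_nonneg: "0 \<le> residue x y"
  by (simp add: residue_def exit_weight_nonneg Lam_nonneg)

text \<open>Inside a block the shift does not change the point reached after the exit; only its
  weight doubles.\<close>

lemma residue_in:
  assumes "x 0 \<in> Z" "y 0 \<in> Z" "exit_diff x y = 0" "exit_diff (shift1 x) (shift1 y) = 0"
  shows "residue x y = residue (shift1 x) (shift1 y) / 2"
proof (cases "exit_weight x = 0")
  case True
  then show ?thesis using assms exit_weight_in[of x] by (simp add: residue_def)
next
  case False
  then have "exit_weight y \<noteq> 0" using assms(3) by (simp add: exit_diff_eq_0_iff)
  with False show ?thesis
    using assms after_exit_in[of x] after_exit_in[of y] exit_weight_in[of x] by (simp add: residue_def)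
qed

text \<open>Doubling an angle moves the first digit into the integer part, so on the circle the
  shift acts by doubling whatever the first symbols are.\<close>

lemma angle_double:
  assumes "x 0 \<in> Z" "y 0 \<in> Z"
  shows "dist_int (2 * (angle x - angle y)) = dist_int (angle (shift1 x) - angle (shift1 y))"
proof -
  define m :: int where "m = of_bool (eps H \<xi> (x 0)) - of_bool (eps H \<xi> (y 0))"
  have "2 * (angle x - angle y) = angle (shift1 x) - angle (shift1 y) + of_int m"
    using angle_in[of x] angle_in[of y] assms unfolding m_def by simp
  then show ?thesis by (simp only: dist_int_add_int)
qed

text \<open>Below, the common second symbol excludes pairs such as $00^\infty$, $01^\infty$.\<close>

lemma angle_diff_half:
  assumes "x 0 \<in> Z" "x 0 = y 0" "x 1 = y 1"
  shows "dist_int (angle x - angle y) = dist_int (angle (shift1 x) - angle (shift1 y)) / 2"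
    "\<bar>angle (shift1 x) - angle (shift1 y)\<bar> \<le> 1/2"
proof -
  let ?x = "shift1 x" and ?y = "shift1 y"
  show le: "\<bar>angle ?x - angle ?y\<bar> \<le> 1/2"
  proof (cases "x 1 \<in> Z")
    case True
    then have "angle ?x = (of_bool (eps H \<xi> (x 1)) + angle (shift1 ?x)) / 2"
      "angle ?y = (of_bool (eps H \<xi> (x 1)) + angle (shift1 ?y)) / 2"
      using angle_in[of ?x] angle_in[of ?y] assms(3) by (simp_all add: shift1_def)
    then have "2 * (angle ?x - angle ?y) = angle (shift1 ?x) - angle (shift1 ?y)" by simp
    moreover have "2 * a \<le> 1" "2 * a \<ge> - 1"
      if "2 * a = c - d" "0 \<le> c" "c \<le> 1" "0 \<le> d" "d \<le> 1" for a c d :: real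
      using that by linarith+
    ultimately have "2 * (angle ?x - angle ?y) \<le> 1" "- 1 \<le> 2 * (angle ?x - angle ?y)"
      using angle_bounds by blast+
    then show ?thesis unfolding abs_le_iff by simp
  next
    case False
    then show ?thesis using angle_out[of ?x] angle_out[of ?y] assms(3) by (simp add: shift1_def)
  qed
  have eq: "angle x - angle y = (angle ?x - angle ?y) / 2"
    using angle_in[of x] angle_in[of y] assms by (simp add: field_simps)
  have "\<bar>(angle ?x - angle ?y) / 2\<bar> \<le> 1/2" using le by (simp only: abs_divide) simp
  then show "dist_int (angle x - angle y) = dist_int (angle ?x - angle ?y) / 2"
    unfolding eq using dist_int_eq_abs[OF le] dist_int_eq_abs[of "(angle ?x - angle ?y) / 2"] by simp
qed

lemma Lam_half:
  assumes "x 0 = y 0" "x 1 = y 1"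
  shows "Lam x y \<le> Lam (shift1 x) (shift1 y) / 2"
proof (cases "x 0 \<in> Z")
  case False
  then show ?thesis using Lam_out[of x y] assms(1) Lam_nonneg[of "shift1 x" "shift1 y"] by simp
next
  case True
  have "\<bar>exit_weight x - exit_weight y\<bar> = \<bar>exit_weight (shift1 x) - exit_weight (shift1 y)\<bar> / 2"
    using exit_weight_in[of x] exit_weight_in[of y] True assms(1) by (simp add: abs_if)
  then have *: "exit_diff x y = exit_diff (shift1 x) (shift1 y) / 2"
    using angle_diff_half(1)[OF True assms] by (simp add: exit_diff_def)
  have "residue x y \<le> residue (shift1 x) (shift1 y) / 2"
  proof (cases "exit_diff x y = 0")
    case True
    with * show ?thesis using residue_in[of x y] \<open>x 0 \<in> Z\<close> assms(1) by simp
  next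
    case False
    then show ?thesis using residue_nonneg[of "shift1 x" "shift1 y"] by (simp add: residue_def)
  qed
  with * show ?thesis by (simp add: Lam_residue[of x y] Lam_residue[of "shift1 x"])
qed

lemma Lam_le_1:
  assumes "x 0 = y 0"
  shows "Lam x y \<le> 1"
proof (cases "x 0 \<in> Z")
  case False
  then show ?thesis using Lam_out[of x y] assms Lam_le_2[of "shift1 x" "shift1 y"] by simp
next
  case True
  have ew: "0 \<le> exit_weight x" "exit_weight x \<le> 1/4" "0 \<le> exit_weight y" "exit_weight y \<le> 1/4"
    using exit_weight_in[of x] exit_weight_in[of y] True assms exit_weight_nonneg[of x]
      exit_weight_nonneg[of y] exit_weight_le_half[of "shift1 x"] exit_weight_le_half[of "shift1 y"]
    by auto
  then have "exit_diff x y \<le> 1/4 + 1/2"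
    using dist_int_le_half[of "angle x - angle y"] unfolding exit_diff_def by linarith
  moreover have "exit_weight x / 4 * Lam (after_exit x) (after_exit y) \<le> 1/16 * 2"
    using ew Lam_le_2 Lam_nonneg by (intro mult_mono) auto
  ultimately show ?thesis by (simp add: Lam_unfold[of x y])
qed

lemma Lam_le_dist1: "Lam x y \<le> 2 * dist1 x y"
proof -
  have *: "Lam x y \<le> 2 * (1/2) ^ N" if "\<forall>i<N. x i = y i" for N
    using that
  proof (induction N arbitrary: x y)
    case 0
    then show ?case using Lam_le_2 by simp
  next
    case (Suc N)
    show ?case
    proof (cases N)
      case 0
      then show ?thesis using Lam_le_1 Suc.prems by simp
    next
      case (Suc M)
      have "Lam x y \<le> Lam (shift1 x) (shift1 y) / 2"
        using Suc.prems Suc by (intro Lam_half) auto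
      moreover have "Lam (shift1 x) (shift1 y) \<le> 2 * (1/2) ^ N"
        using Suc.prems by (intro Suc.IH) (simp add: shift1_def)
      ultimately show ?thesis by simp
    qed
  qed
  show ?thesis
  proof (cases x y rule: dist1_cases)
    case (power N)
    then show ?thesis using *[of N] dist1_le_iff[of x y N] by simp
  qed simp
qed

lemma Lam_eq_0_shift:
  assumes "Lam x y = 0" "x 0 \<in> Z \<longleftrightarrow> y 0 \<in> Z"
  shows "Lam (shift1 x) (shift1 y) = 0"
proof (cases "x 0 \<in> Z")
  case False
  then show ?thesis using Lam_out[of x y] assms by simp
next
  case True
  let ?x = "shift1 x" and ?y = "shift1 y"
  have diff: "exit_diff x y = 0" and res: "residue x y = 0"
    using Lam_residue[of x y] residue_nonneg[of x y] exit_diff_nonneg[of x y] assms(1) by auto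
  have "dist_int (angle ?x - angle ?y) = dist_int (2 * (angle x - angle y))"
    using angle_double[of x y] True assms(2) by simp
  also have "\<dots> = 0"
    using diff dist_int_double[of "angle x - angle y"] by (simp add: exit_diff_eq_0_iff)
  finally have diff': "exit_diff ?x ?y = 0"
    using diff exit_weight_in[of x] exit_weight_in[of y] True assms(2) by (simp add: exit_diff_eq_0_iff)
  then show ?thesis
    using residue_in[of x y] diff res True assms(2) by (simp add: Lam_residue)
qed

lemma Lam_eq_0_funpow:
  assumes "Lam x y = 0" "\<And>i. x i \<in> Z \<longleftrightarrow> y i \<in> Z"
  shows "Lam ((shift1 ^^ n) x) ((shift1 ^^ n) y) = 0"
proof (induction n)
  case (Suc n)
  have "Lam (shift1 ((shift1 ^^ n) x)) (shift1 ((shift1 ^^ n) y)) = 0"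
    by (rule Lam_eq_0_shift[OF Suc]) (simp add: shift1_funpow assms(2))
  then show ?case by simp
qed (simp add: assms)

text \<open>Angles are compared as reals, not modulo 1: a common symbol of \<open>Z\<close> in front
  halves their difference, and half an odd integer is no longer 0 on the circle. In this form the
  relation is preserved by common prefixes.\<close>

definition strongly_equal :: "(nat \<Rightarrow> 'e) \<Rightarrow> (nat \<Rightarrow> 'e) \<Rightarrow> bool" where
  "strongly_equal x y \<longleftrightarrow> exit_weight x = exit_weight y \<and> angle x = angle y \<and> Lam x y = 0"

lemma strongly_equal_shift:
  assumes "x 0 = y 0" "strongly_equal (shift1 x) (shift1 y)"
  shows "strongly_equal x y"
proof (cases "x 0 \<in> Z")
  case False
  then show ?thesis using assms Lam_out[of x y]
    by (simp add: strongly_equal_def exit_weight_out angle_out)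
next
  case True
  have eq: "exit_weight x = exit_weight y" "angle x = angle y"
    using True assms exit_weight_in[of x] exit_weight_in[of y] angle_in[of x] angle_in[of y]
    by (simp_all add: strongly_equal_def)
  have "Lam (shift1 x) (shift1 y) = 0" using assms by (simp add: strongly_equal_def)
  then have "exit_diff (shift1 x) (shift1 y) = 0" "residue (shift1 x) (shift1 y) = 0"
    using Lam_residue[of "shift1 x"] residue_nonneg[of "shift1 x"] exit_diff_nonneg[of "shift1 x"]
    by (metis add_nonneg_eq_0_iff)+
  then show ?thesis using eq residue_in[of x y] True assms(1)
    by (simp add: strongly_equal_def Lam_residue[of x y] exit_diff_def)
qed

lemma strongly_equal_prefix:
  assumes "\<And>i. i < n \<Longrightarrow> x i = y i" "strongly_equal ((shift1 ^^ n) x) ((shift1 ^^ n) y)"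
  shows "strongly_equal x y"
  using assms
proof (induction n arbitrary: x y)
  case (Suc n)
  have "strongly_equal (shift1 x) (shift1 y)"
  proof (rule Suc.IH)
    show "shift1 x i = shift1 y i" if "i < n" for i
      using Suc.prems(1) that by (simp add: shift1_def)
    show "strongly_equal ((shift1 ^^ n) (shift1 x)) ((shift1 ^^ n) (shift1 y))"
      using Suc.prems(2) by (simp only: funpow_Suc_right o_apply)
  qed
  with Suc.prems(1)[of 0] show ?case by (simp add: strongly_equal_shift)
qed simp

text \<open>
  While two points stay close, the distance of their angles doubles in each step as long as the
  symbols are in \<^term>\<open>Z\<close>, and it vanishes at the first other symbol.
\<close>

lemma Lam_expansive:
  assumes "\<And>n. Lam ((shift1 ^^ n) x) ((shift1 ^^ n) y) < 1/4" "\<And>i. x i \<in> Z \<longleftrightarrow> y i \<in> Z"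
  shows "Lam x y = 0"
proof -
  let ?x = "\<lambda>n. (shift1 ^^ n) x" and ?y = "\<lambda>n. (shift1 ^^ n) y"
  define a where "a n = dist_int (angle (?x n) - angle (?y n))" for n
  have sh: "shift1 (?x n) = ?x (Suc n)" "shift1 (?y n) = ?y (Suc n)"
    and in0: "?x n 0 \<in> Z \<longleftrightarrow> ?y n 0 \<in> Z" for n
    using assms(2) by (simp_all add: shift1_funpow)
  have small: "a n < 1/4" for n
    using assms(1)[of n] exit_diff_le_Lam[of "?x n" "?y n"] unfolding a_def exit_diff_def by linarith
  have double: "a (Suc n) = 2 * a n" if "a n \<noteq> 0" for n
  proof -
    have xin: "?x n 0 \<in> Z" and yin: "?y n 0 \<in> Z"
      using that in0[of n] angle_out[of "?x n"] angle_out[of "?y n"] by (auto simp: a_def)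
    have "a (Suc n) = dist_int (2 * (angle (?x n) - angle (?y n)))"
      unfolding a_def using angle_double[of "?x n" "?y n", OF xin yin] by (simp only: sh)
    also have "\<dots> = 2 * a n"
      unfolding a_def using small[of n] by (intro dist_int_double) (simp add: a_def)
    finally show ?thesis .
  qed
  have a0: "a n = 0" for n
  proof (rule ccontr)
    assume "a n \<noteq> 0"
    then have pow: "a (n + k) = 2 ^ k * a n" for k
    proof (induction k)
      case (Suc k)
      then have "a (n + k) \<noteq> 0" using \<open>a n \<noteq> 0\<close> by simp
      then show ?case using double[of "n + k"] Suc by simp
    qed simp
    have pos: "0 < a n" using \<open>a n \<noteq> 0\<close> dist_int_nonneg by (simp add: a_def order_less_le)
    obtain k where "1 / a n < 2 ^ k" using real_arch_pow[of 2 "1 / a n"] by auto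
    then have "1 < 2 ^ k * a n" using pos by (simp add: field_simps)
    then have "1 < a (n + k)" by (simp only: pow)
    then show False using small[of "n + k"] by simp
  qed
  have mem: "?x n i \<in> Z \<longleftrightarrow> ?y n i \<in> Z" for n i
    by (simp add: shift1_funpow assms(2))
  have first: "first_exit H \<xi> (?x n) = first_exit H \<xi> (?y n)" for n
    by (simp only: first_exit_def mem)
  have "exit_weight (?x n) = exit_weight (?y n)" for n
    by (simp only: exit_weight_def mem first)
  then have diff: "exit_diff (?x n) (?y n) = 0" for n
    using a0[of n] by (simp add: exit_diff_eq_0_iff a_def)
  \<comment> \<open>Both points leave \<open>Z\<close> at the same position, so the recursion
    compares later points of the same two orbits, where the first two summands vanish again.\<close>
  have after: "\<exists>m. after_exit (?x n) = ?x m \<and> after_exit (?y n) = ?y m" for n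
  proof (intro exI conjI)
    let ?m = "first_exit H \<xi> (?x n) + n"
    show "after_exit (?x n) = ?x ?m" "after_exit (?y n) = ?y ?m"
      unfolding after_exit_def first funpow_add by simp_all
  qed
  \<comment> \<open>Only the recursive term is left, and every unfolding gains a factor 1/8. The
    bound holds for all n at once because unfolding changes n.\<close>
  have "Lam (?x n) (?y n) \<le> 2 * (1/8) ^ k" for n k
  proof (induction k arbitrary: n)
    case 0
    then show ?case using Lam_le_2 by simp
  next
    case (Suc k)
    show ?case
    proof (cases "exit_weight (?x n) = 0")
      case True
      then show ?thesis using diff[of n] Lam_unfold[of "?x n" "?y n"] by simp
    next
      case False
      then obtain m where m: "after_exit (?x n) = ?x m" "after_exit (?y n) = ?y m" using after by blast
      have "exit_weight (?x n) / 4 * Lam (?x m) (?y m) \<le> 1/8 * (2 * (1/8) ^ k)"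
        using exit_weight_le_half[of "?x n"] exit_weight_nonneg Suc Lam_nonneg by (intro mult_mono) auto
      then show ?thesis using diff[of n] Lam_unfold[of "?x n" "?y n"] m by simp
    qed
  qed
  from this[of 0] have "\<forall>k. Lam x y \<le> 2 * (1/8) ^ k" by simp
  moreover have "(\<lambda>k. 2 * (1/8::real) ^ k) \<longlonglongrightarrow> 2 * 0"
    by (intro tendsto_mult_left LIMSEQ_realpow_zero) auto
  ultimately have "Lam x y \<le> 2 * 0" by (intro LIMSEQ_le_const[of "\<lambda>k. 2 * (1/8) ^ k"]) blast+
  with Lam_nonneg[of x y] show ?thesis by linarith
qed

subsection \<open>Arcs\<close>

abbreviation xa :: "bool \<Rightarrow> 'f \<Rightarrow> 'e" where
  "xa j \<equiv> arc_map (\<xi> j)"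

lemma xa_in_arcs: "h \<in> arcs H \<Longrightarrow> xa j h \<in> arcs G"
  using emb[of j] by (auto simp: graph_embedding_def)

lemma xa_in_Z: "h \<in> arcs H \<Longrightarrow> xa j h \<in> Z"
  by (cases j) (auto simp: xi_arcs_def)

lemma ZE:
  assumes "a \<in> Z"
  obtains j h where "h \<in> arcs H" "a = xa j h"
  using assms by (auto simp: xi_arcs_def)

lemma xa_eq_iff:
  assumes "h \<in> arcs H" "h' \<in> arcs H"
  shows "xa j h = xa j' h' \<longleftrightarrow> j = j' \<and> h = h'"
proof -
  have "xa False h \<noteq> xa True h'" if "h \<in> arcs H" "h' \<in> arcs H" for h h'
    using hyps that by (auto simp: standing_hypotheses_def)
  then have ne: "xa j h \<noteq> xa j' h'" if "j \<noteq> j'"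
    using assms that by (cases j; cases j') (metis+)
  have "inj_on (xa j) (arcs H)" using emb by (simp add: graph_embedding_def)
  then have "xa j h = xa j h' \<longleftrightarrow> h = h'" using assms by (rule inj_on_eq_iff)
  with ne show ?thesis by blast
qed

lemma eps_xa: "h \<in> arcs H \<Longrightarrow> eps H \<xi> (xa j h) = j"
  unfolding eps_def using xa_eq_iff by auto

lemma tail_xa: "h \<in> arcs H \<Longrightarrow> tail G (xa j h) = vert_map (\<xi> False) (tail H h)"
  and head_xa: "h \<in> arcs H \<Longrightarrow> head G (xa j h) = vert_map (\<xi> False) (head H h)"
proof -
  assume h: "h \<in> arcs H"
  have wf: "wf_digraph H" using fin_H by (rule fin_digraph.axioms)
  have "vert_map (\<xi> j) v = vert_map (\<xi> False) v" if "v \<in> verts H" for v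
    using hyps that by (cases j) (auto simp: standing_hypotheses_def)
  moreover have "tail H h \<in> verts H" "head H h \<in> verts H"
    using wf h by (auto simp: wf_digraph_def)
  ultimately show "tail G (xa j h) = vert_map (\<xi> False) (tail H h)"
    "head G (xa j h) = vert_map (\<xi> False) (head H h)"
    using emb[of j] h by (auto simp: graph_embedding_def)
qed

lemma xa_path_iff:
  assumes "h \<in> arcs H" "h' \<in> arcs H"
  shows "head G (xa j h) = tail G (xa j' h') \<longleftrightarrow> head H h = tail H h'"
proof -
  have wf: "wf_digraph H" using fin_H by (rule fin_digraph.axioms)
  then have "head H h \<in> verts H" "tail H h' \<in> verts H" using assms by (auto simp: wf_digraph_def)
  moreover have "inj_on (vert_map (\<xi> False)) (verts H)" using emb by (simp add: graph_embedding_def)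
  ultimately show ?thesis by (auto simp: assms tail_xa head_xa dest: inj_onD)
qed

text \<open>The last standing hypothesis enters through this lemma. It allows an exit to be inserted
  into a path inside \<open>Z\<close> without changing the vertices.\<close>

lemma parallel_arc:
  assumes "a \<in> Z"
  obtains b where "b \<in> arcs G" "b \<notin> Z" "tail G b = tail G a" "head G b = head G a"
proof -
  obtain j h where h: "h \<in> arcs H" "a = xa j h" using assms by (rule ZE)
  then obtain b where "b \<in> arcs G - Z" "tail G b = tail G (xa False h)" "head G b = head G (xa False h)"
    using hyps unfolding standing_hypotheses_def by blast
  with h that show ?thesis by (auto simp: tail_xa head_xa)
qed

abbreviation t :: "'e \<Rightarrow> 'e set" where
  "t \<equiv> tau G H \<xi>"

lemma arc_ident_iff:
  "(a, b) \<in> arc_ident G H \<xi> \<longleftrightarrow> a \<in> arcs G \<and> b \<in> arcs G \<and>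
     (a = b \<or> (\<exists>j. \<exists>h\<in>arcs H. a = xa j h \<and> b = xa (\<not> j) h))"
proof -
  have "(\<exists>y\<in>arcs H. {a, b} = {xa False y, xa True y})
      \<longleftrightarrow> (\<exists>j. \<exists>h\<in>arcs H. a = xa j h \<and> b = xa (\<not> j) h)"
    unfolding doubleton_eq_iff ex_bool_eq by auto
  then show ?thesis unfolding arc_ident_def by auto
qed

lemma t_eq_iff:
  assumes "a \<in> arcs G" "b \<in> arcs G"
  shows "t a = t b \<longleftrightarrow> a = b \<or> (\<exists>j. \<exists>h\<in>arcs H. a = xa j h \<and> b = xa (\<not> j) h)"
proof
  assume "t a = t b"
  moreover have "b \<in> t b" using assms by (simp add: tau_def arc_ident_iff)
  ultimately have "b \<in> t a" by blast
  then have "(a, b) \<in> arc_ident G H \<xi>" by (simp add: tau_def)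
  then show "a = b \<or> (\<exists>j. \<exists>h\<in>arcs H. a = xa j h \<and> b = xa (\<not> j) h)"
    by (simp add: arc_ident_iff)
next
  have cl: "t (xa j h) = {xa False h, xa True h}" if h: "h \<in> arcs H" for j h
  proof -
    have "c \<in> t (xa j h) \<longleftrightarrow> c = xa j h \<or> c = xa (\<not> j) h" for c
      using h by (auto simp: tau_def arc_ident_iff xa_in_arcs xa_eq_iff)
    then show ?thesis by (cases j) auto
  qed
  assume "a = b \<or> (\<exists>j. \<exists>h\<in>arcs H. a = xa j h \<and> b = xa (\<not> j) h)"
  then show "t a = t b" using cl by auto
qed

lemma t_eqD:
  assumes "t a = t b" "a \<in> arcs G" "b \<in> arcs G"
  shows "a \<in> Z \<longleftrightarrow> b \<in> Z" "tail G a = tail G b" "head G a = head G b"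
  using assms by (auto simp: t_eq_iff xa_in_Z tail_xa head_xa)

lemma t_eq_neqE:
  assumes "t a = t b" "a \<in> arcs G" "b \<in> arcs G" "a \<noteq> b"
  obtains j h where "h \<in> arcs H" "a = xa j h" "b = xa (\<not> j) h"
  using assms by (auto simp: t_eq_iff)

subsection \<open>The pseudo-metric $d$\<close>

text \<open>An explicit form of d; \<open>pseudo_dist_eq\<close> identifies it with the
  limit.\<close>

definition lim_dist :: "(nat \<Rightarrow> 'e) \<Rightarrow> (nat \<Rightarrow> 'e) \<Rightarrow> real" where
  "lim_dist x y = dist1 (t \<circ> x) (t \<circ> y) + Lam x y"

lemma lim_dist_nonneg: "0 \<le> lim_dist x y"
  by (simp add: lim_dist_def dist1_nonneg Lam_nonneg)

lemma lim_dist_refl [simp]: "lim_dist x x = 0"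
  by (simp add: lim_dist_def)

lemma lim_dist_sym: "lim_dist x y = lim_dist y x"
  by (simp add: lim_dist_def dist1_sym[of "t \<circ> x"] Lam_sym[of x])

lemma lim_dist_triangle: "lim_dist x z \<le> lim_dist x y + lim_dist y z"
  using dist1_triangle[of "t \<circ> x" "t \<circ> z" "t \<circ> y"] Lam_triangle[of x z y]
  by (simp add: lim_dist_def)

lemma lim_dist_le_3: "lim_dist x y \<le> 3"
  using dist1_le_1[of "t \<circ> x" "t \<circ> y"] Lam_le_2[of x y] by (simp add: lim_dist_def)

lemma lim_dist_le_dist1: "lim_dist x y \<le> 3 * dist1 x y"
  using dist1_comp_le[of t x y] Lam_le_dist1[of x y] by (simp add: lim_dist_def)

lemma lim_dist_half:
  assumes "x 0 = y 0" "x 1 = y 1"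
  shows "lim_dist x y \<le> lim_dist (shift1 x) (shift1 y) / 2"
proof -
  have "shift1 (t \<circ> u) = t \<circ> shift1 u" for u by (simp add: shift1_def comp_def)
  then show ?thesis
    using dist1_shift[of "t \<circ> x" "t \<circ> y"] Lam_half[OF assms] assms by (simp add: lim_dist_def)
qed

lemma lim_dist_eq_0_iff: "lim_dist x y = 0 \<longleftrightarrow> (\<forall>i. t (x i) = t (y i)) \<and> Lam x y = 0"
proof -
  have "dist1 (t \<circ> x) (t \<circ> y) = 0 \<longleftrightarrow> (\<forall>i. t (x i) = t (y i))"
    by (simp add: dist1_eq_0_iff fun_eq_iff)
  then show ?thesis
    using dist1_nonneg[of "t \<circ> x" "t \<circ> y"] Lam_nonneg[of x y] by (simp add: lim_dist_def add_nonneg_eq_0_iff)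
qed

lemma one_sided_arc: "x \<in> one_sided G \<Longrightarrow> x i \<in> arcs G"
  by (simp add: one_sided_def)

lemma one_sided_path: "x \<in> one_sided G \<Longrightarrow> head G (x i) = tail G (x (Suc i))"
  by (simp add: one_sided_def)

lemma shift1_one_sided: "x \<in> one_sided G \<Longrightarrow> shift1 x \<in> one_sided G"
  by (simp add: one_sided_def shift1_def)

lemma lim_dist_eq_0_Z:
  assumes "lim_dist x y = 0" "x \<in> one_sided G" "y \<in> one_sided G"
  shows "x i \<in> Z \<longleftrightarrow> y i \<in> Z"
  using assms by (intro t_eqD) (auto simp: lim_dist_eq_0_iff one_sided_arc)

lemma lim_dist_eq_0_shift:
  assumes "lim_dist x y = 0" "x \<in> one_sided G" "y \<in> one_sided G"
  shows "lim_dist (shift1 x) (shift1 y) = 0"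
  using assms lim_dist_eq_0_Z[OF assms, of 0] Lam_eq_0_shift[of x y]
  by (simp add: lim_dist_eq_0_iff) (simp add: shift1_def)

section \<open>Approximation of d by the d_l and density of the levels\<close>

lemma kappa_after_exit:
  assumes "enat (Suc l) \<le> kappa H \<xi> x"
  shows "\<not> (\<forall>i. x i \<in> Z)" "enat l \<le> kappa H \<xi> (after_exit x)"
proof -
  let ?S = "\<lambda>x. {n. x n \<notin> Z}"
  have "kappa H \<xi> x \<noteq> 0" using assms by (auto simp: zero_enat_def)
  then show nall: "\<not> (\<forall>i. x i \<in> Z)" by (simp only: kappa_eq_0_iff) simp
  then obtain n where n: "first_exit H \<xi> x = Suc n" "\<And>i. i < n \<Longrightarrow> x i \<in> Z"
    using first_exitE by blast
  have after: "after_exit x i = x (Suc n + i)" for i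
    by (simp add: after_exit_def n(1) shift1_funpow del: funpow.simps)
  show "enat l \<le> kappa H \<xi> (after_exit x)"
  proof (cases "finite (?S (after_exit x))")
    case True
    have "?S x \<subseteq> insert n ((+) (Suc n) ` ?S (after_exit x))"
    proof
      fix i assume "i \<in> ?S x"
      then have "i \<ge> n" using n(2)[of i] by (simp add: not_less[symmetric]) blast
      then show "i \<in> insert n ((+) (Suc n) ` ?S (after_exit x))"
        using \<open>i \<in> ?S x\<close> by (cases "i = n") (auto simp: after image_iff intro!: exI[of _ "i - Suc n"])
    qed
    moreover have "finite (insert n ((+) (Suc n) ` ?S (after_exit x)))" using True by simp
    ultimately have fin: "finite (?S x)"
      and le: "card (?S x) \<le> card (insert n ((+) (Suc n) ` ?S (after_exit x)))"
      by (auto intro: finite_subset card_mono)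
    note le
    also have "\<dots> \<le> Suc (card ((+) (Suc n) ` ?S (after_exit x)))" by (rule card_insert_le_m1) auto
    also have "\<dots> \<le> Suc (card (?S (after_exit x)))" using True by (simp add: card_image_le)
    finally show ?thesis using assms fin True by (simp add: kappa_def)
  qed (simp add: kappa_def)
qed

text \<open>As long as both points have exits, \<lambda>_l and \<open>Lam\<close> obey the same
  recursion. After l steps both values lie in [0,2], and each step has contracted their difference
  by 1/8. Lower bounds on \<open>kappa\<close> are used instead of equalities so that infinite
  \<open>kappa\<close> is included.\<close>

lemma lambda_dist_approx:
  assumes "enat l \<le> kappa H \<xi> x" "enat l \<le> kappa H \<xi> y"
  shows "\<bar>lambda_dist H \<xi> l x y - Lam x y\<bar> \<le> 2 * (1/8) ^ l"
  using assms
proof (induction l arbitrary: x y)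
  case 0
  show ?case
    using Lam_nonneg[of x y] Lam_le_2[of x y] dist_int_nonneg[of "angle x - angle y"]
      dist_int_le_half[of "angle x - angle y"]
    by (simp add: circle_dist_theta abs_le_iff)
next
  case (Suc l)
  have x: "exit_weight x = (1/2) ^ first_exit H \<xi> x" and y: "exit_weight y = (1/2) ^ first_exit H \<xi> y"
    using kappa_after_exit(1)[OF Suc.prems(1)] kappa_after_exit(1)[OF Suc.prems(2)]
    by (simp_all add: exit_weight_def del: not_all)
  have "(first_exit H \<xi> x = first_exit H \<xi> y \<and> theta H \<xi> x = theta H \<xi> y) \<longleftrightarrow> exit_diff x y = 0"
    by (simp add: exit_diff_eq_0_iff x y theta_eq_iff half_power_inject)
  then have eq: "lambda_dist H \<xi> (Suc l) x y = exit_diff x y +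
      (if exit_diff x y = 0 then exit_weight x / 4 * lambda_dist H \<xi> l (after_exit x) (after_exit y) else 0)"
    by (simp add: circle_dist_theta after_exit_def exit_diff_def x y)
  have IH: "\<bar>lambda_dist H \<xi> l (after_exit x) (after_exit y) - Lam (after_exit x) (after_exit y)\<bar> \<le> 2 * (1/8) ^ l"
    using Suc.prems by (intro Suc.IH kappa_after_exit(2))
  have "exit_weight x / 4 * \<bar>lambda_dist H \<xi> l (after_exit x) (after_exit y) - Lam (after_exit x) (after_exit y)\<bar>
      \<le> 1/8 * (2 * (1/8) ^ l)"
    using exit_weight_nonneg[of x] exit_weight_le_half[of x] by (intro mult_mono IH) auto
  moreover have "lambda_dist H \<xi> (Suc l) x y - Lam x y = (if exit_diff x y = 0 then
      exit_weight x / 4 * (lambda_dist H \<xi> l (after_exit x) (after_exit y) - Lam (after_exit x) (after_exit y)) else 0)"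
    unfolding eq by (subst Lam_unfold) (simp add: right_diff_distrib)
  ultimately show ?case using exit_weight_nonneg[of x] by (simp add: abs_mult)
qed

lemma level_dist_approx:
  assumes "enat l \<le> kappa H \<xi> x" "enat l \<le> kappa H \<xi> y"
  shows "\<bar>level_dist G H \<xi> l x y - lim_dist x y\<bar> \<le> 2 * (1/8) ^ l"
  using lambda_dist_approx[OF assms] by (simp add: level_dist_def lim_dist_def)

lemma level_iff:
  "x \<in> level G H \<xi> l \<longleftrightarrow> x \<in> one_sided G \<and> finite {n. x n \<notin> Z} \<and> card {n. x n \<notin> Z} = l"
  by (auto simp: level_def kappa_def Let_def split: if_splits)

lemma level_Cons:
  assumes "s \<in> level G H \<xi> l" "a \<in> arcs G" "head G a = tail G (s 0)"
  shows "case_nat a s \<in> level G H \<xi> (if a \<in> Z then l else Suc l)"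
proof -
  have "case_nat a s \<in> one_sided G"
    using assms by (auto simp: level_iff one_sided_def split: nat.split)
  moreover have "{n. case_nat a s n \<notin> Z} = (if a \<in> Z then {} else {0}) \<union> Suc ` {n. s n \<notin> Z}"
  proof (rule set_eqI)
    show "n \<in> {n. case_nat a s n \<notin> Z} \<longleftrightarrow> n \<in> (if a \<in> Z then {} else {0}) \<union> Suc ` {n. s n \<notin> Z}" for n
      by (cases n) auto
  qed
  moreover have "card (Suc ` {n. s n \<notin> Z}) = l" using assms(1) by (simp add: level_iff card_image)
  moreover have "finite {n. s n \<notin> Z}" using assms(1) by (simp add: level_iff)
  ultimately show ?thesis by (auto simp: level_iff)
qed

text \<open>Replace the first r arcs of the path by parallel ones outside \<open>Z\<close>: this
  creates exactly r exits.\<close>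

lemma level_from_Z_path:
  assumes "h \<in> one_sided G" "\<forall>i. h i \<in> Z"
  shows "\<exists>s\<in>level G H \<xi> r. tail G (s 0) = tail G (h 0)"
  using assms
proof (induction r arbitrary: h)
  case 0
  then show ?case by (auto simp: level_iff)
next
  case (Suc r)
  obtain b where b: "b \<in> arcs G" "b \<notin> Z" "tail G b = tail G (h 0)" "head G b = head G (h 0)"
    using parallel_arc Suc.prems by metis
  have "\<exists>s\<in>level G H \<xi> r. tail G (s 0) = tail G (shift1 h 0)"
    using Suc.prems by (intro Suc.IH shift1_one_sided) (auto simp: shift1_def)
  then obtain s where s: "s \<in> level G H \<xi> r" "tail G (s 0) = tail G (h 1)"
    by (auto simp: shift1_def)
  have "case_nat b s \<in> level G H \<xi> (Suc r)"
    using level_Cons[OF s(1) b(1)] b s(2) one_sided_path[OF Suc.prems(1), of 0] by simp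
  then show ?case using b(3) by (intro bexI[of _ "case_nat b s"]) auto
qed

text \<open>The walk itself produces at most \<open>length p\<close> exits; the continuation is
  chosen to supply the remaining ones.\<close>

lemma level_along_walk:
  assumes "pre_digraph.cas G u p v" "set p \<subseteq> arcs G" "\<And>l. \<exists>s\<in>level G H \<xi> l. tail G (s 0) = v"
    and "l \<ge> length p"
  shows "\<exists>s\<in>level G H \<xi> l. tail G (s 0) = u"
  using assms
proof (induction p arbitrary: u l)
  case Nil
  then show ?case by (simp add: pre_digraph.cas.simps)
next
  case (Cons a p)
  let ?l = "if a \<in> Z then l else l - 1"
  have "\<exists>s\<in>level G H \<xi> ?l. tail G (s 0) = head G a"
  proof (rule Cons.IH)
    show "\<exists>s\<in>level G H \<xi> l. tail G (s 0) = v" for l by (rule Cons.prems(3))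
  qed (use Cons.prems(1,2,4) in \<open>auto simp: pre_digraph.cas.simps\<close>)
  then obtain s where s: "s \<in> level G H \<xi> ?l" "tail G (s 0) = head G a" by blast
  have "case_nat a s \<in> level G H \<xi> (if a \<in> Z then ?l else Suc ?l)"
    using Cons.prems s by (intro level_Cons) auto
  then have "case_nat a s \<in> level G H \<xi> l" using Cons.prems(4) by (cases "a \<in> Z") auto
  then show ?case
    using Cons.prems(1) by (intro bexI[of _ "case_nat a s"]) (auto simp: pre_digraph.cas.simps)
qed

text \<open>The prefix uses up at most N exits and leaves at least m to the continuation.\<close>

lemma level_along_prefix:
  assumes "x \<in> one_sided G" "\<And>l. l \<ge> m \<Longrightarrow> \<exists>s\<in>level G H \<xi> l. tail G (s 0) = tail G (x N)"
    and "l \<ge> m + N"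
  shows "\<exists>s\<in>level G H \<xi> l. tail G (s 0) = tail G (x 0) \<and> (\<forall>i<N. s i = x i)"
  using assms
proof (induction N arbitrary: x l)
  case (Suc N)
  let ?l = "if x 0 \<in> Z then l else l - 1"
  have "\<exists>s\<in>level G H \<xi> ?l. tail G (s 0) = tail G (shift1 x 0) \<and> (\<forall>i<N. s i = shift1 x i)"
    using Suc.prems by (intro Suc.IH shift1_one_sided) (auto simp: shift1_def)
  then obtain s where s: "s \<in> level G H \<xi> ?l" "tail G (s 0) = tail G (x 1)" "\<forall>i<N. s i = x (Suc i)"
    by (auto simp: shift1_def)
  have "case_nat (x 0) s \<in> level G H \<xi> (if x 0 \<in> Z then ?l else Suc ?l)"
    using Suc.prems(1) s(2) one_sided_path[of x 0]
    by (intro level_Cons s(1)) (auto simp: one_sided_arc)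
  then have "case_nat (x 0) s \<in> level G H \<xi> l" using Suc.prems(3) by (cases "x 0 \<in> Z") auto
  moreover have "case_nat (x 0) s i = x i" if "i < Suc N" for i
    using s(3) that by (cases i) auto
  ultimately show ?case by (intro bexI[of _ "case_nat (x 0) s"]) auto
qed simp

text \<open>The part of a point of some level after its last exit is a path inside \<open>Z\<close>,
  from which points with any number of exits start. Primitivity reaches its initial vertex from
  every vertex in the same number K of steps. So at level l the first l - K symbols of x can be
  kept.\<close>

lemma level_dense:
  assumes "level G H \<xi> k \<noteq> {}" "x \<in> one_sided G"
  obtains xs where "\<And>l. xs l \<in> level G H \<xi> l" "(\<lambda>l. dist1 (xs l) x) \<longlonglongrightarrow> 0"
proof -
  obtain w where w: "w \<in> one_sided G" "finite {n. w n \<notin> Z}" using assms(1) by (auto simp: level_iff)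
  obtain M where M: "\<forall>n\<in>{n. w n \<notin> Z}. n < M" using w(2) finite_nat_set_iff_bounded by blast
  define h where "h i = w (M + i)" for i
  have h: "h \<in> one_sided G" using w(1) by (simp add: one_sided_def h_def)
  have hZ: "\<forall>i. h i \<in> Z" using M by (force simp: h_def)
  have base: "\<exists>s\<in>level G H \<xi> l. tail G (s 0) = tail G (h 0)" for l
    by (rule level_from_Z_path[OF h hZ])
  have wf: "wf_digraph G" using fin_G by (rule fin_digraph.axioms)
  obtain K where K: "\<forall>v\<in>verts G. \<forall>w\<in>verts G. \<exists>p. pre_digraph.awalk G v p w \<and> length p = K"
    using hyps unfolding standing_hypotheses_def primitive_def by blast
  have start: "\<exists>s\<in>level G H \<xi> l. tail G (s 0) = tail G (x N)" if "l \<ge> K" for l N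
  proof -
    have "tail G (x N) \<in> verts G" "tail G (h 0) \<in> verts G"
      using wf one_sided_arc assms(2) h by (auto simp: wf_digraph_def)
    then obtain p where "pre_digraph.awalk G (tail G (x N)) p (tail G (h 0))" "length p = K"
      using K by blast
    with that show ?thesis
      by (intro level_along_walk[OF _ _ base]) (auto simp: pre_digraph.awalk_def)
  qed
  have "\<exists>s\<in>level G H \<xi> l. \<forall>i<l - K. s i = x i" for l
  proof (cases "l \<ge> K")
    case True
    then show ?thesis using level_along_prefix[OF assms(2) start, of K "l - K" l] by auto
  next
    case False
    then show ?thesis using base[of l] by auto
  qed
  then obtain xs where xs: "\<And>l. xs l \<in> level G H \<xi> l" "\<And>l. \<forall>i<l - K. xs l i = x i" by metis
  have lim: "(\<lambda>l. (1/2::real) ^ (l - K)) \<longlonglongrightarrow> 0"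
    using LIMSEQ_offset[of "\<lambda>l. (1/2::real) ^ (l - K)" K] by (simp add: LIMSEQ_realpow_zero)
  have "(\<lambda>l. dist1 (xs l) x) \<longlonglongrightarrow> 0"
    by (rule tendsto_sandwich[OF _ _ tendsto_const lim]) (auto simp: dist1_nonneg dist1_le_iff xs(2))
  with xs(1) show ?thesis by (rule that)
qed

lemma pow8_tendsto: "(\<lambda>l. 2 * (1/8::real) ^ l) \<longlonglongrightarrow> 0"
  by (intro tendsto_mult_right_zero LIMSEQ_realpow_zero) auto

text \<open>Replacing d_l by \<open>lim_dist\<close> costs a uniform error tending to 0, and
  \<open>lim_dist\<close> is 3-Lipschitz in each argument.\<close>

lemma level_dist_tendsto:
  assumes "\<And>l. xs l \<in> level G H \<xi> l" "\<And>l. ys l \<in> level G H \<xi> l"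
    and "(\<lambda>l. dist1 (xs l) x) \<longlonglongrightarrow> 0" "(\<lambda>l. dist1 (ys l) y) \<longlonglongrightarrow> 0"
  shows "(\<lambda>l. level_dist G H \<xi> l (xs l) (ys l)) \<longlonglongrightarrow> lim_dist x y"
proof (rule LIM_zero_cancel, rule Lim_null_comparison)
  show "\<forall>\<^sub>F l in sequentially. norm (level_dist G H \<xi> l (xs l) (ys l) - lim_dist x y)
      \<le> 2 * (1/8) ^ l + 3 * dist1 (xs l) x + 3 * dist1 (ys l) y"
  proof (rule always_eventually, rule allI)
    fix l
    have "\<bar>level_dist G H \<xi> l (xs l) (ys l) - lim_dist (xs l) (ys l)\<bar> \<le> 2 * (1/8) ^ l"
      using assms(1)[of l] assms(2)[of l] by (intro level_dist_approx) (auto simp: level_def)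
    moreover have "\<bar>lim_dist (xs l) (ys l) - lim_dist x y\<bar> \<le> lim_dist (xs l) x + lim_dist (ys l) y"
      using lim_dist_triangle[of "xs l" "ys l" x] lim_dist_triangle[of x "ys l" y]
        lim_dist_triangle[of x y "xs l"] lim_dist_triangle[of "xs l" y "ys l"]
        lim_dist_sym[of x "xs l"] lim_dist_sym[of y "ys l"]
      unfolding abs_le_iff by linarith
    moreover have "lim_dist (xs l) x \<le> 3 * dist1 (xs l) x" "lim_dist (ys l) y \<le> 3 * dist1 (ys l) y"
      by (rule lim_dist_le_dist1)+
    ultimately show "norm (level_dist G H \<xi> l (xs l) (ys l) - lim_dist x y)
      \<le> 2 * (1/8) ^ l + 3 * dist1 (xs l) x + 3 * dist1 (ys l) y"
      unfolding real_norm_def abs_le_iff by linarith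
  qed
  show "(\<lambda>l. 2 * (1/8) ^ l + 3 * dist1 (xs l) x + 3 * dist1 (ys l) y) \<longlonglongrightarrow> 0"
    using tendsto_add[OF tendsto_add[OF pow8_tendsto tendsto_mult_right_zero[OF assms(3), of 3]]
        tendsto_mult_right_zero[OF assms(4), of 3]] by simp
qed

lemma pseudo_dist_eq:
  assumes "x \<in> one_sided G" "y \<in> one_sided G"
  shows "pseudo_dist G H \<xi> x y = lim_dist x y"
proof (cases "\<exists>k. level G H \<xi> k \<noteq> {}")
  case True
  then obtain k where k: "level G H \<xi> k \<noteq> {}" by blast
  obtain xs where xs: "\<And>l. xs l \<in> level G H \<xi> l" "(\<lambda>l. dist1 (xs l) x) \<longlonglongrightarrow> 0"
    using level_dense[OF k assms(1)] by blast
  obtain ys where ys: "\<And>l. ys l \<in> level G H \<xi> l" "(\<lambda>l. dist1 (ys l) y) \<longlonglongrightarrow> 0"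
    using level_dense[OF k assms(2)] by blast
  let ?P = "\<lambda>r. \<forall>xs ys. (\<forall>l. xs l \<in> level G H \<xi> l \<and> ys l \<in> level G H \<xi> l)
      \<longrightarrow> (\<lambda>l. dist1 (xs l) x) \<longlonglongrightarrow> 0 \<longrightarrow> (\<lambda>l. dist1 (ys l) y) \<longlonglongrightarrow> 0
      \<longrightarrow> (\<lambda>l. level_dist G H \<xi> l (xs l) (ys l)) \<longlonglongrightarrow> r"
  have "(THE r. ?P r) = lim_dist x y"
  proof (rule the_equality)
    show "?P (lim_dist x y)" using level_dist_tendsto by blast
    fix r assume "?P r"
    then have "(\<lambda>l. level_dist G H \<xi> l (xs l) (ys l)) \<longlonglongrightarrow> r" using xs ys by blast
    then show "r = lim_dist x y"
      using level_dist_tendsto[OF xs(1) ys(1) xs(2) ys(2)] by (rule LIMSEQ_unique)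
  qed
  with True show ?thesis by (simp add: pseudo_dist_def)
next
  case False
  have inf: "kappa H \<xi> u = \<infinity>" if "u \<in> one_sided G" for u
    using False that by (cases "kappa H \<xi> u") (auto simp: level_def)
  have "(\<lambda>l. level_dist G H \<xi> l x y) \<longlonglongrightarrow> lim_dist x y"
  proof (rule LIM_zero_cancel, rule Lim_null_comparison[OF _ pow8_tendsto])
    show "\<forall>\<^sub>F l in sequentially. norm (level_dist G H \<xi> l x y - lim_dist x y) \<le> 2 * (1/8) ^ l"
      using level_dist_approx inf assms by (intro always_eventually) simp
  qed
  with False show ?thesis by (simp add: pseudo_dist_def limI)
qed

subsection \<open>The relation $\sim_\xi$\<close>

lemma digit_eps: "(\<And>i. x i \<in> Z) \<Longrightarrow> digit x i = eps H \<xi> (x i)"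
  by (simp add: digit_def)

lemma all_Z_copy:
  assumes "\<And>i. h i \<in> arcs H" "\<And>i. x i = xa j (h i)"
  shows "\<forall>i. x i \<in> Z" "angle x = of_bool j"
proof -
  show Z: "\<forall>i. x i \<in> Z" using assms by (simp add: xa_in_Z)
  then have "digit x = (\<lambda>i. j)" using assms by (simp add: fun_eq_iff digit_eps eps_xa)
  then show "angle x = of_bool j" by (cases j) (simp_all add: angle_def)
qed

lemma Lam_all_Z:
  assumes "\<forall>i. x i \<in> Z" "\<forall>i. y i \<in> Z" "dist_int (angle x - angle y) = 0"
  shows "Lam x y = 0"
proof -
  have "exit_weight x = 0" "exit_weight y = 0" using assms by (simp_all add: exit_weight_def)
  then show ?thesis using assms(3) by (subst Lam_unfold) (simp add: exit_diff_def)
qed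

text \<open>From position n on, both sequences have the angle 1/2, written as 0.1000... and
  0.0111.... The angles agree as reals, so the common prefix does no harm.\<close>

lemma lim_dist_carry:
  assumes "x \<in> one_sided G" "y \<in> one_sided G" "\<And>i. i \<ge> n \<Longrightarrow> h i \<in> arcs H"
    and "\<And>i. i < n \<Longrightarrow> x i = y i" "x n = xa (\<not> j) (h n)" "y n = xa j (h n)"
    and "\<And>i. i > n \<Longrightarrow> x i = xa j (h i)" "\<And>i. i > n \<Longrightarrow> y i = xa (\<not> j) (h i)"
  shows "lim_dist x y = 0"
proof -
  have "t (x i) = t (y i)" for i
  proof -
    consider "i < n" | "i = n" | "i > n" by linarith
    then show ?thesis
    proof cases
      case 2
      then have "h i \<in> arcs H" "x i = xa (\<not> j) (h i)" "y i = xa (\<not> (\<not> j)) (h i)"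
        using assms(3,5,6) by auto
      then show ?thesis using assms(1,2) by (subst t_eq_iff) (blast intro: one_sided_arc)+
    next
      case 3
      then have "h i \<in> arcs H" "x i = xa j (h i)" "y i = xa (\<not> j) (h i)"
        using assms(3,7,8) by auto
      then show ?thesis using assms(1,2) by (subst t_eq_iff) (blast intro: one_sided_arc)+
    qed (simp add: assms(4))
  qed
  moreover have "strongly_equal x y"
  proof (rule strongly_equal_prefix[OF assms(4)])
    define u v where "u = (shift1 ^^ n) x" and "v = (shift1 ^^ n) y"
    have u: "u i = x (n + i)" and v: "v i = y (n + i)" for i by (simp_all add: u_def v_def shift1_funpow)
    have *: "\<forall>i. shift1 u i \<in> Z" "angle (shift1 u) = of_bool j"
      "\<forall>i. shift1 v i \<in> Z" "angle (shift1 v) = of_bool (\<not> j)"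
      by (rule all_Z_copy[of "\<lambda>i. h (Suc (n + i))"]; simp add: shift1_def u v assms)+
    have u0: "u 0 \<in> Z" "eps H \<xi> (u 0) = (\<not> j)" and v0: "v 0 \<in> Z" "eps H \<xi> (v 0) = j"
      using assms(3)[of n] by (simp_all add: u v assms(5,6) xa_in_Z eps_xa)
    have all: "\<forall>i. u i \<in> Z" "\<forall>i. v i \<in> Z"
      using all_in_shift[of u] all_in_shift[of v] u0 v0 * by simp_all
    have "angle u = angle v"
      using angle_in[of u] angle_in[of v] u0 v0 * by (cases j) simp_all
    moreover have "exit_weight u = 0" "exit_weight v = 0" using all by (simp_all add: exit_weight_def)
    ultimately show "strongly_equal u v"
      using Lam_all_Z[OF all] by (simp add: strongly_equal_def)
  qed
  ultimately show ?thesis by (simp add: lim_dist_eq_0_iff strongly_equal_def)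
qed

text \<open>From position n on the angles are 0 and 1, equal only modulo 1. If n > 0, the symbol
  outside \<open>Z\<close> at n - 1 makes both angles 0 there, so strong equality holds from n - 1
  on and passes through the rest of the prefix.\<close>

lemma lim_dist_opposite:
  assumes "x \<in> one_sided G" "y \<in> one_sided G" "\<And>i. i \<ge> n \<Longrightarrow> h i \<in> arcs H"
    and "\<And>i. i < n \<Longrightarrow> x i = y i" "n = 0 \<or> x (n - 1) \<notin> Z"
    and "\<And>i. i \<ge> n \<Longrightarrow> x i = xa j (h i)" "\<And>i. i \<ge> n \<Longrightarrow> y i = xa (\<not> j) (h i)"
  shows "lim_dist x y = 0"
proof -
  have "t (x i) = t (y i)" for i
  proof (cases "i < n")
    case False
    then have "h i \<in> arcs H" "x i = xa j (h i)" "y i = xa (\<not> j) (h i)"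
      using assms(3,6,7) by auto
    then show ?thesis using assms(1,2) by (subst t_eq_iff) (blast intro: one_sided_arc)+
  qed (simp add: assms(4))
  moreover have Lam_n: "Lam ((shift1 ^^ n) x) ((shift1 ^^ n) y) = 0"
  proof -
    define u v where "u = (shift1 ^^ n) x" and "v = (shift1 ^^ n) y"
    have u: "u i = x (n + i)" and v: "v i = y (n + i)" for i by (simp_all add: u_def v_def shift1_funpow)
    have *: "\<forall>i. u i \<in> Z" "angle u = of_bool j" "\<forall>i. v i \<in> Z" "angle v = of_bool (\<not> j)"
      by (rule all_Z_copy[of "\<lambda>i. h (n + i)"]; simp add: u v assms)+
    have "angle u - angle v \<in> \<int>" unfolding * by (cases j) simp_all
    then show "Lam u v = 0" using * by (intro Lam_all_Z) (auto simp: dist_int_eq_0_iff)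
  qed
  have "Lam x y = 0"
  proof (cases n)
    case (Suc m)
    have "strongly_equal x y"
    proof (rule strongly_equal_prefix[of m])
      show "x i = y i" if "i < m" for i using assms(4) Suc that by simp
      define u v where "u = (shift1 ^^ m) x" and "v = (shift1 ^^ m) y"
      have "u 0 \<notin> Z" "v 0 \<notin> Z" using assms(4)[of m] assms(5) Suc
        by (simp_all add: u_def v_def shift1_funpow)
      moreover have "Lam (shift1 u) (shift1 v) = 0"
        using Lam_n Suc by (simp add: u_def v_def)
      ultimately show "strongly_equal u v"
        using Lam_out[of u v] by (simp add: strongly_equal_def exit_weight_out angle_out)
    qed
    then show ?thesis by (simp add: strongly_equal_def)
  qed (use Lam_n in simp)
  ultimately show ?thesis by (simp add: lim_dist_eq_0_iff)
qed

lemma block_start: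
  fixes x :: "nat \<Rightarrow> 'e"
  assumes "x n \<in> Z"
  obtains m where "m \<le> n" "m = 0 \<or> x (m - 1) \<notin> Z" "\<And>i. m \<le> i \<Longrightarrow> i \<le> n \<Longrightarrow> x i \<in> Z"
proof -
  have "\<exists>m\<le>n. (m = 0 \<or> x (m - 1) \<notin> Z) \<and> (\<forall>i. m \<le> i \<and> i \<le> n \<longrightarrow> x i \<in> Z)"
    using assms
  proof (induction n)
    case (Suc n)
    show ?case
    proof (cases "x n \<in> Z")
      case True
      then obtain m where "m \<le> n" "m = 0 \<or> x (m - 1) \<notin> Z" "\<forall>i. m \<le> i \<and> i \<le> n \<longrightarrow> x i \<in> Z"
        using Suc.IH by blast
      then show ?thesis using Suc.prems by (intro exI[of _ m]) (auto simp: le_Suc_eq)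
    next
      case False
      then show ?thesis using Suc.prems by (intro exI[of _ "Suc n"]) (auto dest: le_antisym)
    qed
  qed (auto intro!: exI[of _ 0])
  then show ?thesis using that by blast
qed

text \<open>Let n be the first disagreement and m the start of its block in \<open>Z\<close>.
  Distance 0 persists under the shift to m, where the angles read the digits of the block, and two
  binary expansions equal modulo 1 differ by a carry or by the wrap-around. The latter needs n = m,
  which gives the condition on the preceding symbol.\<close>

lemma lim_dist_eq_0_cases:
  assumes "lim_dist x y = 0" "x \<in> one_sided G" "y \<in> one_sided G"
  obtains "x = y"
  | (carry) n j h where "\<And>i. i \<ge> n \<Longrightarrow> h i \<in> arcs H" "\<And>i. i < n \<Longrightarrow> x i = y i"
      "x n = xa (\<not> j) (h n)" "y n = xa j (h n)"
      "\<And>i. i > n \<Longrightarrow> x i = xa j (h i) \<and> y i = xa (\<not> j) (h i)"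
  | (opposite) n j h where "\<And>i. i \<ge> n \<Longrightarrow> h i \<in> arcs H" "n = 0 \<or> x (n - 1) \<notin> Z"
      "\<And>i. i < n \<Longrightarrow> x i = y i" "\<And>i. i \<ge> n \<Longrightarrow> x i = xa j (h i) \<and> y i = xa (\<not> j) (h i)"
proof (cases "x = y")
  case False
  have teq: "t (x i) = t (y i)" for i using assms(1) by (simp add: lim_dist_eq_0_iff)
  have Lam0: "Lam x y = 0" using assms(1) by (simp add: lim_dist_eq_0_iff)
  note mem = lim_dist_eq_0_Z[OF assms]
  have copies: "\<exists>h\<in>arcs H. x i = xa (eps H \<xi> (x i)) h \<and> y i = xa (\<not> eps H \<xi> (x i)) h" if ne: "x i \<noteq> y i" for i
  proof -
    obtain j h where "h \<in> arcs H" "x i = xa j h" "y i = xa (\<not> j) h"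
      using t_eq_neqE[OF teq one_sided_arc[OF assms(2)] one_sided_arc[OF assms(3)] ne] .
    then show ?thesis by (auto simp: eps_xa)
  qed
  define n where "n = (LEAST i. x i \<noteq> y i)"
  have "\<exists>i. x i \<noteq> y i" using False by (auto simp: fun_eq_iff)
  then have n: "x n \<noteq> y n" unfolding n_def by (rule LeastI_ex)
  have pre: "x i = y i" if "i < n" for i using that not_less_Least unfolding n_def by blast
  have "x n \<in> Z" using copies[OF n] xa_in_Z by metis
  then obtain m where m: "m \<le> n" "m = 0 \<or> x (m - 1) \<notin> Z" "\<And>i. m \<le> i \<Longrightarrow> i \<le> n \<Longrightarrow> x i \<in> Z"
    by (rule block_start) blast
  define u v where "u = (shift1 ^^ m) x" and "v = (shift1 ^^ m) y"
  have u: "u i = x (m + i)" and v: "v i = y (m + i)" for i by (simp_all add: u_def v_def shift1_funpow)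
  have "Lam u v = 0" unfolding u_def v_def by (rule Lam_eq_0_funpow[OF Lam0 mem])
  then have d0: "dist_int (binary_value (digit u) - binary_value (digit v)) = 0"
    using exit_diff_le_Lam[of u v] exit_diff_nonneg[of u v] by (simp add: exit_diff_eq_0_iff angle_def)
  have memuv: "u i \<in> Z \<longleftrightarrow> v i \<in> Z" for i using mem by (simp add: u v)
  have digit_block: "digit u i = eps H \<xi> (u i)" "digit v i = eps H \<xi> (v i)" if "i \<le> n - m" for i
  proof -
    have "u k \<in> Z" if "k \<le> i" for k using m(1) m(3)[of "m + k"] that \<open>i \<le> n - m\<close> by (simp add: u)
    then show "digit u i = eps H \<xi> (u i)" "digit v i = eps H \<xi> (v i)"
      using memuv by (simp_all add: digit_def)
  qed
  have neq: "digit u (n - m) \<noteq> digit v (n - m)"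
    using copies[OF n] m(1) digit_block[of "n - m"] by (auto simp: u v eps_xa)
  have "\<forall>i<n - m. digit u i = digit v i" using pre digit_block by (auto simp: u v)
  from dist_int_binary_value_eq_0[OF d0 this neq]
  have alt: "(\<forall>i>n - m. digit u i = (\<not> digit u (n - m)) \<and> digit v i = digit u (n - m))
      \<or> n - m = 0 \<and> (\<forall>i. digit u i = digit u 0 \<and> digit v i = (\<not> digit u 0))" .
  then have dig_neq: "digit u i \<noteq> digit v i" if "i \<ge> n - m" for i
    using that neq by (cases "i = n - m") (auto simp: order_less_le)
  \<comment> \<open>The digits differ at arbitrarily late positions, so one of them is 1 there; a
    digit 1 certifies that no exit has occurred up to its position.\<close>
  then have allZ: "u i \<in> Z" for i
  proof -
    have "digit u (n - m + i) \<or> digit v (n - m + i)" using dig_neq[of "n - m + i"] by auto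
    then have "u i \<in> Z \<or> v i \<in> Z" by (auto simp: digit_def)
    then show ?thesis using memuv by simp
  qed
  then have digs: "digit u i = eps H \<xi> (u i)" "digit v i = eps H \<xi> (v i)" for i
    using memuv by (simp_all add: digit_eps)
  have xy_neq: "x i \<noteq> y i" if "i \<ge> n" for i
    using dig_neq[of "i - m", OF diff_le_mono[OF that]] that m(1) by (auto simp: digs u v)
  then obtain h where h: "\<And>i. i \<ge> n \<Longrightarrow> h i \<in> arcs H"
    "\<And>i. i \<ge> n \<Longrightarrow> x i = xa (eps H \<xi> (x i)) (h i) \<and> y i = xa (\<not> eps H \<xi> (x i)) (h i)"
    using copies by metis
  define j where "j = eps H \<xi> (x n)"
  have j: "digit u (n - m) = j" using m(1) by (simp add: digs u j_def)
  from alt show ?thesis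
  proof
    assume *: "\<forall>i>n - m. digit u i = (\<not> digit u (n - m)) \<and> digit v i = digit u (n - m)"
    have e: "eps H \<xi> (x i) = (\<not> j)" if "i > n" for i
      using *[rule_format, of "i - m"] that m(1) j by (simp add: digs u)
    have gt: "x i = xa (\<not> j) (h i) \<and> y i = xa (\<not> \<not> j) (h i)" if "i > n" for i
      using h(2)[of i] that unfolding e[OF that] by simp
    have at: "x n = xa (\<not> \<not> j) (h n)" "y n = xa (\<not> j) (h n)"
      using h(2)[of n] unfolding j_def[symmetric] by simp_all
    \<comment> \<open>The index in \<open>carry\<close> names the copy used by x after position n,
      hence the negation of its digit at n.\<close>
    show ?thesis by (rule carry[of n h "\<not> j"]) (use h(1) pre gt at in blast)+
  next
    assume *: "n - m = 0 \<and> (\<forall>i. digit u i = digit u 0 \<and> digit v i = (\<not> digit u 0))"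
    then have nm: "n = m" using m(1) by simp
    have e: "eps H \<xi> (x i) = j" if "i \<ge> n" for i
      using conjunct2[OF *, rule_format, of "i - m"] that j nm by (simp add: digs u)
    have ge: "x i = xa j (h i) \<and> y i = xa (\<not> j) (h i)" if "i \<ge> n" for i
      using h(2)[of i] that unfolding e[OF that] by simp
    show ?thesis by (rule opposite[of n h j]) (use h(1) pre m(2) nm ge in blast)+
  qed
qed (rule that(1))

text \<open>This makes transitivity of the relation a consequence of the triangle inequality instead
  of a case distinction on sequences.\<close>

lemma sim_xi_iff:
  "(x, y) \<in> sim_xi G H \<xi> \<longleftrightarrow> x \<in> one_sided G \<and> y \<in> one_sided G \<and> lim_dist x y = 0"
proof
  assume sim: "(x, y) \<in> sim_xi G H \<xi>"
  then have os: "x \<in> one_sided G" "y \<in> one_sided G" by (auto simp: sim_xi_def)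
  from sim consider "x = y"
    | (carry) "\<exists>n j h. (\<forall>i\<ge>n. h i \<in> arcs H) \<and> (\<forall>i<n. x i = y i) \<and> x n = xa (\<not> j) (h n) \<and>
        y n = xa j (h n) \<and> (\<forall>i>n. x i = xa j (h i) \<and> y i = xa (\<not> j) (h i))"
    | (opposite) "\<exists>n j h. (\<forall>i\<ge>n. h i \<in> arcs H) \<and> (n = 0 \<or> x (n - 1) \<notin> Z) \<and>
        (\<forall>i<n. x i = y i) \<and> (\<forall>i\<ge>n. x i = xa j (h i) \<and> y i = xa (\<not> j) (h i))"
    unfolding sim_xi_def mem_Collect_eq prod.case by argo
  then have "lim_dist x y = 0"
  proof cases
    case carry
    then obtain n j h where "\<forall>i\<ge>n. h i \<in> arcs H" "\<forall>i<n. x i = y i" "x n = xa (\<not> j) (h n)"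
      "y n = xa j (h n)" "\<forall>i>n. x i = xa j (h i) \<and> y i = xa (\<not> j) (h i)" by (elim exE conjE)
    then show ?thesis using os by (intro lim_dist_carry[of x y n h j]) simp_all
  next
    case opposite
    then obtain n j h where "\<forall>i\<ge>n. h i \<in> arcs H" "n = 0 \<or> x (n - 1) \<notin> Z"
      "\<forall>i<n. x i = y i" "\<forall>i\<ge>n. x i = xa j (h i) \<and> y i = xa (\<not> j) (h i)" by (elim exE conjE)
    then show ?thesis using os by (intro lim_dist_opposite[of x y n h j]) simp_all
  qed simp
  with os show "x \<in> one_sided G \<and> y \<in> one_sided G \<and> lim_dist x y = 0" by blast
next
  assume *: "x \<in> one_sided G \<and> y \<in> one_sided G \<and> lim_dist x y = 0"
  then have os: "x \<in> one_sided G" "y \<in> one_sided G" and d: "lim_dist x y = 0" by auto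
  from d os show "(x, y) \<in> sim_xi G H \<xi>"
  proof (cases rule: lim_dist_eq_0_cases)
    case (carry n j h)
    then have "\<exists>n j h. (\<forall>i\<ge>n. h i \<in> arcs H) \<and> (\<forall>i<n. x i = y i) \<and>
         x n = xa (\<not> j) (h n) \<and> y n = xa j (h n) \<and>
         (\<forall>i>n. x i = xa j (h i) \<and> y i = xa (\<not> j) (h i))"
      by (intro exI[of _ n] exI[of _ j] exI[of _ h]) blast
    with os show ?thesis unfolding sim_xi_def by blast
  next
    case (opposite n j h)
    then have "\<exists>n j h. (\<forall>i\<ge>n. h i \<in> arcs H) \<and> (n = 0 \<or> x (n - 1) \<notin> Z) \<and> (\<forall>i<n. x i = y i) \<and>
         (\<forall>i\<ge>n. x i = xa j (h i) \<and> y i = xa (\<not> j) (h i))"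
      by (intro exI[of _ n] exI[of _ j] exI[of _ h]) blast
    with os show ?thesis unfolding sim_xi_def by blast
  qed (simp add: sim_xi_def os)
qed

subsection \<open>The quotient of the one-sided shift\<close>

abbreviation p1 :: "(nat \<Rightarrow> 'e) \<Rightarrow> (nat \<Rightarrow> 'e) set" where
  "p1 \<equiv> pi1 G H \<xi>"

lemma mem_pi1_iff: "y \<in> p1 x \<longleftrightarrow> x \<in> one_sided G \<and> y \<in> one_sided G \<and> lim_dist x y = 0"
  by (simp add: pi1_def sim_xi_iff)

lemma lim_dist_cong:
  assumes "lim_dist x x' = 0" "lim_dist y y' = 0"
  shows "lim_dist x y = lim_dist x' y'"
  using lim_dist_triangle[of x y x'] lim_dist_triangle[of x' y y'] lim_dist_triangle[of x' y' x]
    lim_dist_triangle[of x y' y] lim_dist_sym[of x x'] lim_dist_sym[of y y'] assms by linarith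

lemma pi1_eq_iff:
  assumes "x \<in> one_sided G" "y \<in> one_sided G"
  shows "p1 x = p1 y \<longleftrightarrow> lim_dist x y = 0"
proof
  assume "p1 x = p1 y"
  moreover have "y \<in> p1 y" using assms by (simp add: mem_pi1_iff)
  ultimately show "lim_dist x y = 0" using mem_pi1_iff by blast
next
  assume "lim_dist x y = 0"
  then have "lim_dist x z = lim_dist y z" for z by (rule lim_dist_cong) simp
  then show "p1 x = p1 y" using assms by (auto simp: mem_pi1_iff)
qed

lemma quot1_eq: "quot1 G H \<xi> = p1 ` one_sided G"
  by (auto simp: quot1_def quotient_def pi1_def)

lemma quot1_shift_pi1:
  assumes "x \<in> one_sided G"
  shows "quot1_shift G H \<xi> (p1 x) = p1 (shift1 x)"
proof -
  have "p1 (shift1 y) = p1 (shift1 x)" if "y \<in> p1 x" for y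
    using that lim_dist_eq_0_shift[of x y] lim_dist_sym[of "shift1 x"]
    by (subst pi1_eq_iff) (auto simp: mem_pi1_iff shift1_one_sided)
  moreover have "x \<in> p1 x" using assms by (simp add: mem_pi1_iff)
  ultimately have "{p1 (shift1 y) |y. y \<in> p1 x} = {p1 (shift1 x)}" by blast
  then show ?thesis by (simp add: quot1_shift_def)
qed

lemma quot1_dist_pi1:
  assumes "x \<in> one_sided G" "y \<in> one_sided G"
  shows "quot1_dist G H \<xi> (p1 x) (p1 y) = lim_dist x y"
proof -
  have "pseudo_dist G H \<xi> u v = lim_dist x y" if "u \<in> p1 x" "v \<in> p1 y" for u v
    using that lim_dist_cong[of x u y v] by (simp add: pseudo_dist_eq mem_pi1_iff)
  moreover have "x \<in> p1 x" "y \<in> p1 y" using assms by (simp_all add: mem_pi1_iff)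
  ultimately have "{pseudo_dist G H \<xi> u v |u v. u \<in> p1 x \<and> v \<in> p1 y} \<subseteq> {lim_dist x y}"
    "{pseudo_dist G H \<xi> u v |u v. u \<in> p1 x \<and> v \<in> p1 y} \<noteq> {}" by auto
  then have "{pseudo_dist G H \<xi> u v |u v. u \<in> p1 x \<and> v \<in> p1 y} = {lim_dist x y}"
    by (simp only: subset_singleton_iff) simp
  then show ?thesis by (simp add: quot1_dist_def)
qed

text \<open>
  Changing the angle of \<^term>\<open>shift1 u\<close> by an odd integer is compensated by exchanging the two
  copies of the first symbol.
\<close>

lemma lift_along_shift:
  assumes "u \<in> one_sided G" "w \<in> one_sided G" "lim_dist (shift1 u) w = 0"
  obtains v where "v \<in> one_sided G" "lim_dist u v = 0" "shift1 v = w"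
proof -
  have w0: "t (u 1) = t (w 0)" using assms(3) by (simp add: lim_dist_eq_0_iff shift1_def)
  then have tail_w: "tail G (w 0) = head G (u 0)"
    using t_eqD(2)[OF w0] assms one_sided_path[OF assms(1), of 0] by (simp add: one_sided_arc)
  have sh: "shift1 (case_nat a w) = w" for a by (simp add: shift1_def)
  have os: "case_nat a w \<in> one_sided G" if "a \<in> arcs G" "t (u 0) = t a" for a
    using assms(2) that tail_w t_eqD(3)[OF that(2) one_sided_arc[OF assms(1)] that(1)]
    by (auto simp: one_sided_def split: nat.split)
  have tt: "t (u i) = t (case_nat a w i)" if "t (u 0) = t a" for a i
    using that assms(3) by (cases i) (auto simp: lim_dist_eq_0_iff shift1_def)
  have Lamw: "Lam (shift1 u) w = 0" using assms(3) by (simp add: lim_dist_eq_0_iff)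
  show ?thesis
  proof (cases "u 0 \<in> Z")
    case False
    have "Lam u (case_nat (u 0) w) = 0"
      using Lam_out[of u "case_nat (u 0) w"] False Lamw by (simp add: sh)
    then have "lim_dist u (case_nat (u 0) w) = 0"
      unfolding lim_dist_eq_0_iff using tt[OF refl] by blast
    with os[OF one_sided_arc[OF assms(1)] refl] show ?thesis using sh by (rule that)
  next
    case True
    then obtain j h where h: "h \<in> arcs H" "u 0 = xa j h" by (rule ZE)
    have diff: "exit_diff (shift1 u) w = 0" and res: "residue (shift1 u) w = 0"
      using Lam_residue[of "shift1 u" w] residue_nonneg[of "shift1 u" w]
        exit_diff_nonneg[of "shift1 u" w] Lamw by linarith+
    from diff obtain m where m: "angle (shift1 u) - angle w = of_int m"
      by (auto simp: exit_diff_eq_0_iff dist_int_eq_0_iff elim: Ints_cases)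
    define a where "a = xa (j \<noteq> odd m) h"
    have a: "a \<in> arcs G" "a \<in> Z" "eps H \<xi> a = (j \<noteq> odd m)"
      using h by (auto simp: a_def xa_in_arcs xa_in_Z eps_xa)
    have ta: "t (u 0) = t a"
    proof (cases "odd m")
      case True
      then have "a = xa (\<not> j) h" by (simp add: a_def)
      with h show ?thesis by (subst t_eq_iff) (auto simp: xa_in_arcs)
    qed (simp add: a_def h)
    let ?v = "case_nat a w"
    have "angle u - angle ?v = (of_bool j - of_bool (j \<noteq> odd m) + of_int m) / 2"
      using angle_in[of u, OF True] angle_in[of ?v] a(2,3) h m[symmetric] by (simp add: sh eps_xa)
    \<comment> \<open>Exchanging the copies contributes an odd number exactly when m is odd, so the
      numerator is even.\<close>
    also have "\<dots> = of_int ((of_bool j - of_bool (j \<noteq> odd m) + m) div 2)"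
      by (cases j; cases "even m") (auto elim!: evenE oddE)
    finally have "dist_int (angle u - angle ?v) = 0" by (simp add: dist_int_eq_0_iff)
    moreover have "exit_weight u = exit_weight ?v"
      using exit_weight_in[of u] exit_weight_in[of ?v] True a(2) diff by (simp add: sh exit_diff_eq_0_iff)
    ultimately have "exit_diff u ?v = 0" by (simp add: exit_diff_eq_0_iff)
    then have "Lam u ?v = 0"
      using residue_in[of u ?v] True a(2) diff res by (simp add: Lam_residue sh)
    then have "lim_dist u ?v = 0" unfolding lim_dist_eq_0_iff using tt[OF ta] by blast
    with os[OF a(1) ta] show ?thesis using sh by (rule that)
  qed
qed

text \<open>Different first symbols are either not identified in G_\<xi>, and then the sequences
  there have distance 1, or they are the two copies of an arc, and then the angles differ by
  1/2.\<close>

lemma shift1_eq_imp_eq: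
  assumes "u \<in> one_sided G" "v \<in> one_sided G" "shift1 u = shift1 v" "lim_dist u v < 1/2"
  shows "u = v"
proof -
  have "dist1 (t \<circ> u) (t \<circ> v) < 1" "Lam u v < 1/2"
    using assms(4) Lam_nonneg[of u v] dist1_nonneg[of "t \<circ> u" "t \<circ> v"] by (simp_all add: lim_dist_def)
  then have t0: "t (u 0) = t (v 0)" using dist1_less_1[of "t \<circ> u" "t \<circ> v"] by simp
  have "u 0 = v 0"
  proof (rule ccontr)
    assume "u 0 \<noteq> v 0"
    then obtain j h where h: "h \<in> arcs H" "u 0 = xa j h" "v 0 = xa (\<not> j) h"
      using t_eq_neqE[OF t0] assms(1,2) one_sided_arc by metis
    then have "angle u - angle v = (of_bool j - of_bool (\<not> j)) / 2"
      using angle_in[of u] angle_in[of v] assms(3) by (simp add: xa_in_Z eps_xa field_simps)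
    then have "dist_int (angle u - angle v) = 1/2"
      by (cases j) (simp_all add: dist_int_eq_abs)
    then show False
      using exit_diff_le_Lam[of u v] \<open>Lam u v < 1/2\<close> by (simp add: exit_diff_def)
  qed
  moreover have "u (Suc i) = v (Suc i)" for i using assms(3) by (simp add: shift1_def fun_eq_iff)
  ultimately show ?thesis by (metis ext not0_implies_Suc)
qed

text \<open>The first summand of d, being less than 1 along the orbits, forces equal symbols in
  G_\<xi>. So the exits coincide, as \<open>Lam_expansive\<close> requires.\<close>

lemma lim_dist_expansive:
  assumes "x \<in> one_sided G" "y \<in> one_sided G" "\<And>n. lim_dist ((shift1 ^^ n) x) ((shift1 ^^ n) y) < 1/4"
  shows "lim_dist x y = 0"
proof -
  have less: "dist1 (t \<circ> (shift1 ^^ n) x) (t \<circ> (shift1 ^^ n) y) < 1" "Lam ((shift1 ^^ n) x) ((shift1 ^^ n) y) < 1/4" for n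
    using assms(3)[of n] Lam_nonneg[of "(shift1 ^^ n) x" "(shift1 ^^ n) y"]
      dist1_nonneg[of "t \<circ> (shift1 ^^ n) x" "t \<circ> (shift1 ^^ n) y"]
    by (simp_all add: lim_dist_def)
  have teq: "t (x i) = t (y i)" for i
    using dist1_less_1[OF less(1)[of i]] by (simp add: shift1_funpow)
  have "x i \<in> Z \<longleftrightarrow> y i \<in> Z" for i
    using t_eqD(1)[OF teq] assms(1,2) by (simp add: one_sided_arc)
  then have "Lam x y = 0" using less(2) by (intro Lam_expansive) auto
  with teq show ?thesis by (simp add: lim_dist_eq_0_iff)
qed

end

section \<open>Two-sided sequences and their one-sided restrictions\<close>

lemma two_sided_arc: "x \<in> two_sided G \<Longrightarrow> x k \<in> arcs G"
  by (simp add: two_sided_def)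

lemma two_sided_path: "x \<in> two_sided G \<Longrightarrow> head G (x k) = tail G (x (k + 1))"
  by (simp add: two_sided_def)

lemma shift2_two_sided: "x \<in> two_sided G \<Longrightarrow> shift2 x \<in> two_sided G"
  by (simp add: two_sided_def shift2_def)

lemma shift2_funpow_two_sided: "x \<in> two_sided G \<Longrightarrow> (shift2 ^^ n) x \<in> two_sided G"
  by (induction n) (auto simp: shift2_two_sided)

lemma bracket2_two_sided:
  assumes "x \<in> two_sided G" "y \<in> two_sided G" "x 1 = y 1"
  shows "bracket2 x y \<in> two_sided G"
proof -
  have "head G (bracket2 x y k) = tail G (bracket2 x y (k + 1))" for k
  proof -
    consider "k < 0" | "k = 0" | "k > 0" by linarith
    then show ?thesis
      using assms two_sided_path[of x G k] two_sided_path[of y G k]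
      by cases (auto simp: bracket2_def)
  qed
  then show ?thesis using assms by (auto simp: two_sided_def bracket2_def)
qed

text \<open>The representative (x_{1-n}, x_{2-n}, ...) of coordinate n of the image of x in the
  inverse limit.\<close>

definition past :: "(int \<Rightarrow> 'a) \<Rightarrow> nat \<Rightarrow> nat \<Rightarrow> 'a" where
  "past x n = right_half ((unshift2 ^^ n) x)"

lemma past_nth: "past x n i = x (int i + 1 - int n)"
  by (simp add: past_def right_half_def unshift2_funpow)

lemma past_one_sided: "x \<in> two_sided G \<Longrightarrow> past x n \<in> one_sided G"
  by (auto simp: two_sided_def one_sided_def past_nth algebra_simps)

lemma shift1_past: "shift1 (past x (Suc n)) = past x n"
  by (simp add: shift1_def past_nth fun_eq_iff algebra_simps)

lemma past_shift2: "past (shift2 x) n = shift1 (past x n)"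
proof
  have "int i + 1 - int n + 1 = int (Suc i) + 1 - int n" for i by simp
  then show "past (shift2 x) n i = shift1 (past x n) i" for i
    by (simp only: shift1_def shift2_def past_nth)
qed

lemma past_shift2_funpow: "past ((shift2 ^^ k) x) n = (shift1 ^^ k) (past x n)"
  by (induction k) (simp_all add: past_shift2)

context doubled_graph
begin

subsection \<open>The inverse limit\<close>

abbreviation px :: "(int \<Rightarrow> 'e) \<Rightarrow> nat \<Rightarrow> (nat \<Rightarrow> 'e) set" where
  "px \<equiv> pi_xi G H \<xi>"

abbreviation X :: "(nat \<Rightarrow> (nat \<Rightarrow> 'e) set) set" where
  "X \<equiv> X_xi G H \<xi>"

abbreviation q_dist :: "(nat \<Rightarrow> 'e) set \<Rightarrow> (nat \<Rightarrow> 'e) set \<Rightarrow> real" where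
  "q_dist \<equiv> quot1_dist G H \<xi>"

abbreviation q_shift :: "(nat \<Rightarrow> 'e) set \<Rightarrow> (nat \<Rightarrow> 'e) set" where
  "q_shift \<equiv> quot1_shift G H \<xi>"

lemma pi_xi_nth: "px x n = p1 (past x n)"
  by (simp add: pi_xi_def past_def)

lemma pi_xi_in_X: "x \<in> two_sided G \<Longrightarrow> px x \<in> X"
  by (auto simp: X_xi_def pi_xi_nth quot1_eq past_one_sided quot1_shift_pi1 shift1_past)

lemma X_quot1: "p \<in> X \<Longrightarrow> p n \<in> quot1 G H \<xi>"
  unfolding X_xi_def by blast

lemma X_shift: "p \<in> X \<Longrightarrow> q_shift (p (Suc n)) = p n"
  unfolding X_xi_def mem_Collect_eq by metis

lemma quot1E:
  assumes "A \<in> quot1 G H \<xi>"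
  obtains u where "u \<in> one_sided G" "A = p1 u"
  using assms by (auto simp: quot1_eq)

lemma mem_quot1:
  assumes "A \<in> quot1 G H \<xi>" "u \<in> A"
  shows "u \<in> one_sided G" "A = p1 u"
proof -
  obtain v where v: "v \<in> one_sided G" "A = p1 v" using assms(1) by (rule quot1E)
  with assms(2) show "u \<in> one_sided G" by (simp add: mem_pi1_iff)
  with v assms(2) show "A = p1 u" by (simp add: pi1_eq_iff) (simp add: mem_pi1_iff)
qed

lemma q_dist_nonneg: "A \<in> quot1 G H \<xi> \<Longrightarrow> B \<in> quot1 G H \<xi> \<Longrightarrow> 0 \<le> q_dist A B"
  by (elim quot1E) (simp add: quot1_dist_pi1 lim_dist_nonneg)

lemma q_dist_eq_0_iff: "A \<in> quot1 G H \<xi> \<Longrightarrow> B \<in> quot1 G H \<xi> \<Longrightarrow> q_dist A B = 0 \<longleftrightarrow> A = B"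
  by (elim quot1E) (simp add: quot1_dist_pi1 pi1_eq_iff)

lemma q_dist_triangle:
  "A \<in> quot1 G H \<xi> \<Longrightarrow> B \<in> quot1 G H \<xi> \<Longrightarrow> C \<in> quot1 G H \<xi> \<Longrightarrow> q_dist A C \<le> q_dist A B + q_dist B C"
  by (elim quot1E) (simp add: quot1_dist_pi1 lim_dist_triangle)

text \<open>Equal images under the shift are only equal classes. Lifting along the shift replaces
  one representative by an equivalent one with literally the same shift as the other, to which
  \<open>shift1_eq_imp_eq\<close> applies.\<close>

lemma q_shift_locally_inj:
  assumes "A \<in> quot1 G H \<xi>" "B \<in> quot1 G H \<xi>" "q_shift A = q_shift B" "q_dist A B < 1/2"
  shows "A = B"
proof -
  obtain u where u: "u \<in> one_sided G" "A = p1 u" using assms(1) by (rule quot1E)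
  obtain v where v: "v \<in> one_sided G" "B = p1 v" using assms(2) by (rule quot1E)
  have "lim_dist (shift1 v) (shift1 u) = 0"
    using assms(3) u v by (simp add: quot1_shift_pi1 pi1_eq_iff shift1_one_sided flip: lim_dist_sym[of "shift1 u"])
  then obtain v' where v': "v' \<in> one_sided G" "lim_dist v v' = 0" "shift1 v' = shift1 u"
    using lift_along_shift v(1) shift1_one_sided[OF u(1)] by blast
  have "lim_dist u v' = lim_dist u v" using v'(2) lim_dist_sym[of v v'] by (intro lim_dist_cong) auto
  then have "lim_dist u v' < 1/2" using assms(4) u v by (simp add: quot1_dist_pi1)
  then have "u = v'" using shift1_eq_imp_eq u(1) v' by simp
  then show ?thesis using u v v' by (simp add: pi1_eq_iff lim_dist_sym)
qed

text \<open>
  The locale \<^locale>\<open>Metric_space\<close> requires a distance to be symmetric and nonnegative outside the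
  carrier as well. There \<^term>\<open>q_dist\<close> takes the values of descriptions that have no unique
  solution; these are finitely many, so that the factors $2^{-n}$ make the supremum nonnegative.
\<close>

lemma lambda_dist_bounds: "0 \<le> lambda_dist H \<xi> k x y" "lambda_dist H \<xi> k x y \<le> 2"
proof -
  have "0 \<le> lambda_dist H \<xi> k x y \<and> lambda_dist H \<xi> k x y \<le> 2"
  proof (induction k arbitrary: x y)
    case 0
    show ?case
      using dist_int_nonneg[of "angle x - angle y"] dist_int_le_half[of "angle x - angle y"]
      by (simp add: circle_dist_theta)
  next
    case (Suc k)
    have w: "0 \<le> (1/2::real) ^ first_exit H \<xi> z" "(1/2::real) ^ first_exit H \<xi> z \<le> 1/2" for z
      by (simp_all add: first_exit_def power_le_one)
    define r where "r = (1/2) ^ (2 + first_exit H \<xi> x)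
      * lambda_dist H \<xi> k ((shift1 ^^ first_exit H \<xi> x) x) ((shift1 ^^ first_exit H \<xi> y) y)"
    have "r \<le> 1/8 * 2" unfolding r_def using Suc w[of x] by (intro mult_mono) (auto simp: power_add)
    moreover have "0 \<le> r" unfolding r_def using Suc by simp
    moreover have "\<bar>(1/2::real) ^ first_exit H \<xi> x - (1/2) ^ first_exit H \<xi> y\<bar> \<le> 1/2"
      using w[of x] w[of y] unfolding abs_le_iff by linarith
    moreover define b where "b = (if first_exit H \<xi> x = first_exit H \<xi> y \<and> theta H \<xi> x = theta H \<xi> y then r else 0)"
    ultimately have b: "0 \<le> b" "b \<le> 1/4" and a: "\<bar>(1/2::real) ^ first_exit H \<xi> x - (1/2) ^ first_exit H \<xi> y\<bar> \<le> 1/2"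
      by auto
    have eq: "lambda_dist H \<xi> (Suc k) x y = \<bar>(1/2) ^ first_exit H \<xi> x - (1/2) ^ first_exit H \<xi> y\<bar>
        + dist_int (angle x - angle y) + b"
      by (simp only: lambda_dist.simps circle_dist_theta r_def b_def)
    show ?case
      unfolding eq using a b dist_int_nonneg[of "angle x - angle y"] dist_int_le_half[of "angle x - angle y"]
      by (intro conjI) linarith+
  qed
  then show "0 \<le> lambda_dist H \<xi> k x y" "lambda_dist H \<xi> k x y \<le> 2" by auto
qed

lemma lambda_dist_sym: "lambda_dist H \<xi> k x y = lambda_dist H \<xi> k y x"
proof (induction k arbitrary: x y)
  case 0
  show ?case by (simp add: circle_dist_theta dist_int_commute)
next
  case (Suc k)
  show ?case
    using Suc[of "(shift1 ^^ first_exit H \<xi> x) x" "(shift1 ^^ first_exit H \<xi> y) y"]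
      dist_int_commute[of "angle x" "angle y"] abs_minus_commute[of "(1/2) ^ first_exit H \<xi> x" "(1/2) ^ first_exit H \<xi> y"]
    by (auto simp: circle_dist_theta)
qed

lemma level_dist_bounds: "0 \<le> level_dist G H \<xi> l x y" "level_dist G H \<xi> l x y \<le> 3"
  using lambda_dist_bounds[of l x y] dist1_nonneg[of "t \<circ> x" "t \<circ> y"] dist1_le_1[of "t \<circ> x" "t \<circ> y"]
  by (simp_all add: level_dist_def)

lemma level_dist_sym: "level_dist G H \<xi> l x y = level_dist G H \<xi> l y x"
  by (simp add: level_dist_def dist1_sym[of "t \<circ> x"] lambda_dist_sym[of l x])

lemma one_sided_closed:
  assumes "\<And>l. xs l \<in> one_sided G" "(\<lambda>l. dist1 (xs l) x) \<longlonglongrightarrow> 0"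
  shows "x \<in> one_sided G"
proof -
  have "x n \<in> arcs G \<and> head G (x n) = tail G (x (Suc n))" for n
  proof -
    have "\<forall>\<^sub>F l in sequentially. dist1 (xs l) x < (1/2) ^ (n + 2)"
      by (rule order_tendstoD(2)[OF assms(2)]) simp
    then obtain l where "dist1 (xs l) x < (1/2) ^ (n + 2)" by (auto simp: eventually_sequentially)
    then have "\<forall>i<n + 2. xs l i = x i" using dist1_le_iff[of "xs l" x "n + 2"] by simp
    then have "xs l n = x n" "xs l (Suc n) = x (Suc n)" by simp_all
    then show ?thesis using one_sided_arc[OF assms(1), of l n] one_sided_path[OF assms(1), of l n] by simp
  qed
  then show ?thesis by (simp add: one_sided_def)
qed

text \<open>A limit of points of the levels is again a path, so no approximations exist here and the
  condition on r holds vacuously. The resulting value is the same for both orders of the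
  arguments.\<close>

lemma pseudo_dist_outside:
  assumes "\<exists>k. level G H \<xi> k \<noteq> {}" "x \<notin> one_sided G \<or> y \<notin> one_sided G"
  shows "pseudo_dist G H \<xi> x y = (THE r. True)"
proof -
  have "\<not> ((\<forall>l. xs l \<in> level G H \<xi> l \<and> ys l \<in> level G H \<xi> l)
      \<and> (\<lambda>l. dist1 (xs l) x) \<longlonglongrightarrow> 0 \<and> (\<lambda>l. dist1 (ys l) y) \<longlonglongrightarrow> 0)" for xs ys
    using assms(2) one_sided_closed[of xs x] one_sided_closed[of ys y] by (auto simp: level_def)
  then have "(\<lambda>r::real. \<forall>xs ys. (\<forall>l. xs l \<in> level G H \<xi> l \<and> ys l \<in> level G H \<xi> l)
      \<longrightarrow> (\<lambda>l. dist1 (xs l) x) \<longlonglongrightarrow> 0 \<longrightarrow> (\<lambda>l. dist1 (ys l) y) \<longlonglongrightarrow> 0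
      \<longrightarrow> (\<lambda>l. level_dist G H \<xi> l (xs l) (ys l)) \<longlonglongrightarrow> r) = (\<lambda>r. True)"
    by (intro ext) blast
  with assms(1) show ?thesis by (simp only: pseudo_dist_def if_True)
qed

lemma pseudo_dist_sym: "pseudo_dist G H \<xi> x y = pseudo_dist G H \<xi> y x"
proof (cases "x \<in> one_sided G \<and> y \<in> one_sided G")
  case True
  then show ?thesis by (simp add: pseudo_dist_eq lim_dist_sym)
next
  case False
  show ?thesis
  proof (cases "\<exists>k. level G H \<xi> k \<noteq> {}")
    case True
    then show ?thesis using False pseudo_dist_outside[of x y] pseudo_dist_outside[of y x] by auto
  next
    case False
    then show ?thesis by (simp add: pseudo_dist_def level_dist_sym[of _ x])
  qed
qed

lemma q_dist_sym: "q_dist A B = q_dist B A"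
proof -
  have "{pseudo_dist G H \<xi> x y |x y. x \<in> A \<and> y \<in> B} = {pseudo_dist G H \<xi> x y |x y. x \<in> B \<and> y \<in> A}"
    using pseudo_dist_sym by blast
  then show ?thesis by (simp add: quot1_dist_def)
qed

lemma q_dist_bounded:
  obtains C where "\<And>A B. \<bar>q_dist A B\<bar> \<le> C"
proof -
  \<comment> \<open>3 bounds the genuine values. The first description arises where there are no
    approximations, the second from divergent sequences and from sets that are not
    singletons.\<close>
  define C where "C = 3 + \<bar>THE r::real. True\<bar> + \<bar>THE r::real. False\<bar>"
  have C: "3 \<le> C" "\<bar>THE r::real. True\<bar> \<le> C" "\<bar>THE r::real. False\<bar> \<le> C" by (simp_all add: C_def)
  have pd: "\<bar>pseudo_dist G H \<xi> x y\<bar> \<le> C" for x y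
  proof (cases "\<exists>k. level G H \<xi> k \<noteq> {}")
    case True
    show ?thesis
    proof (cases "x \<in> one_sided G \<and> y \<in> one_sided G")
      case True
      then show ?thesis using C lim_dist_nonneg[of x y] lim_dist_le_3[of x y] by (simp add: pseudo_dist_eq)
    next
      case False
      then have "pseudo_dist G H \<xi> x y = (THE r. True)" using pseudo_dist_outside[OF True] by blast
      then show ?thesis using C(2) by (simp only:)
    qed
  next
    case False
    then have eq: "pseudo_dist G H \<xi> x y = lim (\<lambda>l. level_dist G H \<xi> l x y)" by (simp add: pseudo_dist_def)
    show ?thesis
    proof (cases "convergent (\<lambda>l. level_dist G H \<xi> l x y)")
      case True
      then have lim: "(\<lambda>l. level_dist G H \<xi> l x y) \<longlonglongrightarrow> pseudo_dist G H \<xi> x y"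
        by (simp add: eq convergent_LIMSEQ_iff)
      have "0 \<le> pseudo_dist G H \<xi> x y"
        by (rule LIMSEQ_le_const[OF lim]) (simp add: level_dist_bounds)
      moreover have "pseudo_dist G H \<xi> x y \<le> 3"
        by (rule LIMSEQ_le_const2[OF lim]) (simp add: level_dist_bounds)
      ultimately show ?thesis using C by simp
    next
      case False
      then have "(\<lambda>L. (\<lambda>l. level_dist G H \<xi> l x y) \<longlonglongrightarrow> L) = (\<lambda>L. False)"
        by (auto simp: convergent_def)
      then have "pseudo_dist G H \<xi> x y = (THE r. False)" by (simp only: eq lim_def)
      then show ?thesis using C(3) by (simp only:)
    qed
  qed
  have "\<bar>q_dist A B\<bar> \<le> C" for A B
  proof -
    define S where "S = {pseudo_dist G H \<xi> x y |x y. x \<in> A \<and> y \<in> B}"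
    have eq: "q_dist A B = the_elem S" by (simp add: quot1_dist_def S_def)
    show ?thesis
    proof (cases "\<exists>r. S = {r}")
      case True
      then obtain r where r: "S = {r}" by blast
      then obtain x y where "r = pseudo_dist G H \<xi> x y" unfolding S_def by blast
      then show ?thesis using pd r by (simp add: eq)
    next
      case False
      then have "(\<lambda>r. S = {r}) = (\<lambda>r. False)" by simp
      then have "q_dist A B = (THE r. False)" by (simp only: eq the_elem_def)
      then show ?thesis using C(3) by (simp only:)
    qed
  qed
  then show ?thesis by (rule that)
qed

lemma d_xi_bdd: "bdd_above (range (\<lambda>n. (1/2) ^ n * q_dist (p n) (q n)))"
proof -
  obtain C where C: "\<And>A B. \<bar>q_dist A B\<bar> \<le> C" using q_dist_bounded by blast
  show ?thesis
  proof (rule bdd_aboveI2)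
    fix n
    have "(1/2) ^ n * q_dist (p n) (q n) \<le> (1/2) ^ n * C"
      using C[of "p n" "q n"] by (intro mult_left_mono) auto
    also have "\<dots> \<le> 1 * C"
      using C[of "p n" "q n"] by (intro mult_right_mono) (auto simp: power_le_one)
    finally show "(1/2) ^ n * q_dist (p n) (q n) \<le> C" by simp
  qed
qed

lemma d_xi_ge: "(1/2) ^ n * q_dist (p n) (q n) \<le> d_xi G H \<xi> p q"
  unfolding d_xi_def by (rule cSUP_upper[OF _ d_xi_bdd]) simp

lemma d_xi_le: "(\<And>n. (1/2) ^ n * q_dist (p n) (q n) \<le> c) \<Longrightarrow> d_xi G H \<xi> p q \<le> c"
  unfolding d_xi_def by (rule cSUP_least) auto

lemma d_xi_nonneg: "0 \<le> d_xi G H \<xi> p q"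
proof -
  obtain C where C: "\<And>A B. \<bar>q_dist A B\<bar> \<le> C" using q_dist_bounded by blast
  have "(\<lambda>n. (1/2) ^ n * q_dist (p n) (q n)) \<longlonglongrightarrow> 0"
  proof (rule Lim_null_comparison)
    show "\<forall>\<^sub>F n in sequentially. norm ((1/2) ^ n * q_dist (p n) (q n)) \<le> (1/2) ^ n * C"
      using C by (intro always_eventually allI) (simp add: abs_mult)
    show "(\<lambda>n. (1/2) ^ n * C) \<longlonglongrightarrow> 0"
      by (intro tendsto_mult_left_zero LIMSEQ_realpow_zero) auto
  qed
  then show ?thesis by (rule LIMSEQ_le_const2) (simp add: d_xi_ge)
qed

lemma d_xi_sym: "d_xi G H \<xi> p q = d_xi G H \<xi> q p"
  unfolding d_xi_def by (simp add: q_dist_sym[of "p _"])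

lemma Metric_space_d_xi: "Metric_space X (d_xi G H \<xi>)"
proof
  show "d_xi G H \<xi> p q = 0 \<longleftrightarrow> p = q" if "p \<in> X" "q \<in> X" for p q
  proof
    assume zero: "d_xi G H \<xi> p q = 0"
    show "p = q"
    proof
      fix n
      have "(1/2) ^ n * q_dist (p n) (q n) \<le> 0" using d_xi_ge[of n p q] zero by simp
      then have "q_dist (p n) (q n) \<le> 0" using mult_le_cancel_left_pos[of "(1/2::real) ^ n" _ 0] by simp
      then show "p n = q n"
        using that q_dist_nonneg[of "p n" "q n"] q_dist_eq_0_iff[of "p n" "q n"] by (simp add: X_quot1)
    qed
  next
    assume "p = q"
    then have "q_dist (p n) (q n) = 0" for n using that by (simp add: q_dist_eq_0_iff X_quot1)
    then have "d_xi G H \<xi> p q \<le> 0" by (intro d_xi_le) simp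
    then show "d_xi G H \<xi> p q = 0" using d_xi_nonneg[of p q] by simp
  qed
  show "d_xi G H \<xi> p r \<le> d_xi G H \<xi> p q + d_xi G H \<xi> q r" if "p \<in> X" "q \<in> X" "r \<in> X" for p q r
  proof (rule d_xi_le)
    fix n
    have "(1/2) ^ n * q_dist (p n) (r n) \<le> (1/2) ^ n * (q_dist (p n) (q n) + q_dist (q n) (r n))"
      using that by (intro mult_left_mono q_dist_triangle) (auto simp: X_quot1)
    also have "\<dots> \<le> d_xi G H \<xi> p q + d_xi G H \<xi> q r"
      unfolding distrib_left by (intro add_mono d_xi_ge)
    finally show "(1/2) ^ n * q_dist (p n) (r n) \<le> d_xi G H \<xi> p q + d_xi G H \<xi> q r" .
  qed
qed (rule d_xi_nonneg d_xi_sym)+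

section \<open>The map to the inverse limit: continuity and surjectivity\<close>

lemma pi_xi_eq_iff:
  assumes "x \<in> two_sided G" "y \<in> two_sided G"
  shows "px x = px y \<longleftrightarrow> (\<forall>n. lim_dist (past x n) (past y n) = 0)"
  using assms by (simp add: fun_eq_iff pi_xi_nth pi1_eq_iff past_one_sided)

lemma q_dist_pi_xi:
  assumes "x \<in> two_sided G" "y \<in> two_sided G"
  shows "q_dist (px x n) (px y n) = lim_dist (past x n) (past y n)"
  using assms by (simp add: pi_xi_nth quot1_dist_pi1 past_one_sided)

lemma sigma_xi_pi_xi: "x \<in> two_sided G \<Longrightarrow> sigma_xi G H \<xi> (px x) = px (shift2 x)"
  by (simp add: sigma_xi_def fun_eq_iff pi_xi_nth quot1_shift_pi1 past_one_sided past_shift2)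

lemma sigma_xi_funpow_pi_xi:
  "x \<in> two_sided G \<Longrightarrow> (sigma_xi G H \<xi> ^^ n) (px x) = px ((shift2 ^^ n) x)"
  by (induction n) (simp_all add: sigma_xi_pi_xi shift2_funpow_two_sided)

text \<open>If x and y agree on 1-N..N, then for n up to N the n-th representatives share at least N
  initial symbols; for larger n the weight 2^(-n) alone is small enough.\<close>

lemma d_xi_pi_xi_le:
  assumes "x \<in> two_sided G" "y \<in> two_sided G"
  shows "d_xi G H \<xi> (px x) (px y) \<le> 3 * dist2 x y"
proof (cases "fold_int x" "fold_int y" rule: dist1_cases)
  case equal
  then have "x = y" by (simp add: inj_fold_int)
  then have "d_xi G H \<xi> (px x) (px y) = 0"
    using Metric_space.zero[OF Metric_space_d_xi] pi_xi_in_X assms by blast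
  then show ?thesis using equal by (simp add: dist2_eq)
next
  case (power N)
  then have d: "dist2 x y = (1/2) ^ N" by (simp add: dist2_eq)
  then have agree: "x j = y j" if "1 - int N \<le> j" "j \<le> int N" for j
    using dist2_le_iff[of x y N] that by simp
  have "(1/2) ^ n * lim_dist (past x n) (past y n) \<le> 3 * (1/2) ^ N" for n
  proof (cases "n \<le> N")
    case True
    have "dist1 (past x n) (past y n) \<le> (1/2) ^ N"
      unfolding dist1_le_iff using True by (auto simp: past_nth intro!: agree)
    then have "lim_dist (past x n) (past y n) \<le> 3 * (1/2) ^ N"
      using lim_dist_le_dist1[of "past x n" "past y n"] by linarith
    then have "(1/2) ^ n * lim_dist (past x n) (past y n) \<le> 1 * (3 * (1/2) ^ N)"
      by (intro mult_mono) (auto simp: power_le_one lim_dist_nonneg)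
    then show ?thesis by simp
  next
    case False
    then have "(1/2::real) ^ n \<le> (1/2) ^ N" by (intro power_decreasing) auto
    then have "(1/2) ^ n * lim_dist (past x n) (past y n) \<le> (1/2) ^ N * 3"
      by (intro mult_mono lim_dist_le_3) (auto simp: lim_dist_nonneg)
    then show ?thesis by simp
  qed
  then show ?thesis unfolding d by (intro d_xi_le) (simp add: q_dist_pi_xi assms)
qed

text \<open>Representatives are chosen one after the other so that each is literally the shift of
  the next; such a sequence glues to a two-sided path. The freedom to prescribe the right half w is
  needed for lifting stable sets.\<close>

lemma X_lift:
  assumes "p \<in> X" "w \<in> p 0"
  obtains x where "x \<in> two_sided G" "px x = p" "past x 0 = w"
proof -
  have "\<exists>v. \<forall>n. (v n \<in> p n \<and> (n = 0 \<longrightarrow> v n = w)) \<and> shift1 (v (Suc n)) = v n"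
  proof (rule dependent_nat_choice)
    show "\<exists>v. v \<in> p 0 \<and> (0 = (0::nat) \<longrightarrow> v = w)" using assms(2) by blast
    fix v n
    assume "v \<in> p n \<and> (n = 0 \<longrightarrow> v = w)"
    then have v: "v \<in> one_sided G" "p n = p1 v" using mem_quot1 X_quot1[OF assms(1)] by blast+
    obtain u where u: "u \<in> one_sided G" "p (Suc n) = p1 u" using quot1E X_quot1[OF assms(1)] by blast
    have "lim_dist (shift1 u) v = 0"
      using X_shift[OF assms(1), of n] u v by (simp add: quot1_shift_pi1 pi1_eq_iff shift1_one_sided)
    then obtain v' where "v' \<in> one_sided G" "lim_dist u v' = 0" "shift1 v' = v"
      using lift_along_shift[OF u(1) v(1)] by blast
    then show "\<exists>v'. (v' \<in> p (Suc n) \<and> (Suc n = 0 \<longrightarrow> v' = w)) \<and> shift1 v' = v"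
      using u by (auto simp: mem_pi1_iff)
  qed
  then obtain v where v: "\<And>n. v n \<in> p n" "v 0 = w" "\<And>n. shift1 (v (Suc n)) = v n" by blast
  have v_os: "v n \<in> one_sided G" and pv: "p n = p1 (v n)" for n
    using mem_quot1[OF X_quot1[OF assms(1)] v(1)] by blast+
  have step: "v (n + m) (i + m) = v n i" for n m i
  proof (induction m)
    case (Suc m)
    have "v (n + Suc m) (i + Suc m) = shift1 (v (Suc (n + m))) (i + m)" by (simp add: shift1_def)
    also have "\<dots> = v (n + m) (i + m)" by (simp only: v(3))
    finally show ?case using Suc by simp
  qed simp
  have diag: "v N k = v n i" if "int N - int n = int k - int i" for N k n i
  proof (cases "n \<le> N")
    case True
    then have "N = n + (N - n)" "k = i + (N - n)" using that by simp_all
    then show ?thesis using step by metis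
  next
    case False
    then have "n = N + (n - N)" "i = k + (n - N)" using that by simp_all
    then show ?thesis using step by metis
  qed
  \<comment> \<open>Any n and i with k = i + 1 - n give the same entry; n = |k| + 1 is always large
    enough and leaves i = k + |k|.\<close>
  define x where "x k = v (Suc (nat \<bar>k\<bar>)) (nat (k + \<bar>k\<bar>))" for k :: int
  have x_eq: "x k = v n i" if "k = int i + 1 - int n" for k n i
    unfolding x_def using that by (intro diag) auto
  have past_x: "past x n = v n" for n by (auto simp: past_nth intro!: x_eq)
  have "x k \<in> arcs G \<and> head G (x k) = tail G (x (k + 1))" for k
  proof -
    let ?n = "Suc (nat \<bar>k\<bar>)" and ?i = "nat (k + \<bar>k\<bar>)"
    have "x k = v ?n ?i" "x (k + 1) = v ?n (Suc ?i)" by (rule x_eq; simp)+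
    then show ?thesis using v_os[of ?n] by (simp add: one_sided_arc one_sided_path)
  qed
  then have "x \<in> two_sided G" by (simp add: two_sided_def)
  moreover have "px x = p" by (simp add: fun_eq_iff pi_xi_nth past_x pv)
  moreover have "past x 0 = w" by (simp add: past_x v(2))
  ultimately show ?thesis by (rule that)
qed

lemma pi_xi_surj: "px ` two_sided G = X"
proof (intro equalityI subsetI)
  fix p assume p: "p \<in> X"
  obtain u where u: "u \<in> one_sided G" "p 0 = p1 u" by (rule quot1E[OF X_quot1[OF p]])
  then have "u \<in> p 0" by (simp add: mem_pi1_iff)
  with p obtain x where "x \<in> two_sided G" "px x = p" by (rule X_lift)
  then show "p \<in> px ` two_sided G" by blast
qed (auto simp: pi_xi_in_X)

lemma factor_map_pi_xi: "factor_map (two_sided G) dist2 shift2 X (d_xi G H \<xi>) (sigma_xi G H \<xi>) px"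
  unfolding factor_map_def
proof (intro conjI ballI)
  show "continuous_map (Metric_space.mtopology (two_sided G) dist2) (Metric_space.mtopology X (d_xi G H \<xi>)) px"
    unfolding Metric_space.metric_continuous_map[OF Metric_space_dist2 Metric_space_d_xi]
  proof (intro conjI ballI allI impI)
    show "px ` two_sided G \<subseteq> X" by (simp add: pi_xi_surj)
    fix x and e :: real assume x: "x \<in> two_sided G" and "0 < e"
    have "d_xi G H \<xi> (px x) (px y) < e" if "y \<in> two_sided G" "dist2 x y < e / 3" for y
      using d_xi_pi_xi_le[OF x that(1)] that(2) by linarith
    then show "\<exists>\<delta>>0. \<forall>y. y \<in> two_sided G \<and> dist2 x y < \<delta> \<longrightarrow> d_xi G H \<xi> (px x) (px y) < e"
      using \<open>0 < e\<close> by (intro exI[of _ "e / 3"]) auto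
  qed
qed (simp_all add: pi_xi_surj sigma_xi_pi_xi)

subsection \<open>The bracket\<close>

lemma bracket_pi_xi:
  assumes x: "x \<in> two_sided G" and y: "y \<in> two_sided G" and le: "dist2 x y \<le> (1/2) ^ 3"
  shows "bracket2 x y \<in> two_sided G" "bracket_xi_defined G H \<xi> (px x) (px y)"
    "px (bracket2 x y) = bracket_xi G H \<xi> (px x) (px y)"
proof -
  define b where "b = bracket2 x y"
  have agree: "x j = y j" if "-2 \<le> j" "j \<le> 3" for j
    using dist2_le_iff[of x y 3] le that by simp
  show b: "bracket2 x y \<in> two_sided G" using bracket2_two_sided x y agree[of 1] by simp
  then have b': "b \<in> two_sided G" by (simp add: b_def)
  have b0: "past b 0 = past x 0" by (simp add: b_def bracket2_def past_nth fun_eq_iff)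
  define e where "e n = q_dist (px b n) (px y n)" for n
  have e_eq: "e n = lim_dist (past b n) (past y n)" for n
    by (simp add: e_def q_dist_pi_xi b' y)
  have e_half: "e (Suc n) \<le> 1/2 * e n" for n
  proof -
    \<comment> \<open>Agreement at j = 1, where b takes the entry of x, supplies the second common
      symbol for n = 0.\<close>
    have "b j = y j" if "j \<le> 1" for j using that agree[of j] by (auto simp: b_def bracket2_def)
    then have "past b (Suc n) 0 = past y (Suc n) 0" "past b (Suc n) 1 = past y (Suc n) 1"
      by (simp_all add: past_nth)
    then show ?thesis unfolding e_eq using lim_dist_half[of "past b (Suc n)" "past y (Suc n)"] by (simp add: shift1_past)
  qed
  \<comment> \<open>3/8 is the Lipschitz constant 3 times 2^(-3). It stays below the separation 1/2
    of preimages, which is what uniqueness needs.\<close>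
  have e_le: "e n \<le> 3/8 * (1/2) ^ n" for n
  proof (induction n)
    case 0
    have "dist1 (past x 0) (past y 0) \<le> (1/2) ^ 3"
      unfolding dist1_le_iff by (auto simp: past_nth intro!: agree)
    then show ?case
      using lim_dist_le_dist1[of "past x 0" "past y 0"] by (simp add: e_eq b0 power3_eq_cube)
  next
    case (Suc n)
    then show ?case using e_half[of n] by simp
  qed
  have X: "px x \<in> X" "px y \<in> X" "px b \<in> X" using x y b' by (simp_all add: pi_xi_in_X)
  have is_b: "is_bracket_xi G H \<xi> (px x) (px y) (px b)"
    unfolding is_bracket_xi_def
  proof (intro conjI allI)
    show "px b 0 = px x 0" by (simp add: pi_xi_nth b0)
    show "q_dist (px b (Suc n)) (px y (Suc n)) \<le> 1/2 * q_dist (px b n) (px y n)" for n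
      using e_half by (simp add: e_def)
    have "1/2 * e n \<le> (1/2) ^ (n + 2)" for n
    proof -
      have "(1/2::real) ^ (n + 2) = (1/2) ^ n / 4" "0 \<le> (1/2::real) ^ n"
        by (simp_all add: power_add power2_eq_square)
      then show ?thesis using e_le[of n] by linarith
    qed
    then show "1/2 * q_dist (px b n) (px y n) \<le> (1/2) ^ (n + 2)" for n by (simp add: e_def)
  qed (rule X)
  have uniq: "z = px b" if z: "is_bracket_xi G H \<xi> (px x) (px y) z" for z
  proof
    have zX: "z \<in> X" and z0: "z 0 = px x 0"
      and zn: "\<And>n. q_dist (z (Suc n)) (px y (Suc n)) \<le> 1/2 * q_dist (z n) (px y n)"
      using z unfolding is_bracket_xi_def by blast+
    show "z n = px b n" for n
    proof (induction n)
      case 0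
      show ?case by (simp add: z0 pi_xi_nth b0)
    next
      case (Suc n)
      show ?case
      proof (rule q_shift_locally_inj)
        show "q_shift (z (Suc n)) = q_shift (px b (Suc n))" using Suc by (simp add: X_shift zX X)
        have pow: "(1/2::real) ^ n \<le> 1" by (simp add: power_le_one)
        \<comment> \<open>Both preimages of the common point are within \<open>e n / 2\<close> of
          the coordinate of y, hence closer to each other than 1/2.\<close>
        have "q_dist (z (Suc n)) (px b (Suc n))
            \<le> q_dist (z (Suc n)) (px y (Suc n)) + q_dist (px y (Suc n)) (px b (Suc n))"
          by (intro q_dist_triangle X_quot1 zX X)
        also have "\<dots> \<le> 1/2 * e n + 1/2 * e n"
          using zn[of n] e_half[of n] Suc by (simp add: e_def q_dist_sym[of "px y _"])
        also have "\<dots> < 1/2" using e_le[of n] pow by simp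
        finally show "q_dist (z (Suc n)) (px b (Suc n)) < 1/2" .
      qed (simp_all add: X_quot1 zX X)
    qed
  qed
  have "d_xi G H \<xi> (px x) (px y) \<le> 1/2"
    using d_xi_pi_xi_le[OF x y] le by (simp add: power3_eq_cube)
  with is_b uniq show "bracket_xi_defined G H \<xi> (px x) (px y)"
    unfolding bracket_xi_defined_def by blast
  have "bracket_xi G H \<xi> (px x) (px y) = px b"
    unfolding bracket_xi_def using is_b uniq by (rule the_equality)
  then show "px (bracket2 x y) = bracket_xi G H \<xi> (px x) (px y)" by (simp add: b_def)
qed

subsection \<open>The fibres\<close>

lemma swapped_imp_neq:
  assumes "swapped H \<xi> x y"
  shows "x n \<noteq> y n"
proof -
  obtain j z where "z \<in> two_sided H" "arc_map (\<xi> j) (z n) = x n" "arc_map (\<xi> (\<not> j)) (z n) = y n"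
    using assms unfolding swapped_def by blast
  then show ?thesis by (metis two_sided_arc xa_eq_iff)
qed

text \<open>Agreement on the left and disagreement on the right keep the three alternatives apart
  and exclude pairs that are eventually equal.\<close>

lemma swapped_after_fwd_bounds:
  assumes "swapped_after_fwd H \<xi> x y"
  obtains m where "\<And>n. n < m \<Longrightarrow> x n = y n" "\<And>n. n > m \<Longrightarrow> x n \<noteq> y n"
proof -
  obtain m j z where "\<forall>n>m. z n \<in> arcs H \<and> head H (z n) = tail H (z (n + 1))" "\<forall>n<m. x n = y n"
    "\<forall>n>m. arc_map (\<xi> j) (z n) = x n \<and> arc_map (\<xi> (\<not> j)) (z n) = y n"
    using assms unfolding swapped_after_fwd_def by blast
  then show ?thesis by (intro that[of m]) (auto, metis xa_eq_iff)
qed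

lemma swapped_imp_pi_xi_eq:
  assumes "x \<in> two_sided G" "y \<in> two_sided G" "swapped H \<xi> x y"
  shows "px x = px y"
proof -
  obtain j z where z: "z \<in> two_sided H" "\<And>n. xa j (z n) = x n" "\<And>n. xa (\<not> j) (z n) = y n"
    using assms(3) unfolding swapped_def by blast
  have "lim_dist (past x n) (past y n) = 0" for n
    by (rule lim_dist_opposite[of _ _ 0 "past z n" j])
      (simp_all add: past_one_sided assms past_nth z two_sided_arc[OF z(1)])
  then show ?thesis by (simp add: pi_xi_eq_iff assms)
qed

text \<open>A window starting after m sees opposite copies from its first symbol on. An earlier one
  contains position m and sees either opposite copies after a symbol outside \<open>Z\<close>, or a
  carry at m.\<close>

lemma swapped_after_fwd_imp_pi_xi_eq:
  assumes "x \<in> two_sided G" "y \<in> two_sided G" "swapped_after_fwd H \<xi> x y"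
  shows "px x = px y"
proof -
  obtain m j z where z: "\<And>n. n > m \<Longrightarrow> z n \<in> arcs H" and pre: "\<And>n. n < m \<Longrightarrow> x n = y n"
    and mid: "x m = y m \<and> x m \<notin> Z \<or> z m \<in> arcs H \<and> xa (\<not> j) (z m) = x m \<and> xa j (z m) = y m"
    and post: "\<And>n. n > m \<Longrightarrow> xa j (z n) = x n \<and> xa (\<not> j) (z n) = y n"
    using assms(3) unfolding swapped_after_fwd_def by blast
  have "lim_dist (past x n) (past y n) = 0" for n
  proof (cases "1 - int n > m")
    case True
    then show ?thesis
      by (intro lim_dist_opposite[of _ _ 0 "past z n" j])
        (auto simp: past_one_sided assms past_nth z post)
  next
    case False
    \<comment> \<open>The position of m inside the window starting at 1 - n.\<close>
    define k where "k = nat (m - (1 - int n))"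
    have k: "int i + 1 - int n < m \<longleftrightarrow> i < k" "int i + 1 - int n > m \<longleftrightarrow> i > k" "int k + 1 - int n = m" for i
      using False by (auto simp: k_def)
    from mid show ?thesis
    proof
      assume m: "x m = y m \<and> x m \<notin> Z"
      show ?thesis
      proof (rule lim_dist_opposite[of _ _ "Suc k" "past z n" j])
        show "past x n i = past y n i" if "i < Suc k" for i
          using that pre[of "int i + 1 - int n"] k m by (cases "i = k") (auto simp: past_nth)
        show "Suc k = 0 \<or> past x n (Suc k - 1) \<notin> Z" using conjunct2[OF m] k(3) by (simp add: past_nth)
        show "past z n i \<in> arcs H" if "i \<ge> Suc k" for i
          using that z k(2) by (simp add: past_nth Suc_le_eq)
        show "past x n i = xa j (past z n i)" "past y n i = xa (\<not> j) (past z n i)" if "i \<ge> Suc k" for i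
          using that post[of "int i + 1 - int n"] k(2) by (simp_all add: past_nth Suc_le_eq)
      qed (simp_all add: past_one_sided assms)
    next
      assume m: "z m \<in> arcs H \<and> xa (\<not> j) (z m) = x m \<and> xa j (z m) = y m"
      show ?thesis
      proof (rule lim_dist_carry[of _ _ k "past z n" j])
        show "past z n i \<in> arcs H" if "k \<le> i" for i
          using that z[of "int i + 1 - int n"] k m by (cases "i = k") (auto simp: past_nth)
        show "past x n i = past y n i" if "i < k" for i using that pre k(1) by (simp add: past_nth)
        show "past x n k = xa (\<not> j) (past z n k)" "past y n k = xa j (past z n k)"
          using m k(3) by (simp_all add: past_nth)
        show "past x n i = xa j (past z n i)" "past y n i = xa (\<not> j) (past z n i)" if "k < i" for i
          using that post[of "int i + 1 - int n"] k(2) by (simp_all add: past_nth)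
      qed (simp_all add: past_one_sided assms)
    qed
  qed
  then show ?thesis by (simp add: pi_xi_eq_iff assms)
qed

text \<open>The case distinction for one-sided sequences in absolute indices, so that windows
  starting at different points can be compared.\<close>

lemma window_cases:
  assumes "x \<in> two_sided G" "y \<in> two_sided G" "lim_dist (past x n) (past y n) = 0"
  obtains "\<And>i. i \<ge> 1 - int n \<Longrightarrow> x i = y i"
  | (carry) p j h where "p \<ge> 1 - int n" "\<And>i. i \<ge> p \<Longrightarrow> h i \<in> arcs H"
      "\<And>i. 1 - int n \<le> i \<Longrightarrow> i < p \<Longrightarrow> x i = y i" "x p = xa (\<not> j) (h p)" "y p = xa j (h p)"
      "\<And>i. i > p \<Longrightarrow> x i = xa j (h i) \<and> y i = xa (\<not> j) (h i)"
  | (opposite) p j h where "p \<ge> 1 - int n" "\<And>i. i \<ge> p \<Longrightarrow> h i \<in> arcs H"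
      "p = 1 - int n \<or> x (p - 1) \<notin> Z" "\<And>i. 1 - int n \<le> i \<Longrightarrow> i < p \<Longrightarrow> x i = y i"
      "\<And>i. i \<ge> p \<Longrightarrow> x i = xa j (h i) \<and> y i = xa (\<not> j) (h i)"
proof -
  let ?k = "\<lambda>i. nat (i - (1 - int n))"
  have nth: "past x n (?k i) = x i" "past y n (?k i) = y i" if "i \<ge> 1 - int n" for i
    using that by (simp_all add: past_nth)
  from assms(3) past_one_sided[OF assms(1)] past_one_sided[OF assms(2)] show ?thesis
  proof (cases rule: lim_dist_eq_0_cases)
    case 1
    then show ?thesis using nth by (intro that(1)) metis
  next
    case (carry N j h)
    define p where "p = int N + 1 - int n"
    have p: "p \<ge> 1 - int n" "?k p = N" by (simp_all add: p_def)
    have lt: "i < p \<longleftrightarrow> ?k i < N" "p < i \<longleftrightarrow> N < ?k i" "p \<le> i \<longleftrightarrow> N \<le> ?k i" if "i \<ge> 1 - int n" for i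
      using that by (auto simp: p_def)
    show ?thesis
    proof (rule that(2)[of p "\<lambda>i. h (?k i)" j])
      show "x i = y i" if "1 - int n \<le> i" "i < p" for i
        using carry(2)[of "?k i"] that nth[of i] lt[of i] by simp
      show "x p = xa (\<not> j) (h (?k p))" "y p = xa j (h (?k p))"
        using carry(3,4) p nth[of p] by simp_all
      show "h (?k i) \<in> arcs H" if "p \<le> i" for i
        using carry(1) lt(3)[of i] p that by simp
      show "x i = xa j (h (?k i)) \<and> y i = xa (\<not> j) (h (?k i))" if "p < i" for i
        using carry(5)[of "?k i"] lt(2)[of i] p that nth[of i] by simp
    qed (rule p)
  next
    case (opposite N j h)
    define p where "p = int N + 1 - int n"
    have p: "p \<ge> 1 - int n" "?k p = N" by (simp_all add: p_def)
    have lt: "i < p \<longleftrightarrow> ?k i < N" "p \<le> i \<longleftrightarrow> N \<le> ?k i" if "i \<ge> 1 - int n" for i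
      using that by (auto simp: p_def)
    show ?thesis
    proof (rule that(3)[of p "\<lambda>i. h (?k i)" j])
      have "past x n (N - 1) = x (p - 1)" if "N \<noteq> 0" using that by (simp add: past_nth p_def of_nat_diff)
      then show "p = 1 - int n \<or> x (p - 1) \<notin> Z" using opposite(2) by (cases "N = 0") (auto simp: p_def)
      show "x i = y i" if "1 - int n \<le> i" "i < p" for i
        using opposite(3)[of "?k i"] that nth[of i] lt[of i] by simp
      show "h (?k i) \<in> arcs H" if "p \<le> i" for i
        using opposite(1) lt(2)[of i] p that by simp
      show "x i = xa j (h (?k i)) \<and> y i = xa (\<not> j) (h (?k i))" if "p \<le> i" for i
        using opposite(4)[of "?k i"] lt(2)[of i] p that nth[of i] by simp
    qed (rule p)
  qed
qed

lemma path_of_copies: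
  assumes "x \<in> two_sided G" "h i \<in> arcs H" "h (i + 1) \<in> arcs H" "x i = xa j (h i)" "x (i + 1) = xa j' (h (i + 1))"
  shows "head H (h i) = tail H (h (i + 1))"
  using two_sided_path[OF assms(1), of i] assms(2-5) xa_path_iff by simp

text \<open>If x and y agree far to the left, a single window starting there shows the whole
  picture. Otherwise windows start at disagreements arbitrarily far to the left, and each forces
  opposite copies to its right.\<close>

lemma pi_xi_eq_imp:
  assumes x: "x \<in> two_sided G" and y: "y \<in> two_sided G" and eq: "px x = px y" and "x \<noteq> y"
  shows "swapped H \<xi> x y \<or> swapped_after_fwd H \<xi> x y"
proof -
  have win: "lim_dist (past x n) (past y n) = 0" for n
    using eq by (simp add: pi_xi_eq_iff x y)
  have xa_ne: "xa j h \<noteq> xa (\<not> j) h" "xa (\<not> j) h \<noteq> xa j h" if "h \<in> arcs H" for j h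
    using that by (simp_all add: xa_eq_iff)
  show ?thesis
  proof (cases "\<exists>q. \<forall>i<q. x i = y i")
    case True
    then obtain q where q: "\<And>i. i < q \<Longrightarrow> x i = y i" by blast
    obtain r where r: "x r \<noteq> y r" using \<open>x \<noteq> y\<close> by (auto simp: fun_eq_iff)
    \<comment> \<open>The window has to start where x and y still agree and to contain the
      disagreement r.\<close>
    define n where "n = nat (1 - min (q - 1) r)"
    have n: "1 - int n < q" "1 - int n \<le> r" by (auto simp: n_def)
    from x y win[of n] have "swapped_after_fwd H \<xi> x y"
    proof (cases rule: window_cases)
      case 1
      then show ?thesis using r n(2) by blast
    next
      case (carry p j h)
      have "x i = y i" if "i < p" for i
        using carry(3)[of i] q[of i] n(1) that by linarith
      moreover have "head H (h i) = tail H (h (i + 1))" if "i \<ge> p" for i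
      proof (rule path_of_copies[OF x])
        show "x i = xa (if i = p then \<not> j else j) (h i)" "x (i + 1) = xa j (h (i + 1))"
          using carry(4) carry(6)[of i] carry(6)[of "i + 1"] that by auto
      qed (use carry(2) that in auto)
      ultimately show ?thesis
        unfolding swapped_after_fwd_def using carry(2,4-6)
        by (intro exI[of _ p] exI[of _ j] exI[of _ h]) auto
    next
      case (opposite p j h)
      have path: "head H (h i) = tail H (h (i + 1))" if "i \<ge> p" for i
        using opposite(2,5)[of i] opposite(2,5)[of "i + 1"] that by (intro path_of_copies[OF x]) auto
      \<comment> \<open>The sequences agree at the left end of the window, so opposite copies cannot
        begin there and must follow a symbol outside \<open>Z\<close>.\<close>
      have "p \<noteq> 1 - int n"
        using q[of p] n(1) opposite(2,5)[of p] xa_ne by auto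
      then have "x (p - 1) \<notin> Z" "1 - int n \<le> p - 1" using opposite(1,3) by auto
      moreover have "x i = y i" if "i < p" for i
        using opposite(4)[of i] q[of i] n(1) that by linarith
      ultimately show ?thesis
        unfolding swapped_after_fwd_def using opposite(2,5) path
        by (intro exI[of _ "p - 1"] exI[of _ j] exI[of _ h]) auto
    qed
    then show ?thesis ..
  next
    case False
    have copies: "\<exists>j. \<forall>i\<ge>m. \<exists>h\<in>arcs H. x i = xa j h \<and> y i = xa (\<not> j) h" for m
    proof -
      \<comment> \<open>A window starting at a disagreement k has its exceptional position at k. The
        bound 1 ensures that k is the start of some window, and the bound m that all indices from m
        on come after k.\<close>
      obtain k where k: "k < min m 1" "x k \<noteq> y k" using False by blast
      define n where "n = nat (1 - k)"
      have n: "1 - int n = k" using k(1) by (simp add: n_def)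
      from x y win[of n] show ?thesis
      proof (cases rule: window_cases)
        case 1
        then show ?thesis using k(2) n by simp
      next
        case (carry p j h)
        then have "p = k" using k(2) n by force
        then show ?thesis using carry(2,6) k(1) by (intro exI[of _ j] allI impI bexI[of _ "h _"]) auto
      next
        case (opposite p j h)
        then have "p = k" using k(2) n by force
        then show ?thesis using opposite(2,5) k(1) by (intro exI[of _ j] allI impI bexI[of _ "h _"]) auto
      qed
    qed
    \<comment> \<open>Every window reaching back to 0 has the index read off from
      \<open>x 0\<close>, so the index does not depend on the window.\<close>
    define j where "j = eps H \<xi> (x 0)"
    have "\<exists>h\<in>arcs H. x i = xa j h \<and> y i = xa (\<not> j) h" for i
    proof -
      obtain j' where j': "\<forall>k\<ge>min i 0. \<exists>h\<in>arcs H. x k = xa j' h \<and> y k = xa (\<not> j') h"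
        using copies by blast
      then have "j' = j" unfolding j_def by (metis eps_xa min.cobounded2)
      then show ?thesis using j' by simp
    qed
    then obtain h where h: "\<And>i. h i \<in> arcs H" "\<And>i. x i = xa j (h i)" "\<And>i. y i = xa (\<not> j) (h i)"
      by metis
    have "head H (h i) = tail H (h (i + 1))" for i by (rule path_of_copies[OF x]) (rule h)+
    then have "h \<in> two_sided H" by (simp add: two_sided_def h)
    then have "swapped H \<xi> x y" unfolding swapped_def using h by metis
    then show ?thesis ..
  qed
qed

lemma pi_xi_eq_iff_exactly_one:
  assumes "x \<in> two_sided G" "y \<in> two_sided G"
  shows "px x = px y \<longleftrightarrow> exactly_one (x = y) (swapped H \<xi> x y) (swapped_after_fwd H \<xi> x y)"
proof -
  have "\<not> swapped H \<xi> x y" "\<not> swapped_after_fwd H \<xi> x y" if "x = y"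
  proof -
    show "\<not> swapped H \<xi> x y" using swapped_imp_neq[of x y 0] that by auto
    show "\<not> swapped_after_fwd H \<xi> x y"
    proof
      assume "swapped_after_fwd H \<xi> x y"
      then obtain m where "\<And>n. n > m \<Longrightarrow> x n \<noteq> y n" by (rule swapped_after_fwd_bounds) blast
      from this[of "m + 1"] that show False by simp
    qed
  qed
  moreover have "\<not> swapped_after_fwd H \<xi> x y" if "swapped H \<xi> x y"
  proof
    assume "swapped_after_fwd H \<xi> x y"
    then obtain m where "\<And>n. n < m \<Longrightarrow> x n = y n" by (rule swapped_after_fwd_bounds) blast
    from this[of "m - 1"] show False using swapped_imp_neq[OF that, of "m - 1"] by simp
  qed
  ultimately show ?thesis
    using swapped_imp_pi_xi_eq[OF assms] swapped_after_fwd_imp_pi_xi_eq[OF assms] pi_xi_eq_imp[OF assms]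
    unfolding exactly_one_def by blast
qed

end

section \<open>The two forms of the third alternative\<close>

lemma extend_path_backwards:
  fixes s :: int
  assumes "\<forall>a\<in>arcs H. \<exists>b\<in>arcs H. head H b = tail H a"
    and "\<And>n. n \<ge> s \<Longrightarrow> z n \<in> arcs H \<and> head H (z n) = tail H (z (n + 1))"
  obtains z' where "z' \<in> two_sided H" "\<And>n. n \<ge> s \<Longrightarrow> z' n = z n"
proof -
  obtain pr where pr: "\<And>a. a \<in> arcs H \<Longrightarrow> pr a \<in> arcs H \<and> head H (pr a) = tail H a"
    using assms(1) by metis
  define z' where "z' n = (if n \<ge> s then z n else (pr ^^ nat (s - n)) (z s))" for n
  have arcs: "(pr ^^ i) (z s) \<in> arcs H" for i
    using assms(2)[of s] pr by (induction i) auto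
  have "z' n \<in> arcs H \<and> head H (z' n) = tail H (z' (n + 1))" for n
  proof (cases "n \<ge> s")
    case True
    then show ?thesis using assms(2)[of n] by (simp add: z'_def)
  next
    case False
    define i where "i = nat (s - (n + 1))"
    have "nat (s - n) = Suc i" using False by (simp add: i_def)
    then have "z' n = pr ((pr ^^ i) (z s))" using False by (simp add: z'_def)
    moreover have "z' (n + 1) = (pr ^^ i) (z s)"
    proof (cases "n + 1 = s")
      case True
      then show ?thesis by (simp add: z'_def i_def)
    next
      case neq: False
      with False have "\<not> n + 1 \<ge> s" by linarith
      then show ?thesis by (simp only: z'_def i_def if_False)
    qed
    ultimately show ?thesis using pr[OF arcs] by simp
  qed
  then have "z' \<in> two_sided H" by (simp add: two_sided_def)
  then show ?thesis using that[of z'] by (simp add: z'_def)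
qed

text \<open>A forward path of H is completed by predecessors at the indices that x and y do not
  constrain: those up to m if x_m lies outside \<xi>(H^1), and those before m otherwise.\<close>

lemma swapped_after_iff_fwd:
  assumes pred: "\<forall>a\<in>arcs H. \<exists>b\<in>arcs H. head H b = tail H a"
  shows "swapped_after H \<xi> x y \<longleftrightarrow> swapped_after_fwd H \<xi> x y"
proof
  assume "swapped_after H \<xi> x y"
  then obtain m j z where "z \<in> two_sided H" "\<forall>n<m. x n = y n"
    "x m = y m \<and> x m \<notin> xi_arcs H \<xi> \<or> arc_map (\<xi> (\<not> j)) (z m) = x m \<and> arc_map (\<xi> j) (z m) = y m"
    "\<forall>n>m. arc_map (\<xi> j) (z n) = x n \<and> arc_map (\<xi> (\<not> j)) (z n) = y n"
    unfolding swapped_after_def by blast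
  then show "swapped_after_fwd H \<xi> x y"
    unfolding swapped_after_fwd_def
    by (intro exI[of _ m] exI[of _ j] exI[of _ z]) (auto simp: two_sided_arc two_sided_path)
next
  assume "swapped_after_fwd H \<xi> x y"
  then obtain m j z where path: "\<forall>n>m. z n \<in> arcs H \<and> head H (z n) = tail H (z (n + 1))"
    and pre: "\<forall>n<m. x n = y n"
    and mid: "x m = y m \<and> x m \<notin> xi_arcs H \<xi> \<or> z m \<in> arcs H \<and> head H (z m) = tail H (z (m + 1)) \<and>
      arc_map (\<xi> (\<not> j)) (z m) = x m \<and> arc_map (\<xi> j) (z m) = y m"
    and post: "\<forall>n>m. arc_map (\<xi> j) (z n) = x n \<and> arc_map (\<xi> (\<not> j)) (z n) = y n"
    unfolding swapped_after_fwd_def by blast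
  from mid show "swapped_after H \<xi> x y"
  proof
    assume m: "x m = y m \<and> x m \<notin> xi_arcs H \<xi>"
    obtain z' where "z' \<in> two_sided H" "\<And>n. n \<ge> m + 1 \<Longrightarrow> z' n = z n"
      using extend_path_backwards[OF pred, of "m + 1" z] path by auto
    then show ?thesis
      unfolding swapped_after_def using pre m post
      by (intro exI[of _ m] exI[of _ j] bexI[of _ z']) auto
  next
    assume m: "z m \<in> arcs H \<and> head H (z m) = tail H (z (m + 1)) \<and>
      arc_map (\<xi> (\<not> j)) (z m) = x m \<and> arc_map (\<xi> j) (z m) = y m"
    have "z n \<in> arcs H \<and> head H (z n) = tail H (z (n + 1))" if "n \<ge> m" for n
      using path m that by (cases "n = m") auto
    then obtain z' where "z' \<in> two_sided H" "\<And>n. n \<ge> m \<Longrightarrow> z' n = z n"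
      using extend_path_backwards[OF pred, of m z] by blast
    then show ?thesis
      unfolding swapped_after_def using pre m post
      by (intro exI[of _ m] exI[of _ j] bexI[of _ z']) auto
  qed
qed

context doubled_graph
begin

subsection \<open>Stable sets\<close>

lemma stable_set_two_sided_iff:
  assumes "x \<in> two_sided G"
  shows "y \<in> stable_set (two_sided G) dist2 shift2 x \<longleftrightarrow> y \<in> two_sided G \<and> (\<exists>N. \<forall>k\<ge>N. x k = y k)"
proof (intro iffI conjI)
  assume S: "y \<in> stable_set (two_sided G) dist2 shift2 x"
  then show "y \<in> two_sided G" by (simp add: stable_set_def)
  have "(\<lambda>n. dist2 ((shift2 ^^ n) x) ((shift2 ^^ n) y)) \<longlonglongrightarrow> 0"
    using S by (simp add: stable_set_def)
  then have "\<forall>\<^sub>F n in sequentially. dist2 ((shift2 ^^ n) x) ((shift2 ^^ n) y) < 1"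
    by (rule order_tendstoD) simp
  then obtain N where N: "\<And>n. n \<ge> N \<Longrightarrow> dist2 ((shift2 ^^ n) x) ((shift2 ^^ n) y) < 1"
    by (auto simp: eventually_sequentially)
  have "x k = y k" if "k \<ge> int N" for k
  proof -
    \<comment> \<open>The first pair of the folded sequence contains the entry 0, which after k
      shifts is the entry k of the original.\<close>
    have "nat k \<ge> N" using that by simp
    then have "fold_int ((shift2 ^^ nat k) x) 0 = fold_int ((shift2 ^^ nat k) y) 0"
      using N unfolding dist2_eq by (intro dist1_less_1) blast
    then show ?thesis using that by (simp add: fold_int_def shift2_funpow)
  qed
  then show "\<exists>N. \<forall>k\<ge>N. x k = y k" by blast
next
  assume "y \<in> two_sided G \<and> (\<exists>N. \<forall>k\<ge>N. x k = y k)"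
  then obtain N where y: "y \<in> two_sided G" and N: "\<And>k. k \<ge> N \<Longrightarrow> x k = y k" by blast
  have lim: "(\<lambda>n. (1/2::real) ^ (n - nat N)) \<longlonglongrightarrow> 0"
    using LIMSEQ_offset[of "\<lambda>n. (1/2::real) ^ (n - nat N)" "nat N"] by (simp add: LIMSEQ_realpow_zero)
  have le: "dist2 ((shift2 ^^ n) x) ((shift2 ^^ n) y) \<le> (1/2) ^ (n - nat N)" for n
  proof (cases "nat N < n")
    case True
    then show ?thesis unfolding dist2_le_iff by (auto simp: shift2_funpow intro!: N)
  next
    case False
    then show ?thesis using dist1_le_1 by (simp add: dist2_eq)
  qed
  have "(\<lambda>n. dist2 ((shift2 ^^ n) x) ((shift2 ^^ n) y)) \<longlonglongrightarrow> 0"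
    by (rule tendsto_sandwich[OF _ _ tendsto_const lim])
      (use le in \<open>auto simp: dist2_eq dist1_nonneg\<close>)
  with y show "y \<in> stable_set (two_sided G) dist2 shift2 x" by (simp add: stable_set_def)
qed

lemma inj_sigma_xi: "p \<in> X \<Longrightarrow> q \<in> X \<Longrightarrow> sigma_xi G H \<xi> p = sigma_xi G H \<xi> q \<Longrightarrow> p = q"
proof
  fix n assume "p \<in> X" "q \<in> X" "sigma_xi G H \<xi> p = sigma_xi G H \<xi> q"
  then show "p n = q n" using X_shift[of p n] X_shift[of q n]
    by (metis sigma_xi_def)
qed

lemma pi_xi_shift2_funpow_eqD:
  assumes "x \<in> two_sided G" "y \<in> two_sided G" "px ((shift2 ^^ n) x) = px ((shift2 ^^ n) y)"
  shows "px x = px y"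
  using assms(3)
proof (induction n)
  case (Suc n)
  have "sigma_xi G H \<xi> (px ((shift2 ^^ n) x)) = sigma_xi G H \<xi> (px ((shift2 ^^ n) y))"
    using Suc.prems by (simp add: sigma_xi_pi_xi shift2_funpow_two_sided assms)
  then have "px ((shift2 ^^ n) x) = px ((shift2 ^^ n) y)"
    by (rule inj_sigma_xi[rotated 2]) (simp_all add: pi_xi_in_X shift2_funpow_two_sided assms)
  then show ?case by (rule Suc.IH)
qed simp

lemma pi_xi_stable_set:
  assumes x: "x \<in> two_sided G" and S: "y \<in> stable_set (two_sided G) dist2 shift2 x"
  shows "px y \<in> stable_set X (d_xi G H \<xi>) (sigma_xi G H \<xi>) (px x)"
proof -
  have y: "y \<in> two_sided G" and lim: "(\<lambda>n. dist2 ((shift2 ^^ n) x) ((shift2 ^^ n) y)) \<longlonglongrightarrow> 0"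
    using S by (simp_all add: stable_set_def)
  have lim3: "(\<lambda>n. 3 * dist2 ((shift2 ^^ n) x) ((shift2 ^^ n) y)) \<longlonglongrightarrow> 0"
    using tendsto_mult_right_zero[OF lim, of 3] by simp
  have "(\<lambda>n. d_xi G H \<xi> ((sigma_xi G H \<xi> ^^ n) (px x)) ((sigma_xi G H \<xi> ^^ n) (px y))) \<longlonglongrightarrow> 0"
    by (rule tendsto_sandwich[OF _ _ tendsto_const lim3])
      (auto simp: sigma_xi_funpow_pi_xi x y d_xi_nonneg intro!: always_eventually d_xi_pi_xi_le shift2_funpow_two_sided)
  then show ?thesis by (simp add: stable_set_def pi_xi_in_X y)
qed

text \<open>Points of one stable set agree from some index on, whereas different points with the
  same image disagree from some index on.\<close>

lemma pi_xi_inj_on_stable_set: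
  assumes x: "x \<in> two_sided G"
  shows "inj_on px (stable_set (two_sided G) dist2 shift2 x)"
proof
  fix y z
  assume "y \<in> stable_set (two_sided G) dist2 shift2 x" "z \<in> stable_set (two_sided G) dist2 shift2 x"
    and eq: "px y = px z"
  then obtain M N where y: "y \<in> two_sided G" "\<And>k. k \<ge> M \<Longrightarrow> x k = y k"
    and z: "z \<in> two_sided G" "\<And>k. k \<ge> N \<Longrightarrow> x k = z k"
    using stable_set_two_sided_iff[OF x] by metis
  have yz: "y k = z k" if "k \<ge> max M N" for k using y(2)[of k] z(2)[of k] that by simp
  show "y = z"
  proof (rule ccontr)
    assume "y \<noteq> z"
    with eq y z have "swapped H \<xi> y z \<or> swapped_after_fwd H \<xi> y z" by (intro pi_xi_eq_imp)
    then show False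
    proof
      assume "swapped H \<xi> y z"
      then show False using swapped_imp_neq yz by blast
    next
      assume "swapped_after_fwd H \<xi> y z"
      then obtain m where "\<And>n. n > m \<Longrightarrow> y n \<noteq> z n" by (rule swapped_after_fwd_bounds) blast
      then have "y k \<noteq> z k" if "k > m" for k using that by blast
      from this[of "max (m + 1) (max M N)"] yz[of "max (m + 1) (max M N)"] show False
        by (auto simp: less_max_iff_disj)
    qed
  qed
qed

text \<open>An arbitrary preimage y of p need not be asymptotic to x. But after N steps
  expansiveness identifies the right halves of x and y in the quotient, so the image of the N-th
  shift of y has a lift whose right half is literally that of the shifted x. Shifting this lift back
  gives the required point.\<close>

lemma stable_set_lift:
  assumes x: "x \<in> two_sided G" and p: "p \<in> stable_set X (d_xi G H \<xi>) (sigma_xi G H \<xi>) (px x)"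
  shows "p \<in> px ` stable_set (two_sided G) dist2 shift2 x"
proof -
  have "p \<in> px ` two_sided G" using p by (simp add: stable_set_def pi_xi_surj)
  then obtain y where y: "y \<in> two_sided G" "px y = p" by blast
  let ?x = "\<lambda>n. (shift2 ^^ n) x" and ?y = "\<lambda>n. (shift2 ^^ n) y"
  have os: "?x n \<in> two_sided G" "?y n \<in> two_sided G" for n
    by (simp_all add: shift2_funpow_two_sided x y)
  have "(\<lambda>n. d_xi G H \<xi> (px (?x n)) (px (?y n))) \<longlonglongrightarrow> 0"
    using p y(2) by (auto simp: stable_set_def sigma_xi_funpow_pi_xi x simp flip: sigma_xi_funpow_pi_xi[OF y(1)])
  then have "\<forall>\<^sub>F n in sequentially. d_xi G H \<xi> (px (?x n)) (px (?y n)) < 1/4"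
    by (rule order_tendstoD) simp
  then obtain N where N: "\<And>n. n \<ge> N \<Longrightarrow> d_xi G H \<xi> (px (?x n)) (px (?y n)) < 1/4"
    by (auto simp: eventually_sequentially)
  have "lim_dist (past (?x N) 0) (past (?y N) 0) = 0"
  proof (rule lim_dist_expansive)
    fix n
    have eq: "(shift1 ^^ n) (past (?x N) 0) = past (?x (n + N)) 0" "(shift1 ^^ n) (past (?y N) 0) = past (?y (n + N)) 0"
      by (simp_all add: past_shift2_funpow[symmetric] funpow_add)
    have "lim_dist (past (?x (n + N)) 0) (past (?y (n + N)) 0) \<le> d_xi G H \<xi> (px (?x (n + N))) (px (?y (n + N)))"
      using d_xi_ge[of 0 "px (?x (n + N))" "px (?y (n + N))"] q_dist_pi_xi[OF os(1)[of "n + N"] os(2)[of "n + N"], of 0] by simp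
    also have "\<dots> < 1/4" by (rule N) simp
    finally show "lim_dist ((shift1 ^^ n) (past (?x N) 0)) ((shift1 ^^ n) (past (?y N) 0)) < 1/4"
      unfolding eq .
  qed (simp_all add: past_one_sided os)
  then have "past (?x N) 0 \<in> px (?y N) 0"
    by (simp add: pi_xi_nth mem_pi1_iff past_one_sided os lim_dist_sym)
  with pi_xi_in_X[OF os(2)] obtain w
    where w: "w \<in> two_sided G" "px w = px (?y N)" "past w 0 = past (?x N) 0" by (rule X_lift)
  define v where "v = (\<lambda>k. w (k - int N))"
  have v: "v \<in> two_sided G" using w(1) by (auto simp: two_sided_def v_def algebra_simps)
  have "(shift2 ^^ N) v = w" by (simp add: v_def shift2_funpow)
  then have "px v = p" using pi_xi_shift2_funpow_eqD[OF v y(1), of N] w(2) y(2) by simp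
  moreover have "x k = v k" if "k \<ge> int N + 1" for k
  proof -
    have "past w 0 (nat (k - int N - 1)) = past (?x N) 0 (nat (k - int N - 1))" by (simp only: w(3))
    then show ?thesis using that by (simp add: past_nth shift2_funpow v_def)
  qed
  then have "v \<in> stable_set (two_sided G) dist2 shift2 x"
    using v stable_set_two_sided_iff[OF x] by blast
  ultimately show ?thesis by blast
qed

lemma pi_xi_s_bijective:
  assumes "x \<in> two_sided G"
  shows "bij_betw px (stable_set (two_sided G) dist2 shift2 x)
    (stable_set X (d_xi G H \<xi>) (sigma_xi G H \<xi>) (px x))"
  unfolding bij_betw_def
  using pi_xi_inj_on_stable_set pi_xi_stable_set stable_set_lift assms by blast

end

theorem theorem4p3:
  fixes G :: "('v, 'e) pre_digraph" and H :: "('w, 'f) pre_digraph"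
    and \<xi> :: "bool \<Rightarrow> ('w, 'f, 'v, 'e) graph_map"
  assumes "fin_digraph G" and "fin_digraph H"
    and "\<And>j. graph_embedding H G (\<xi> j)"
    and "standing_hypotheses G H \<xi>"
  shows "(factor_map (two_sided G) dist2 shift2 (X_xi G H \<xi>) (d_xi G H \<xi>) (sigma_xi G H \<xi>)
       (pi_xi G H \<xi>)) \<and>
    (\<forall>x\<in>two_sided G. \<forall>y\<in>two_sided G. dist2 x y \<le> (1/2) ^ 3 \<longrightarrow>
       dist2 x y \<le> 1/2 \<and> bracket2 x y \<in> two_sided G \<and>
       bracket_xi_defined G H \<xi> (pi_xi G H \<xi> x) (pi_xi G H \<xi> y) \<and>
       pi_xi G H \<xi> (bracket2 x y) = bracket_xi G H \<xi> (pi_xi G H \<xi> x) (pi_xi G H \<xi> y)) \<and>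
    (\<forall>x\<in>two_sided G. \<forall>y\<in>two_sided G.
       pi_xi G H \<xi> x = pi_xi G H \<xi> y \<longleftrightarrow>
       exactly_one (x = y) (swapped H \<xi> x y) (swapped_after_fwd H \<xi> x y)) \<and>
    ((\<forall>a\<in>arcs H. \<exists>b\<in>arcs H. head H b = tail H a) \<longrightarrow>
       (\<forall>x\<in>two_sided G. \<forall>y\<in>two_sided G.
          pi_xi G H \<xi> x = pi_xi G H \<xi> y \<longleftrightarrow>
          exactly_one (x = y) (swapped H \<xi> x y) (swapped_after H \<xi> x y))) \<and>
    (\<forall>x\<in>two_sided G.
       bij_betw (pi_xi G H \<xi>) (stable_set (two_sided G) dist2 shift2 x)
         (stable_set (X_xi G H \<xi>) (d_xi G H \<xi>) (sigma_xi G H \<xi>) (pi_xi G H \<xi> x)))"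
proof -
  interpret doubled_graph G H \<xi>
    by (rule doubled_graph.intro) (fact assms)+
  have close: "dist2 x y \<le> 1/2" if "dist2 x y \<le> (1/2) ^ 3" for x y :: "int \<Rightarrow> 'e"
    using that by (simp add: power3_eq_cube)
  show ?thesis
    using factor_map_pi_xi close bracket_pi_xi pi_xi_eq_iff_exactly_one
      swapped_after_iff_fwd[of H \<xi>] pi_xi_s_bijective
    by (intro conjI ballI impI) auto
qed

end
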